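(* Let $\mathcal G=(\mathcal G_1,\dots,\mathcal G_M):X\to\mathbb R^M$, $\mathcal G_i(u)=\int_0^T\int_0^{x^*}\mathcal H_i(x,t)\,p[u](x,t)\,dx\,dt$, where $\mathcal H_i\in L^\infty(D_T)$ for $i=1,\dots,M$ and $p[u]$ is the pressure of the one-dimensional moving-boundary Darcy model. Then each $\mathcal G_i$ is Fréchet differentiable over the Cameron--Martin space $E$ (i.e. at every $u\in E$, with respect to perturbations $h\in E$). Moreover, for every $h\in E$, $$D\mathcal G_i(u)h=\langle r_i[u],h\rangle_{L^2(D)},$$ where, writing $\Upsilon(t)=\Upsilon[u](t)$, \begin{align*} r_i[u](z)=(p_I-p_0)e^{-u(z)}\int_0^T\mathbb I_{\{z<\Upsilon(t)\}}\Bigg[&\frac{1}{F[u](\Upsilon(t))}\int_z^{\Upsilon(t)}\mathcal H_i(x,t)\,dx-\frac{1}{F[u](\Upsilon(t))^2}\int_0^{\Upsilon(t)}\mathcal H_i(x,t)F[u](x)\,dx\\ &+\mathbb I_{\{t<\tau^*[u]\}}\frac{\Upsilon(t)-z}{F[u](\Upsilon(t))^3}\,e^{-u(\Upsilon(t))}\int_0^{\Upsilon(t)}\mathcal H_i(x,t)F[u](x)\,dx\Bigg]dt . \end{align*}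
   Context: Let $x^*>0$, $D=(0,x^* )$, $T>0$, $D_T=D\times(0,T]$, $X=C(\overline D)$ with the supremum norm; $\mu_f,\phi>0$ and $p_I>p_0$ are constants. For $u\in X$ put $F[u](x)=\int_0^xe^{-u(z)}dz$, $W[u](x)=\int_0^xF[u](\xi)\,d\xi$ and filling time $\tau^*[u]=\frac{\mu_f\phi}{p_I-p_0}W[u](x^* )$. The moving front is $\Upsilon[u](t)=W[u]^{-1}\bigl(\frac{p_I-p_0}{\mu_f\phi}t\bigr)$ for $t<\tau^*[u]$ and $\Upsilon[u](t)=x^*$ for $t\ge\tau^*[u]$. The pressure, for $t\in(0,T]$, is $$p[u](x,t)=\begin{cases}p_I-(p_I-p_0)\dfrac{F[u](x)}{F[u](\Upsilon[u](t))},&x\in(0,\Upsilon[u](t)),\\ p_0,&x\in D\setminus(0,\Upsilon[u](t)).\end{cases}$$ (This is the explicit solution of $-(e^up_x)_x=0$ on $(0,\Upsilon(t))$, $\dot\Upsilon=-\frac1{\mu_f\phi}e^{u(\Upsilon)}p_x(\Upsilon,t)$, $\Upsilon(0)=0$, $p(0,t)=p_I$, $p(\Upsilon(t),t)=p_0$, $p(x,0)=p_0$, with $\Upsilon=x^*$ after filling.) $E=\operatorname{Range}(\mathcal C_0^{1/2})$ with $\langle h_1,h_2\rangle_E=\langle\mathcal C_0^{-1/2}h_1,\mathcal C_0^{-1/2}h_2\rangle_{L^2(D)}$ is the Cameron--Martin space of the Gaussian prior with Matérn covariance $\mathcal C_0=\sigma^2(\varkappa^2I-\Delta)^{-(\nu+d/2)}$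 on $L^2(D)$, $d=1$, $\sigma,\varkappa>0$, $\nu>d/2$ (fractional power defined spectrally with appropriate boundary conditions); $E$ is norm-equivalent to $H^{\nu+d/2}(D)$ (subject to the boundary conditions) and compactly embedded in $X$. $\mathbb I_A$ denotes an indicator. *)

theory Defs
  imports "HOL-Analysis.Analysis"
begin

section \<open>Lebesgue spaces\<close>

definition L2 :: "real set \<Rightarrow> (real \<Rightarrow> real) set" where
  "L2 S = {f. f \<in> borel_measurable (lebesgue_on S) \<and> integrable (lebesgue_on S) (\<lambda>x. (f x)\<^sup>2)}"

definition L2_inner :: "real set \<Rightarrow> (real \<Rightarrow> real) \<Rightarrow> (real \<Rightarrow> real) \<Rightarrow> real" where
  "L2_inner S f g = (LINT x|lebesgue_on S. f x * g x)"

definition Linfty :: "(real \<times> real) set \<Rightarrow> (real \<times> real \<Rightarrow> real) set" where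
  "Linfty S = {f. f \<in> borel_measurable (lebesgue_on S) \<and>
                  (\<exists>C. AE z in lebesgue_on S. \<bar>f z\<bar> \<le> C)}"

section \<open>The one-dimensional moving-boundary Darcy model\<close>

text \<open>Throughout, \<open>D = {0<..<xs}\<close> with \<open>xs > 0\<close> the right end point. Elements of
  \<open>X = C(closure D)\<close> are functions on the reals that are continuous on \<open>{0..xs}\<close>;
  nothing below depends on their values outside \<open>{0..xs}\<close>.\<close>

definition F_int :: "(real \<Rightarrow> real) \<Rightarrow> real \<Rightarrow> real" where
  "F_int u x = (LINT z:{0..x}|lebesgue. exp (- u z))"

definition W_int :: "(real \<Rightarrow> real) \<Rightarrow> real \<Rightarrow> real" where
  "W_int u x = (LINT y:{0..x}|lebesgue. F_int u y)"

definition filling_time :: "real \<Rightarrow> real \<Rightarrow> real \<Rightarrow> real \<Rightarrow> real \<Rightarrow> (real \<Rightarrow> real) \<Rightarrow> real" where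
  "filling_time xs muf phi pI p0 u = muf * phi / (pI - p0) * W_int u xs"

definition front :: "real \<Rightarrow> real \<Rightarrow> real \<Rightarrow> real \<Rightarrow> real \<Rightarrow> (real \<Rightarrow> real) \<Rightarrow> real \<Rightarrow> real" where
  "front xs muf phi pI p0 u t =
     (if t < filling_time xs muf phi pI p0 u
      then the_inv_into {0..xs} (W_int u) ((pI - p0) / (muf * phi) * t)
      else xs)"

definition pressure ::
  "real \<Rightarrow> real \<Rightarrow> real \<Rightarrow> real \<Rightarrow> real \<Rightarrow> (real \<Rightarrow> real) \<Rightarrow> real \<Rightarrow> real \<Rightarrow> real" where
  "pressure xs muf phi pI p0 u x t =
     (let Y = front xs muf phi pI p0 u t
      in if x \<in> {0<..<Y} then pI - (pI - p0) * (F_int u x / F_int u Y) else p0)"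

definition observation_map ::
  "real \<Rightarrow> real \<Rightarrow> real \<Rightarrow> real \<Rightarrow> real \<Rightarrow> real \<Rightarrow> ('m::finite \<Rightarrow> real \<times> real \<Rightarrow> real)
     \<Rightarrow> (real \<Rightarrow> real) \<Rightarrow> real ^ 'm" where
  "observation_map xs muf phi pI p0 T H u =
     (\<chi> i. LINT t:{0<..T}|lebesgue. LINT x:{0<..<xs}|lebesgue.
              H i (x, t) * pressure xs muf phi pI p0 u x t)"

definition representer ::
  "real \<Rightarrow> real \<Rightarrow> real \<Rightarrow> real \<Rightarrow> real \<Rightarrow> real \<Rightarrow> (real \<times> real \<Rightarrow> real)
     \<Rightarrow> (real \<Rightarrow> real) \<Rightarrow> real \<Rightarrow> real" where
  "representer xs muf phi pI p0 T H u z =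
     (pI - p0) * exp (- u z) *
     (LINT t:{0<..T}|lebesgue.
        (let Y = front xs muf phi pI p0 u t in
          of_bool (z < Y) *
           (1 / F_int u Y * (LINT x:{z..Y}|lebesgue. H (x, t))
            - 1 / (F_int u Y)\<^sup>2 * (LINT x:{0..Y}|lebesgue. H (x, t) * F_int u x)
            + of_bool (t < filling_time xs muf phi pI p0 u) *
              ((Y - z) / (F_int u Y) ^ 3) * exp (- u Y) *
              (LINT x:{0..Y}|lebesgue. H (x, t) * F_int u x))))"

section \<open>The Matern covariance and its Cameron--Martin space\<close>

text \<open>An orthonormal basis of \<open>L2 {0<..<xs}\<close> consisting of eigenfunctions of \<open>- d\<^sup>2/dx\<^sup>2\<close>. Such a
  basis is the spectral resolution of a self-adjoint realisation of \<open>-\<Delta>\<close>, and every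
  self-adjoint boundary condition (Dirichlet, Neumann, mixed, Robin, periodic) has
  one; so the pair \<open>(e, lam)\<close> is the choice of boundary condition.\<close>

definition laplace_eigenbasis :: "real \<Rightarrow> (nat \<Rightarrow> real \<Rightarrow> real) \<Rightarrow> (nat \<Rightarrow> real) \<Rightarrow> bool" where
  "laplace_eigenbasis xs e lam \<longleftrightarrow>
     (\<forall>k. \<exists>e'. \<forall>x\<in>{0..xs}.
        (e k has_real_derivative e' x) (at x within {0..xs}) \<and>
        (e' has_real_derivative - (lam k * e k x)) (at x within {0..xs})) \<and>
     (\<forall>j k. L2_inner {0<..<xs} (e j) (e k) = of_bool (j = k)) \<and>
     (\<forall>g\<in>L2 {0<..<xs}. (\<forall>k. L2_inner {0<..<xs} g (e k) = 0)
        \<longrightarrow> (AE x in lebesgue_on {0<..<xs}. g x = 0))"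

text \<open>The eigenvalues of \<open>C\<^sub>0 = \<sigma>\<^sup>2 (\<kappa>\<^sup>2 I - \<Delta>)\<^bsup>-(\<nu> + d/2)\<^esup>\<close> for \<open>d = 1\<close>.\<close>

definition matern_eigenvalue ::
  "real \<Rightarrow> real \<Rightarrow> real \<Rightarrow> (nat \<Rightarrow> real) \<Rightarrow> nat \<Rightarrow> real" where
  "matern_eigenvalue sig kap nu lam k = sig\<^sup>2 * (kap\<^sup>2 + lam k) powr (- (nu + 1/2))"

text \<open>\<open>spectral_power xs e c r g h\<close> says \<open>h = C\<^bsup>r\<^esup> g\<close> in \<open>L2\<close> (that is, almost everywhere), where \<open>C\<close> is
  the operator with \<open>C (e k) = c k * e k\<close>.\<close>

definition spectral_power ::
  "real \<Rightarrow> (nat \<Rightarrow> real \<Rightarrow> real) \<Rightarrow> (nat \<Rightarrow> real) \<Rightarrow> real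
     \<Rightarrow> (real \<Rightarrow> real) \<Rightarrow> (real \<Rightarrow> real) \<Rightarrow> bool" where
  "spectral_power xs e c r g h \<longleftrightarrow>
     g \<in> L2 {0<..<xs} \<and> h \<in> L2 {0<..<xs} \<and>
     (\<forall>k. L2_inner {0<..<xs} h (e k) = c k powr r * L2_inner {0<..<xs} g (e k))"

text \<open>\<open>E = Range (C\<^bsup>1/2\<^esup>)\<close>, each class being represented by its continuous representative, which
  exists for the Matern covariance because \<open>E\<close> embeds in \<open>C(closure D)\<close>.\<close>

definition cm_space ::
  "real \<Rightarrow> (nat \<Rightarrow> real \<Rightarrow> real) \<Rightarrow> (nat \<Rightarrow> real) \<Rightarrow> (real \<Rightarrow> real) set" where
  "cm_space xs e c = {h. continuous_on {0..xs} h \<and> (\<exists>g. spectral_power xs e c (1/2) g h)}"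

text \<open>\<open>C\<^bsup>-1/2\<^esup> h\<close>, determined up to a null set for \<open>h \<in> E\<close>, since \<open>c k > 0\<close> and \<open>e\<close> is complete.\<close>

definition cov_inv_sqrt ::
  "real \<Rightarrow> (nat \<Rightarrow> real \<Rightarrow> real) \<Rightarrow> (nat \<Rightarrow> real) \<Rightarrow> (real \<Rightarrow> real) \<Rightarrow> real \<Rightarrow> real" where
  "cov_inv_sqrt xs e c h = (SOME g. spectral_power xs e c (1/2) g h)"

definition cm_inner ::
  "real \<Rightarrow> (nat \<Rightarrow> real \<Rightarrow> real) \<Rightarrow> (nat \<Rightarrow> real) \<Rightarrow> (real \<Rightarrow> real) \<Rightarrow> (real \<Rightarrow> real) \<Rightarrow> real" where
  "cm_inner xs e c h1 h2 = L2_inner {0<..<xs} (cov_inv_sqrt xs e c h1) (cov_inv_sqrt xs e c h2)"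

definition cm_norm ::
  "real \<Rightarrow> (nat \<Rightarrow> real \<Rightarrow> real) \<Rightarrow> (nat \<Rightarrow> real) \<Rightarrow> (real \<Rightarrow> real) \<Rightarrow> real" where
  "cm_norm xs e c h = sqrt (cm_inner xs e c h h)"

section \<open>Frechet differentiability over a normed space of functions\<close>

text \<open>\<open>has_derivative\<close> requires a normed space that is a type, whereas \<open>E\<close> with its norm depends on
  the parameters; so the definition is repeated for a carrier set \<open>V\<close> with norm \<open>N\<close>: the derivative
  \<open>A\<close> at \<open>u\<close> is linear and bounded on \<open>V\<close>, and the remainder is \<open>o(N h)\<close> as \<open>N h \<rightarrow> 0\<close> in \<open>V\<close>.\<close>

definition has_frechet_derivative_over ::
  "((real \<Rightarrow> real) \<Rightarrow> real) \<Rightarrow> ((real \<Rightarrow> real) \<Rightarrow> real) \<Rightarrow> (real \<Rightarrow> real)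
     \<Rightarrow> (real \<Rightarrow> real) set \<Rightarrow> ((real \<Rightarrow> real) \<Rightarrow> real) \<Rightarrow> bool" where
  "has_frechet_derivative_over G A u V N \<longleftrightarrow>
     (\<forall>h\<in>V. \<forall>k\<in>V. \<forall>a b. A (\<lambda>x. a * h x + b * k x) = a * A h + b * A k) \<and>
     (\<exists>B. \<forall>h\<in>V. \<bar>A h\<bar> \<le> B * N h) \<and>
     (\<forall>eps>0. \<exists>del>0. \<forall>h\<in>V. N h < del \<longrightarrow>
        \<bar>G (\<lambda>x. u x + h x) - G u - A h\<bar> \<le> eps * N h)"

end

theory Submission
  imports Defs
begin

text \<open>
Two independent facts give the theorem: the observation map is Frechet differentiable at every continuous
\<open>u\<close> for the supremum norm, with the stated derivative, and the Cameron--Martin norm dominates the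
supremum norm.

\<^emph>\<open>Embedding\<close> (\<open>cm_space_embeds_continuous\<close>). If \<open>h = C\<^bsup>1/2\<^esup>
g\<close>, Cauchy--Schwarz bounds the partial sums of the eigenfunction expansion of \<open>h\<close> at
\<open>x\<close> by the norm of \<open>g\<close> times the square root of \<open>\<Sum>\<^sub>k c\<^sub>k
e\<^sub>k(x)\<^sup>2\<close>, so that the issue is to bound this sum uniformly in \<open>x\<close> for an arbitrary
self-adjoint boundary condition. A cubic weight on an interval of length \<open>d\<close> with end point
\<open>x\<close>, vanishing to second order at the other end, recovers \<open>e\<^sub>k(x)\<close> from
\<open>L\<^sup>2\<close> products with \<open>e\<^sub>k\<close>, by Green's formula and without reference to the
boundary condition. Bessel's inequality then gives \<open>\<Sum> e\<^sub>k(x)\<^sup>2 \<le> 34/d\<close> over all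
\<open>k\<close> with \<open>\<bar>\<lambda>\<^sub>k\<bar> \<le> 1/d\<^sup>2\<close> when \<open>d\<close> is at most
half the length of \<open>D\<close> (\<open>local_weyl_bound\<close>), and dyadic summation over \<open>d\<close>
closes the argument. The expansion converges uniformly, and by completeness of the eigenbasis its sum is
\<open>h\<close>.

\<^emph>\<open>Differentiability.\<close> On \<open>D\<close> the pressure is \<open>p\<^sub>0 + (p\<^sub>I -
p\<^sub>0) (1 - min (F(x)/F(\<Upsilon>)) 1)\<close>. Both \<open>F\<close> and \<open>W\<close> are integrals of
\<open>exp (-u)\<close> against nonnegative weights, because \<open>W(x) = \<integral>\<^sub>0\<^sup>x (x-z) exp
(-u(z)) dz\<close>; hence a perturbation of size \<open>\<eta>\<close> changes them by a
\<^emph>\<open>relative\<close> amount \<open>O(\<eta>)\<close>. Convexity of \<open>W\<close> transfers this to the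
front, \<open>\<bar>\<Upsilon>' - \<Upsilon>\<bar> \<le> 8 \<eta> \<Upsilon>\<close>, and then to the ratio
\<open>F(x)/F(\<Upsilon>)\<close>, so that the pressure is Lipschitz in \<open>u\<close> uniformly in
\<open>(x,t)\<close>, even as \<open>t \<rightarrow> 0\<close>, where the front degenerates. At a point off the front
and at a time other than the filling time the pressure has a derivative: there the minimum and the case distinction at
\<open>\<tau>\<^sup>*\<close> are locally constant, and the front moves by \<open>-
\<delta>W(\<Upsilon>)/F(\<Upsilon>)\<close> to first order, as implicit differentiation of \<open>W(\<Upsilon>) =
const\<close> predicts. The excluded points form a null set, so dominated convergence makes the integrated remainder
\<open>o(\<eta>)\<close> (\<open>sup_norm_differentiability\<close>). Finally the linearised pressure is an integral
of \<open>exp (-u) h\<close> against an explicit kernel, and two applications of Fubini's theorem move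
\<open>h\<close> outside and leave the representer (\<open>representer_duality\<close>).
\<close>

section \<open>Square-integrable functions on the interval and Bessel's inequality\<close>

lemma L2_mult_integrable:
  assumes "f \<in> L2 S" "g \<in> L2 S"
  shows "integrable (lebesgue_on S) (\<lambda>x. f x * g x)"
proof (rule Bochner_Integration.integrable_bound)
  show "integrable (lebesgue_on S) (\<lambda>x. (f x)\<^sup>2 + (g x)\<^sup>2)"
    using assms by (auto simp: L2_def)
  show "(\<lambda>x. f x * g x) \<in> borel_measurable (lebesgue_on S)"
    using assms by (auto simp: L2_def)
  have "\<bar>a * b\<bar> \<le> a\<^sup>2 + b\<^sup>2" for a b :: real
  proof -
    have "2 * \<bar>a\<bar> * \<bar>b\<bar> \<le> a\<^sup>2 + b\<^sup>2" using sum_squares_bound[of "\<bar>a\<bar>" "\<bar>b\<bar>"] by simp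
    moreover have "0 \<le> \<bar>a\<bar> * \<bar>b\<bar>" by simp
    ultimately show ?thesis unfolding abs_mult by linarith
  qed
  then show "AE x in lebesgue_on S. norm (f x * g x) \<le> norm ((f x)\<^sup>2 + (g x)\<^sup>2)"
    by auto
qed

lemma L2_add: "f \<in> L2 S \<Longrightarrow> g \<in> L2 S \<Longrightarrow> (\<lambda>x. f x + g x) \<in> L2 S"
  using L2_mult_integrable[of f S g] unfolding L2_def by (auto simp: power2_sum mult.assoc)

lemma L2_scale: "f \<in> L2 S \<Longrightarrow> (\<lambda>x. c * f x) \<in> L2 S"
  unfolding L2_def by (auto simp: power_mult_distrib)

lemma L2_sum: "(\<And>k. k \<in> K \<Longrightarrow> f k \<in> L2 S) \<Longrightarrow> (\<lambda>x. \<Sum>k\<in>K. f k x) \<in> L2 S"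
proof (induction K rule: infinite_finite_induct)
  case (insert k K)
  then show ?case using L2_add[of "f k" S "\<lambda>x. \<Sum>k\<in>K. f k x"] by simp
qed (auto simp: L2_def)

lemma L2_inner_sum:
  assumes "f \<in> L2 S" "\<And>k. k \<in> K \<Longrightarrow> g k \<in> L2 S"
  shows "L2_inner S (\<lambda>x. \<Sum>k\<in>K. c k * g k x) f = (\<Sum>k\<in>K. c k * L2_inner S (g k) f)"
proof -
  have "L2_inner S (\<lambda>x. \<Sum>k\<in>K. c k * g k x) f = (LINT x|lebesgue_on S. (\<Sum>k\<in>K. c k * (g k x * f x)))"
    by (simp add: L2_inner_def sum_distrib_right mult.assoc)
  also have "\<dots> = (\<Sum>k\<in>K. c k * L2_inner S (g k) f)"
    unfolding L2_inner_def using assms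
    by (subst Bochner_Integration.integral_sum) (auto intro!: L2_mult_integrable)
  finally show ?thesis .
qed

lemma L2_inner_commute: "L2_inner S f g = L2_inner S g f"
  by (simp add: L2_inner_def mult.commute)

lemma L2_inner_diff:
  assumes "f \<in> L2 S" "g \<in> L2 S" "h \<in> L2 S"
  shows "L2_inner S (\<lambda>x. f x - g x) h = L2_inner S f h - L2_inner S g h"
  unfolding L2_inner_def left_diff_distrib
  by (intro Bochner_Integration.integral_diff L2_mult_integrable assms)

text \<open>The square norm of \<open>f\<close> minus its orthogonal projection onto the span of the \<open>e k\<close> is nonnegative.\<close>

lemma bessel_inequality:
  assumes e: "\<And>k. e k \<in> L2 S" and orth: "\<And>j k. L2_inner S (e j) (e k) = of_bool (j = k)"
    and f: "f \<in> L2 S" and K: "finite (K :: 'i set)"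
  shows "(\<Sum>k\<in>K. (L2_inner S f (e k))\<^sup>2) \<le> L2_inner S f f"
proof -
  define a where "a k = L2_inner S f (e k)" for k
  define p where "p = (\<lambda>x. \<Sum>k\<in>K. a k * e k x)"
  have p: "p \<in> L2 S" unfolding p_def by (intro L2_sum L2_scale e)
  have pf: "L2_inner S p f = (\<Sum>k\<in>K. (a k)\<^sup>2)"
  proof -
    have "L2_inner S p f = (\<Sum>k\<in>K. a k * L2_inner S (e k) f)"
      using L2_inner_sum[OF f, of K e a] e by (simp add: p_def)
    also have "\<dots> = (\<Sum>k\<in>K. (a k)\<^sup>2)"
    proof (rule sum.cong)
      show "a k * L2_inner S (e k) f = (a k)\<^sup>2" if "k \<in> K" for k
        unfolding a_def L2_inner_commute[of S "e k" f] power2_eq_square ..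
    qed simp
    finally show ?thesis .
  qed
  have pe: "L2_inner S p (e j) = a j" if "j \<in> K" for j
    unfolding p_def using L2_inner_sum[OF e, of K e a j] e K that
    by (simp add: orth of_bool_def if_distrib[of "\<lambda>y. _ * y"] cong: if_cong)
  have pp: "L2_inner S p p = (\<Sum>k\<in>K. (a k)\<^sup>2)"
  proof -
    have "L2_inner S p p = (\<Sum>k\<in>K. a k * L2_inner S (e k) p)"
      using L2_inner_sum[OF p, of K e a] e by (simp add: p_def)
    also have "\<dots> = (\<Sum>k\<in>K. (a k)\<^sup>2)"
    proof (rule sum.cong)
      show "a k * L2_inner S (e k) p = (a k)\<^sup>2" if "k \<in> K" for k
        using pe[OF that] L2_inner_commute[of S p "e k"] by (simp add: power2_eq_square)
    qed simp
    finally show ?thesis .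
  qed
  have fp: "(\<lambda>x. f x - p x) \<in> L2 S" using L2_add[OF f L2_scale[OF p, of "-1"]] by simp
  have "0 \<le> L2_inner S (\<lambda>x. f x - p x) (\<lambda>x. f x - p x)"
    unfolding L2_inner_def by (rule Bochner_Integration.integral_nonneg) auto
  also have "\<dots> = L2_inner S f f - 2 * L2_inner S p f + L2_inner S p p"
    using L2_inner_diff[OF f p fp] L2_inner_diff[OF f p f] L2_inner_diff[OF f p p]
      L2_inner_commute[of S f "\<lambda>x. f x - p x"] L2_inner_commute[of S p "\<lambda>x. f x - p x"]
      L2_inner_commute[of S f p]
    by linarith
  finally show ?thesis by (simp add: pf pp a_def)
qed

lemma L2_inner_nonneg: "0 \<le> L2_inner S f f"
  unfolding L2_inner_def by (rule Bochner_Integration.integral_nonneg) auto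

lemma measurable_indicator_times_continuous:
  fixes g :: "real \<Rightarrow> real"
  assumes "continuous_on {0..xs} g"
  shows "(\<lambda>x. indicator {al..be} x * g x) \<in> borel_measurable (lebesgue_on {0<..<xs::real})"
proof -
  have "g \<in> borel_measurable (lebesgue_on {0<..<xs})"
    by (rule continuous_imp_measurable_on_sets_lebesgue) (auto intro: continuous_on_subset[OF assms])
  moreover have "(\<lambda>x. indicator {al..be} x :: real) \<in> borel_measurable (lebesgue_on {0<..<xs})"
    by (intro measurable_restrict_space1 measurable_completion) simp
  ultimately show ?thesis by (intro borel_measurable_times)
qed

lemma integrable_indicator_times_continuous:
  fixes g :: "real \<Rightarrow> real"
  assumes "continuous_on {0..xs} g"
  shows "integrable (lebesgue_on {0<..<xs::real}) (\<lambda>x. indicator {al..be} x * g x)"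
proof -
  obtain C where C: "\<And>x. x \<in> {0..xs} \<Longrightarrow> \<bar>g x\<bar> \<le> C"
    using compact_imp_bounded[OF compact_continuous_image[OF assms compact_Icc]] unfolding bounded_iff by fastforce
  interpret finite_measure "lebesgue_on {0<..<xs}" by (rule finite_measure_lebesgue_on) auto
  have "\<bar>indicator {al..be} x * g x\<bar> \<le> \<bar>C\<bar>" if "x \<in> {0<..<xs}" for x
    using C[of x] that by (auto simp: indicator_def)
  then show ?thesis
    by (intro integrable_const_bound[where B = "\<bar>C\<bar>"] AE_I2 measurable_indicator_times_continuous assms) simp
qed

text \<open>Spectral quantities are Lebesgue integrals over the open interval, whereas the fundamental theorem of calculus speaks
of gauge integrals over closed subintervals; this is the bridge.\<close>

lemma integral_indicator_times_continuous:
  fixes g :: "real \<Rightarrow> real"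
  assumes g: "continuous_on {0..xs} g" and "0 \<le> al" "al \<le> be" "be \<le> xs"
  shows "(LINT x|lebesgue_on {0<..<xs::real}. indicator {al..be} x * g x) = integral {al..be} g"
proof -
  have "(LINT x|lebesgue_on {0<..<xs}. indicator {al..be} x * g x) = integral {0<..<xs} (\<lambda>x. indicator {al..be} x * g x)"
    by (rule lebesgue_integral_eq_integral[OF integrable_indicator_times_continuous[OF g]]) auto
  also have "\<dots> = integral {0..xs} (\<lambda>x. indicator {al..be} x * g x)"
    by (simp add: integral_open_interval_real)
  also have "\<dots> = integral {0..xs} (\<lambda>x. if x \<in> {al..be} then g x else 0)"
    by (rule integral_cong) (auto simp: indicator_def)
  also have "\<dots> = integral {al..be} g"
    using assms by (subst integral_restrict_Int) (auto simp: Int_absorb1 intro!: arg_cong2[of _ _ _ _ integral])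
  finally show ?thesis .
qed

lemma L2_indicator_times_continuous:
  assumes "continuous_on {0..xs} g"
  shows "(\<lambda>x. indicator {al..be} x * g x) \<in> L2 {0<..<xs}"
proof -
  have "integrable (lebesgue_on {0<..<xs}) (\<lambda>x. indicator {al..be} x * (g x)\<^sup>2)"
    by (intro integrable_indicator_times_continuous continuous_on_power assms)
  moreover have "(\<lambda>x. indicator {al..be} x * (g x)\<^sup>2) = (\<lambda>x. (indicator {al..be} x * g x)\<^sup>2)"
    by (rule ext) (simp add: indicator_def)
  ultimately show ?thesis
    using measurable_indicator_times_continuous[OF assms, of al be] unfolding L2_def by simp
qed

lemma L2_continuous:
  assumes "continuous_on {0..xs} g"
  shows "g \<in> L2 {0<..<xs}"
proof -
  have 1: "indicator {0..xs} x * g x = g x" if "x \<in> {0<..<xs}" for x using that by auto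
  have "(\<lambda>x. indicator {0..xs} x * g x) \<in> borel_measurable (lebesgue_on {0<..<xs}) \<longleftrightarrow> g \<in> borel_measurable (lebesgue_on {0<..<xs})"
    by (rule measurable_cong) (simp add: 1)
  moreover have "integrable (lebesgue_on {0<..<xs}) (\<lambda>x. (indicator {0..xs} x * g x)\<^sup>2) \<longleftrightarrow> integrable (lebesgue_on {0<..<xs}) (\<lambda>x. (g x)\<^sup>2)"
    by (rule Bochner_Integration.integrable_cong) (simp_all add: 1)
  ultimately show ?thesis
    using L2_indicator_times_continuous[OF assms, of 0 xs] unfolding L2_def by blast
qed

section \<open>A local Weyl bound for the eigenfunctions of the Laplacian\<close>

text \<open>The function \<open>w' f - w f'\<close> is a primitive of \<open>w'' f - w f''\<close>, and \<open>f'' = - l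
f\<close>.\<close>

lemma green_identity:
  fixes f f1 w w1 w2 :: "real \<Rightarrow> real"
  assumes "al \<le> be"
    and "\<And>x. x \<in> {al..be} \<Longrightarrow> (f has_real_derivative f1 x) (at x within {al..be})"
    and "\<And>x. x \<in> {al..be} \<Longrightarrow> (f1 has_real_derivative - (l * f x)) (at x within {al..be})"
    and "\<And>x. x \<in> {al..be} \<Longrightarrow> (w has_real_derivative w1 x) (at x within {al..be})"
    and "\<And>x. x \<in> {al..be} \<Longrightarrow> (w1 has_real_derivative w2 x) (at x within {al..be})"
  shows "((\<lambda>x. (l * w x + w2 x) * f x) has_integral
           (w1 be * f be - w be * f1 be) - (w1 al * f al - w al * f1 al)) {al..be}"
proof (rule fundamental_theorem_of_calculus[OF \<open>al \<le> be\<close>])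
  fix x assume x: "x \<in> {al..be}"
  show "((\<lambda>x. w1 x * f x - w x * f1 x) has_vector_derivative (l * w x + w2 x) * f x) (at x within {al..be})"
    unfolding has_real_derivative_iff_has_vector_derivative[symmetric]
    by (rule derivative_eq_intros refl assms(2-5)[OF x])+ (simp add: algebra_simps)
qed

text \<open>With \<open>d = be - al\<close>, the cubic \<open>w z = (z - al) (be - z)\<^sup>2 / d\<^sup>2\<close> has \<open>w =
w' = 0\<close> at \<open>be\<close> and \<open>w = 0\<close>, \<open>w' = 1\<close> at \<open>al\<close>, so that in
Green's formula only the value of the eigenfunction at \<open>al\<close> survives; its mirror image serves the other
end point. The weight depends neither on the eigenvalue nor on the boundary condition, which makes Bessel's inequality
applicable to all modes at once.\<close>

lemma point_value_weight:
  fixes al be x :: real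
  assumes ab: "al < be" and x: "x = al \<or> x = be"
  obtains w w2 :: "real \<Rightarrow> real" where
    "continuous_on UNIV w" "continuous_on UNIV w2"
    "\<And>z. z \<in> {al..be} \<Longrightarrow> \<bar>w z\<bar> \<le> be - al" "\<And>z. z \<in> {al..be} \<Longrightarrow> \<bar>w2 z\<bar> \<le> 4 / (be - al)"
    "\<And>f f1 l. (\<And>z. z \<in> {al..be} \<Longrightarrow> (f has_real_derivative f1 z) (at z within {al..be})) \<Longrightarrow>
       (\<And>z. z \<in> {al..be} \<Longrightarrow> (f1 has_real_derivative - (l * f z)) (at z within {al..be})) \<Longrightarrow>
       ((\<lambda>z. (l * w z + w2 z) * f z) has_integral - f x) {al..be}"
proof -
  define d where "d = be - al"
  have d: "d > 0" using ab by (simp add: d_def)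
  have bnd: "\<bar>a * b\<^sup>2 / d\<^sup>2\<bar> \<le> d" "\<bar>(2 * a - 4 * b) / d\<^sup>2\<bar> \<le> 4 / d" if "0 \<le> a" "0 \<le> b" "a + b = d" for a b
  proof -
    have "b\<^sup>2 \<le> d\<^sup>2" using that by (intro power_mono) auto
    then have "a * b\<^sup>2 \<le> d * d\<^sup>2" using that by (intro mult_mono) auto
    then show "\<bar>a * b\<^sup>2 / d\<^sup>2\<bar> \<le> d" using d that by (simp add: field_simps)
    have "\<bar>2 * a - 4 * b\<bar> \<le> 4 * d" using that by auto
    then have "\<bar>2 * a - 4 * b\<bar> / d\<^sup>2 \<le> 4 * d / d\<^sup>2" by (intro divide_right_mono) auto
    then show "\<bar>(2 * a - 4 * b) / d\<^sup>2\<bar> \<le> 4 / d" using d by (simp add: power2_eq_square)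
  qed
  show ?thesis
  proof (cases "x = al")
    case True
    define w where "w z = (z - al) * (be - z)\<^sup>2 / d\<^sup>2" for z
    define w1 where "w1 z = ((be - z)\<^sup>2 - 2 * (z - al) * (be - z)) / d\<^sup>2" for z
    define w2 where "w2 z = (2 * (z - al) - 4 * (be - z)) / d\<^sup>2" for z
    show ?thesis
    proof (rule that[of w w2])
      show "continuous_on UNIV w" "continuous_on UNIV w2"
        unfolding w_def w2_def using d by (auto intro!: continuous_intros)
      show "\<bar>w z\<bar> \<le> be - al" "\<bar>w2 z\<bar> \<le> 4 / (be - al)" if "z \<in> {al..be}" for z
        using bnd[of "z - al" "be - z"] that by (auto simp: w_def w2_def d_def)
      fix f f1 l
      assume f: "\<And>z. z \<in> {al..be} \<Longrightarrow> (f has_real_derivative f1 z) (at z within {al..be})"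
        "\<And>z. z \<in> {al..be} \<Longrightarrow> (f1 has_real_derivative - (l * f z)) (at z within {al..be})"
      have w1: "(w has_real_derivative w1 z) (at z within {al..be})" for z
        unfolding w_def w1_def using d by (auto intro!: derivative_eq_intros simp: field_simps power2_eq_square)
      have w2: "(w1 has_real_derivative w2 z) (at z within {al..be})" for z
        unfolding w1_def w2_def using d by (auto intro!: derivative_eq_intros simp: field_simps power2_eq_square)
      have "w1 al = 1" "w1 be = 0" "w al = 0" "w be = 0"
        using d by (auto simp: w_def w1_def d_def)
      then show "((\<lambda>z. (l * w z + w2 z) * f z) has_integral - f x) {al..be}"
        using green_identity[OF less_imp_le[OF ab] f w1 w2] True by simp
    qed
  next
    case False
    then have xbe: "x = be" using x by simp
    define w where "w z = (be - z) * (z - al)\<^sup>2 / d\<^sup>2" for z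
    define w1 where "w1 z = (2 * (be - z) * (z - al) - (z - al)\<^sup>2) / d\<^sup>2" for z
    define w2 where "w2 z = (2 * (be - z) - 4 * (z - al)) / d\<^sup>2" for z
    show ?thesis
    proof (rule that[of w w2])
      show "continuous_on UNIV w" "continuous_on UNIV w2"
        unfolding w_def w2_def using d by (auto intro!: continuous_intros)
      show "\<bar>w z\<bar> \<le> be - al" "\<bar>w2 z\<bar> \<le> 4 / (be - al)" if "z \<in> {al..be}" for z
        using bnd[of "be - z" "z - al"] that by (auto simp: w_def w2_def d_def)
      fix f f1 l
      assume f: "\<And>z. z \<in> {al..be} \<Longrightarrow> (f has_real_derivative f1 z) (at z within {al..be})"
        "\<And>z. z \<in> {al..be} \<Longrightarrow> (f1 has_real_derivative - (l * f z)) (at z within {al..be})"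
      have w1: "(w has_real_derivative w1 z) (at z within {al..be})" for z
        unfolding w_def w1_def using d by (auto intro!: derivative_eq_intros simp: field_simps power2_eq_square)
      have w2: "(w1 has_real_derivative w2 z) (at z within {al..be})" for z
        unfolding w1_def w2_def using d by (auto intro!: derivative_eq_intros simp: field_simps power2_eq_square)
      have "w1 al = 0" "w1 be = - 1" "w al = 0" "w be = 0"
        using d by (auto simp: w_def w1_def d_def)
      then show "((\<lambda>z. (l * w z + w2 z) * f z) has_integral - f x) {al..be}"
        using green_identity[OF less_imp_le[OF ab] f w1 w2] xbe by simp
    qed
  qed
qed

lemma eigenbasis_continuous:
  assumes "laplace_eigenbasis xs e lam"
  shows "continuous_on {0..xs} (e k)"
  using assms unfolding laplace_eigenbasis_def
  by (meson DERIV_continuous_on)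

lemma eigenbasis_L2: "laplace_eigenbasis xs e lam \<Longrightarrow> e k \<in> L2 {0<..<xs}"
  by (intro L2_continuous eigenbasis_continuous)

lemma eigenbasis_orthonormal:
  "laplace_eigenbasis xs e lam \<Longrightarrow> L2_inner {0<..<xs} (e j) (e k) = of_bool (j = k)"
  by (simp add: laplace_eigenbasis_def)

text \<open>An interval of length \<open>d\<close> with end point \<open>x\<close> fits into \<open>{0..xs}\<close> on one side of
\<open>x\<close>. There the weight has square norm at most \<open>d\<^sup>3\<close> and its second derivative has
square norm at most \<open>16/d\<close>; for eigenvalues of modulus at most \<open>1/d\<^sup>2\<close>, Bessel's
inequality gives \<open>2 d\<^sup>-\<^sup>4 d\<^sup>3 + 2 (16/d) = 34/d\<close>. The order \<open>1/d\<close> is that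
of Weyl's law.\<close>

lemma local_weyl_bound:
  assumes E: "laplace_eigenbasis xs e lam" and d: "0 < d" "d \<le> xs / 2"
    and K: "finite K" "\<And>k. k \<in> K \<Longrightarrow> \<bar>lam k\<bar> \<le> 1 / d\<^sup>2" and x: "x \<in> {0..xs}"
  shows "(\<Sum>k\<in>K. (e k x)\<^sup>2) \<le> 34 / d"
proof -
  define al where "al = (if x \<le> xs / 2 then x else x - d)"
  define be where "be = al + d"
  have ab: "al < be" "0 \<le> al" "be \<le> xs" "x = al \<or> x = be" "be - al = d"
    using d x by (auto simp: al_def be_def)
  have sub: "{al..be} \<subseteq> {0..xs}" using ab by auto
  obtain w w2 where w: "continuous_on UNIV w" "continuous_on UNIV w2"
    "\<And>z. z \<in> {al..be} \<Longrightarrow> \<bar>w z\<bar> \<le> be - al" "\<And>z. z \<in> {al..be} \<Longrightarrow> \<bar>w2 z\<bar> \<le> 4 / (be - al)"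
    and rep: "\<And>f f1 l. (\<And>z. z \<in> {al..be} \<Longrightarrow> (f has_real_derivative f1 z) (at z within {al..be})) \<Longrightarrow>
       (\<And>z. z \<in> {al..be} \<Longrightarrow> (f1 has_real_derivative - (l * f z)) (at z within {al..be})) \<Longrightarrow>
       ((\<lambda>z. (l * w z + w2 z) * f z) has_integral - f x) {al..be}"
    using point_value_weight[OF ab(1,4)] by blast
  have cw: "continuous_on {0..xs} w" "continuous_on {0..xs} w2"
    using w(1,2) continuous_on_subset by blast+
  let ?S = "{0<..<xs}"
  define p where "p = (\<lambda>z. indicator {al..be} z * w z)"
  define q where "q = (\<lambda>z. indicator {al..be} z * w2 z)"
  have pq: "p \<in> L2 ?S" "q \<in> L2 ?S"
    unfolding p_def q_def by (intro L2_indicator_times_continuous cw)+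
  have norm_bound: "L2_inner ?S (\<lambda>z. indicator {al..be} z * v z) (\<lambda>z. indicator {al..be} z * v z) \<le> c\<^sup>2 * d"
    if v: "continuous_on {0..xs} v" and c: "\<And>z. z \<in> {al..be} \<Longrightarrow> \<bar>v z\<bar> \<le> c" for v c
  proof -
    have "(\<lambda>z. (indicator {al..be} z * v z) * (indicator {al..be} z * v z)) = (\<lambda>z. indicator {al..be} z * (v z)\<^sup>2)"
      by (rule ext) (simp add: indicator_def power2_eq_square)
    then have "L2_inner ?S (\<lambda>z. indicator {al..be} z * v z) (\<lambda>z. indicator {al..be} z * v z)
        = integral {al..be} (\<lambda>z. (v z)\<^sup>2)"
      unfolding L2_inner_def using ab v
      by (simp add: integral_indicator_times_continuous continuous_on_power)
    also have "\<dots> \<le> integral {al..be} (\<lambda>z. c\<^sup>2)"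
    proof (rule integral_le)
      show "(\<lambda>z. (v z)\<^sup>2) integrable_on {al..be}"
        by (intro integrable_continuous_real continuous_on_power continuous_on_subset[OF v sub])
      show "(v z)\<^sup>2 \<le> c\<^sup>2" if "z \<in> {al..be}" for z
        using c[OF that] by (metis abs_ge_zero power2_abs power_mono)
    qed auto
    also have "\<dots> = c\<^sup>2 * d" using ab by (simp add: mult.commute)
    finally show ?thesis .
  qed
  have pp: "L2_inner ?S p p \<le> d\<^sup>2 * d" unfolding p_def
    by (rule norm_bound) (use w ab cw in auto)
  have qq: "L2_inner ?S q q \<le> (4 / d)\<^sup>2 * d" unfolding q_def
    by (rule norm_bound) (use w ab cw in auto)
  have pt: "(e k x)\<^sup>2 \<le> 2 / d ^ 4 * (L2_inner ?S p (e k))\<^sup>2 + 2 * (L2_inner ?S q (e k))\<^sup>2" if k: "k \<in> K" for k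
  proof -
    obtain e' where e': "\<And>z. z \<in> {0..xs} \<Longrightarrow> (e k has_real_derivative e' z) (at z within {0..xs})"
        "\<And>z. z \<in> {0..xs} \<Longrightarrow> (e' has_real_derivative - (lam k * e k z)) (at z within {0..xs})"
      using E unfolding laplace_eigenbasis_def by blast
    have "((\<lambda>z. (lam k * w z + w2 z) * e k z) has_integral - e k x) {al..be}"
      by (rule rep) (use e' sub in \<open>blast intro: DERIV_subset\<close>)+
    then have "e k x = - integral {al..be} (\<lambda>z. (lam k * w z + w2 z) * e k z)"
      by (simp add: integral_unique)
    also have "integral {al..be} (\<lambda>z. (lam k * w z + w2 z) * e k z)
       = (LINT z|lebesgue_on ?S. indicator {al..be} z * ((lam k * w z + w2 z) * e k z))"
      using ab by (intro integral_indicator_times_continuous[symmetric] continuous_intros cw eigenbasis_continuous[OF E]) auto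
    also have "\<dots> = (LINT z|lebesgue_on ?S. lam k * (p z * e k z) + q z * e k z)"
      by (simp add: p_def q_def algebra_simps)
    also have "\<dots> = lam k * L2_inner ?S p (e k) + L2_inner ?S q (e k)"
      unfolding L2_inner_def
      by (subst Bochner_Integration.integral_add)
         (auto intro!: Bochner_Integration.integrable_mult_right L2_mult_integrable pq eigenbasis_L2[OF E])
    finally have "(e k x)\<^sup>2 = (lam k * L2_inner ?S p (e k) + L2_inner ?S q (e k))\<^sup>2"
      by (simp only: power2_minus)
    also have "\<dots> \<le> 2 * (lam k * L2_inner ?S p (e k))\<^sup>2 + 2 * (L2_inner ?S q (e k))\<^sup>2"
      using sum_squares_bound[of "lam k * L2_inner ?S p (e k)" "L2_inner ?S q (e k)"] by (simp add: power2_sum)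
    also have "(lam k * L2_inner ?S p (e k))\<^sup>2 \<le> (1 / d\<^sup>2)\<^sup>2 * (L2_inner ?S p (e k))\<^sup>2"
    proof -
      have "(lam k)\<^sup>2 \<le> (1 / d\<^sup>2)\<^sup>2" using K(2)[OF k] by (metis abs_ge_zero power2_abs power_mono)
      then show ?thesis unfolding power_mult_distrib by (intro mult_right_mono) auto
    qed
    finally show ?thesis by (simp add: power_divide flip: power_mult)
  qed
  have "(\<Sum>k\<in>K. (e k x)\<^sup>2) \<le> (\<Sum>k\<in>K. 2 / d ^ 4 * (L2_inner ?S p (e k))\<^sup>2 + 2 * (L2_inner ?S q (e k))\<^sup>2)"
    by (intro sum_mono pt)
  also have "\<dots> = 2 / d ^ 4 * (\<Sum>k\<in>K. (L2_inner ?S p (e k))\<^sup>2) + 2 * (\<Sum>k\<in>K. (L2_inner ?S q (e k))\<^sup>2)"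
    by (simp add: sum.distrib sum_distrib_left)
  also have "\<dots> \<le> 2 / d ^ 4 * (d\<^sup>2 * d) + 2 * ((4 / d)\<^sup>2 * d)"
    using bessel_inequality[of e ?S, OF eigenbasis_L2[OF E] eigenbasis_orthonormal[OF E] pq(1) K(1)]
      bessel_inequality[of e ?S, OF eigenbasis_L2[OF E] eigenbasis_orthonormal[OF E] pq(2) K(1)] pp qq d
    by (intro add_mono mult_left_mono) auto
  also have "\<dots> = 34 / d" using d by (simp add: field_simps power2_eq_square eval_nat_numeral)
  finally show ?thesis .
qed

section \<open>The Cameron--Martin space embeds in the continuous functions\<close>

text \<open>Integrating the local Weyl bound over the interval counts the modes, because each has norm \<open>1\<close>.\<close>

lemma finite_low_modes:
  assumes E: "laplace_eigenbasis xs e lam" and d: "0 < d" "d \<le> xs / 2"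
  shows "finite {k. \<bar>lam k\<bar> \<le> 1 / d\<^sup>2}"
proof -
  have "card G \<le> nat \<lceil>34 / d * xs\<rceil>" if G: "G \<subseteq> {k. \<bar>lam k\<bar> \<le> 1 / d\<^sup>2}" "finite G" for G
  proof -
    interpret finite_measure "lebesgue_on {0<..<xs}" by (rule finite_measure_lebesgue_on) auto
    have I: "integrable (lebesgue_on {0<..<xs}) (\<lambda>x. (e k x)\<^sup>2)" for k
      using eigenbasis_L2[OF E, of k] by (simp add: L2_def)
    have "real (card G) = (\<Sum>k\<in>G. L2_inner {0<..<xs} (e k) (e k))"
      by (simp add: eigenbasis_orthonormal[OF E])
    also have "\<dots> = (LINT x|lebesgue_on {0<..<xs}. (\<Sum>k\<in>G. (e k x)\<^sup>2))"
      unfolding L2_inner_def using I by (subst Bochner_Integration.integral_sum) (auto simp: power2_eq_square)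
    also have "\<dots> \<le> (LINT x|lebesgue_on {0<..<xs}. 34 / d)"
    proof (rule integral_mono)
      show "(\<Sum>k\<in>G. (e k x)\<^sup>2) \<le> 34 / d" if "x \<in> space (lebesgue_on {0<..<xs})" for x
        using local_weyl_bound[OF E d G(2), of x] G(1) that by auto
    qed (auto intro: I)
    also have "\<dots> = 34 / d * xs"
      using d by (simp add: measure_restrict_space)
    finally show ?thesis by linarith
  qed
  then show ?thesis using finite_if_finite_subsets_card_bdd by blast
qed

text \<open>The left-hand side is a partial sum of the covariance function of the prior on the diagonal. The modes are grouped by
the least \<open>j\<close> with \<open>\<bar>\<lambda>\<^sub>k\<bar> \<le> L\<^sub>j\<close>, where \<open>L\<^sub>j =
1/d\<^sub>j\<^sup>2\<close> and \<open>d\<^sub>j = d\<^sub>1 2\<^sup>-\<^sup>j\<close>. For \<open>j > 0\<close> the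
exponent \<open>\<nu> + 1/2 > 1\<close> gives covariance eigenvalues \<open>O(4\<^sup>-\<^sup>j)\<close>, while the
local Weyl bound for the group is \<open>O(2\<^sup>j)\<close>, so the groups form a geometric series. The group
\<open>j = 0\<close> is finite.\<close>

lemma matern_kernel_bound:
  assumes E: "laplace_eigenbasis xs e lam" and xs: "xs > 0" and kap: "kap > 0" and nu: "nu > 1/2"
    and pos: "\<forall>k. kap\<^sup>2 + lam k > 0"
  obtains B where "B > 0"
    "\<And>K x. finite K \<Longrightarrow> x \<in> {0..xs} \<Longrightarrow> (\<Sum>k\<in>K. matern_eigenvalue sig kap nu lam k * (e k x)\<^sup>2) \<le> B"
proof -
  let ?c = "matern_eigenvalue sig kap nu lam"
  \<comment> \<open>With this \<open>d1\<close> all thresholds are at least \<open>1\<close> and \<open>kap\<^sup>2\<close>. An eigenvalue of larger modulus is then positive, as \<open>lam k > - kap\<^sup>2\<close>, and lowering the exponent \<open>nu + 1/2\<close> to \<open>1\<close> weakens the bound.\<close>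
  define d1 where "d1 = min (xs / 2) (min 1 (1 / kap))"
  have d1: "0 < d1" "d1 \<le> xs / 2" "d1 \<le> 1" "d1 \<le> 1 / kap" using xs kap by (auto simp: d1_def)
  define L where "L j = 4 ^ j / d1\<^sup>2" for j :: nat
  have L: "L j = 1 / (d1 / 2 ^ j)\<^sup>2" for j
    by (simp add: L_def power_divide power_mult[symmetric] mult.commute[of j] power_mult)
  have dj: "0 < d1 / 2 ^ j" "d1 / 2 ^ j \<le> xs / 2" for j :: nat
  proof -
    have "d1 / 2 ^ j \<le> d1 / 1" using d1 by (intro divide_left_mono) auto
    then show "d1 / 2 ^ j \<le> xs / 2" using d1(2) by linarith
    show "0 < d1 / 2 ^ j" using d1(1) by simp
  qed
  have L0: "1 \<le> L j" "kap\<^sup>2 \<le> L j" for j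
  proof -
    have "d1\<^sup>2 \<le> 1" using d1 by (simp add: power_le_one)
    moreover have "d1\<^sup>2 \<le> (1 / kap)\<^sup>2" using d1 by (intro power_mono) auto
    ultimately have *: "1 \<le> L 0" "kap\<^sup>2 \<le> L 0" using d1 kap by (auto simp: L_def field_simps)
    have "L 0 \<le> L j" using d1 by (simp add: L_def divide_right_mono)
    with * show "1 \<le> L j" "kap\<^sup>2 \<le> L j" by auto
  qed
  define K0 where "K0 = {k. \<bar>lam k\<bar> \<le> L 0}"
  have fin: "finite K0"
    using finite_low_modes[OF E dj[of 0]] by (simp add: K0_def L)
  have c_nonneg: "0 \<le> ?c k" for k by (simp add: matern_eigenvalue_def)
  define b where "b j = (if j = 0 then sum ?c K0 else 4 * sig\<^sup>2 * d1\<^sup>2 / 4 ^ j)" for j :: nat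
  have "\<exists>j. \<bar>lam k\<bar> \<le> L j" for k
  proof -
    obtain j where "\<bar>lam k\<bar> * d1\<^sup>2 < 4 ^ j" using real_arch_pow[of 4 "\<bar>lam k\<bar> * d1\<^sup>2"] by auto
    then show ?thesis using d1 by (intro exI[of _ j]) (simp add: L_def field_simps)
  qed
  define lev where "lev k = (LEAST j. \<bar>lam k\<bar> \<le> L j)" for k
  have lev: "\<bar>lam k\<bar> \<le> L (lev k)" for k
    unfolding lev_def by (rule LeastI_ex) fact
  have cb: "?c k \<le> b (lev k)" for k
  proof (cases "lev k")
    case 0
    then have "k \<in> K0" using lev[of k] by (simp add: K0_def)
    then show ?thesis using 0 fin c_nonneg by (simp add: b_def member_le_sum)
  next
    case (Suc j)
    then have "\<not> \<bar>lam k\<bar> \<le> L j" unfolding lev_def by (metis lessI not_less_Least)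
    moreover have "kap\<^sup>2 + lam k > 0" using pos by blast
    ultimately have lamk: "lam k > L j" using L0[of j] by linarith
    define mu where "mu = kap\<^sup>2 + lam k"
    have mu: "mu \<ge> L j" "mu \<ge> 1" using lamk L0[of j] unfolding mu_def by (auto intro: add_increasing)
    have "?c k = sig\<^sup>2 * mu powr (- (nu + 1/2))" by (simp add: matern_eigenvalue_def mu_def)
    also have "\<dots> \<le> sig\<^sup>2 * mu powr (- 1)"
      using mu nu by (intro mult_left_mono powr_mono) auto
    also have "mu powr (- 1) = 1 / mu" using mu by (simp add: powr_minus_divide)
    also have "sig\<^sup>2 * (1 / mu) \<le> sig\<^sup>2 * (1 / L j)"
      using mu L0[of j] by (intro mult_left_mono divide_left_mono) auto
    also have "\<dots> = b (lev k)" using Suc d1 by (simp add: b_def L_def)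
    finally show ?thesis .
  qed
  define t where "t j = (if j = 0 then sum ?c K0 * (34 / d1) else 0) + 136 * sig\<^sup>2 * d1 * (1/2) ^ j" for j :: nat
  have t: "b j * (34 / (d1 / 2 ^ j)) \<le> t j" for j
  proof (cases j)
    case 0 then show ?thesis using d1 by (simp add: b_def t_def)
  next
    case (Suc i)
    have "(4::real) ^ j = 2 ^ j * 2 ^ j" by (simp flip: power_mult_distrib)
    then show ?thesis using Suc d1 by (simp add: b_def t_def field_simps power2_eq_square)
  qed
  have t_sum: "summable t" unfolding t_def
    by (intro summable_add summable_mult summable_geometric summable_finite[of "{0}"]) auto
  have t_nonneg: "0 \<le> t j" for j unfolding t_def using d1
    by (auto intro!: add_nonneg_nonneg mult_nonneg_nonneg divide_nonneg_nonneg sum_nonneg c_nonneg)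
  show ?thesis
  proof (rule that[of "suminf t + 1"])
    show "suminf t + 1 > 0" using suminf_nonneg[OF t_sum t_nonneg] by simp
    fix K :: "nat set" and x assume K: "finite K" and x: "x \<in> {0..xs}"
    have "(\<Sum>k\<in>K. ?c k * (e k x)\<^sup>2) \<le> (\<Sum>k\<in>K. b (lev k) * (e k x)\<^sup>2)"
      by (intro sum_mono mult_right_mono cb) auto
    also have "\<dots> = (\<Sum>j\<in>lev ` K. \<Sum>k\<in>{k\<in>K. lev k = j}. b (lev k) * (e k x)\<^sup>2)"
      by (rule sum.group[symmetric]) (use K in auto)
    also have "\<dots> = (\<Sum>j\<in>lev ` K. b j * (\<Sum>k\<in>{k\<in>K. lev k = j}. (e k x)\<^sup>2))"
      by (simp add: sum_distrib_left)
    also have "\<dots> \<le> (\<Sum>j\<in>lev ` K. b j * (34 / (d1 / 2 ^ j)))"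
    proof (intro sum_mono mult_left_mono)
      fix j
      show "(\<Sum>k\<in>{k\<in>K. lev k = j}. (e k x)\<^sup>2) \<le> 34 / (d1 / 2 ^ j)"
        by (rule local_weyl_bound[OF E dj]) (use K x lev L in auto)
      show "0 \<le> b j" by (auto simp: b_def intro!: sum_nonneg c_nonneg)
    qed
    also have "\<dots> \<le> sum t (lev ` K)" by (intro sum_mono t)
    also have "\<dots> \<le> suminf t" using K by (intro sum_le_suminf t_sum t_nonneg) auto
    finally show "(\<Sum>k\<in>K. ?c k * (e k x)\<^sup>2) \<le> suminf t + 1" by simp
  qed
qed

lemma spectral_sum_abs_le:
  fixes c :: "nat \<Rightarrow> real"
  assumes c: "\<And>k. 0 \<le> c k" and K: "(\<Sum>k\<in>K. c k * (v k)\<^sup>2) \<le> B"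
  shows "\<bar>\<Sum>k\<in>K. (c k powr (1/2) * g k) * v k\<bar> \<le> sqrt ((\<Sum>k\<in>K. (g k)\<^sup>2) * B)"
proof -
  have "(\<Sum>k\<in>K. (c k powr (1/2) * g k) * v k)\<^sup>2 = (\<Sum>k\<in>K. g k * (sqrt (c k) * v k))\<^sup>2"
    using c by (simp add: powr_half_sqrt mult.assoc mult.left_commute)
  also have "\<dots> \<le> (\<Sum>k\<in>K. (g k)\<^sup>2) * (\<Sum>k\<in>K. (sqrt (c k) * v k)\<^sup>2)"
    by (rule Cauchy_Schwarz_ineq_sum)
  also have "\<dots> = (\<Sum>k\<in>K. (g k)\<^sup>2) * (\<Sum>k\<in>K. c k * (v k)\<^sup>2)"
    using c by (simp add: power_mult_distrib)
  also have "\<dots> \<le> (\<Sum>k\<in>K. (g k)\<^sup>2) * B"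
    by (intro mult_left_mono K sum_nonneg) auto
  finally show ?thesis by (metis real_sqrt_abs real_sqrt_le_iff)
qed

lemma continuous_AE_zero:
  fixes f :: "real \<Rightarrow> real"
  assumes f: "continuous_on {0..xs} f" and xs: "0 < xs" and AE: "AE x in lebesgue_on {0<..<xs}. f x = 0"
    and x: "x \<in> {0..xs}"
  shows "f x = 0"
proof -
  have f2: "continuous_on {0..xs} (\<lambda>x. (f x)\<^sup>2)" by (intro continuous_on_power f)
  have "integral {0..xs} (\<lambda>x. (f x)\<^sup>2) = (LINT x|lebesgue_on {0<..<xs}. indicator {0..xs} x * (f x)\<^sup>2)"
    using xs by (subst integral_indicator_times_continuous[OF f2]) auto
  also have "\<dots> = 0"
    by (rule integral_eq_zero_AE) (use AE in eventually_elim, simp)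
  finally have "\<forall>x\<in>{0..xs}. (f x)\<^sup>2 = 0"
    using integral_eq_0_iff[OF f2 xs] by simp
  then show ?thesis using x by simp
qed

text \<open>By Cauchy--Schwarz the partial sums of the expansion of \<open>h\<close> are uniformly Cauchy. Their continuous limit
has the coefficients of \<open>h\<close>, so it equals \<open>h\<close> almost everywhere by completeness, hence
everywhere by continuity, and it inherits the bound on the partial sums.\<close>

lemma spectral_power_sup_bound:
  assumes E: "laplace_eigenbasis xs e lam" and xs: "xs > 0"
    and c: "\<And>k. 0 \<le> c k" and B: "\<And>K x. finite K \<Longrightarrow> x \<in> {0..xs} \<Longrightarrow> (\<Sum>k\<in>K. c k * (e k x)\<^sup>2) \<le> B"
    and h: "continuous_on {0..xs} h" and gh: "spectral_power xs e c (1/2) g h" and x: "x \<in> {0..xs}"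
  shows "\<bar>h x\<bar> \<le> sqrt (L2_inner {0<..<xs} g g * B)"
proof -
  let ?S = "{0<..<xs}"
  have g: "g \<in> L2 ?S" and hk: "L2_inner ?S h (e k) = c k powr (1/2) * L2_inner ?S g (e k)" for k
    using gh by (auto simp: spectral_power_def)
  define a where "a k = L2_inner ?S g (e k)" for k
  define s where "s n x = (\<Sum>k<n. (c k powr (1/2) * a k) * e k x)" for n x
  have B0: "0 \<le> B" using B[of "{}" x] x by simp
  have bess: "(\<Sum>k\<in>K. (a k)\<^sup>2) \<le> L2_inner ?S g g" if "finite K" for K
    unfolding a_def by (rule bessel_inequality[of e, OF eigenbasis_L2[OF E] eigenbasis_orthonormal[OF E] g that])
  have "summable (\<lambda>k. (a k)\<^sup>2)"
    by (rule summableI_nonneg_bounded[of _ "L2_inner ?S g g"]) (auto intro: bess)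
  then have cau: "\<exists>N. \<forall>m\<ge>N. \<forall>n. norm (\<Sum>k=m..<n. (a k)\<^sup>2) < r" if "r > 0" for r
    using that unfolding summable_Cauchy by blast
  have "uniformly_Cauchy_on {0..xs} s"
  proof (rule uniformly_Cauchy_onI')
    fix r :: real assume r: "r > 0"
    obtain N where N: "\<And>m n. m \<ge> N \<Longrightarrow> (\<Sum>k=m..<n. (a k)\<^sup>2) < r\<^sup>2 / (B + 1)"
      using cau[of "r\<^sup>2 / (B + 1)"] r B0 by (auto simp: sum_nonneg)
    have "dist (s m x) (s n x) < r" if "x \<in> {0..xs}" "m \<ge> N" "n > m" for x m n
    proof -
      have split: "{..<n} = {..<m} \<union> {m..<n}" using that by auto
      have "s n x - s m x = (\<Sum>k=m..<n. (c k powr (1/2) * a k) * e k x)"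
        unfolding s_def split by (subst sum.union_disjoint) auto
      then have "dist (s m x) (s n x) = \<bar>\<Sum>k=m..<n. (c k powr (1/2) * a k) * e k x\<bar>"
        by (simp add: dist_real_def abs_minus_commute)
      also have "\<dots> \<le> sqrt ((\<Sum>k=m..<n. (a k)\<^sup>2) * B)"
        by (rule spectral_sum_abs_le[OF c B]) (use that in auto)
      also have "\<dots> < sqrt (r\<^sup>2)"
      proof (rule real_sqrt_less_mono)
        have "(\<Sum>k=m..<n. (a k)\<^sup>2) * B \<le> (\<Sum>k=m..<n. (a k)\<^sup>2) * (B + 1)"
          by (intro mult_left_mono sum_nonneg) auto
        also have "\<dots> < r\<^sup>2" using N[OF that(2), of n] B0 by (simp add: pos_less_divide_eq)
        finally show "(\<Sum>k=m..<n. (a k)\<^sup>2) * B < r\<^sup>2" .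
      qed
      finally show ?thesis using r by simp
    qed
    then show "\<exists>M. \<forall>x\<in>{0..xs}. \<forall>m\<ge>M. \<forall>n>m. dist (s m x) (s n x) < r" by blast
  qed
  then obtain l where l: "uniform_limit {0..xs} s l sequentially"
    using Cauchy_uniformly_convergent[of "{0..xs}" s] by (auto simp: uniformly_convergent_on_def)
  have s_cont: "continuous_on {0..xs} (s n)" for n
    unfolding s_def by (intro continuous_on_sum continuous_on_mult continuous_on_const eigenbasis_continuous[OF E])
  have l_cont: "continuous_on {0..xs} l"
    by (rule uniform_limit_theorem[OF _ l]) (auto simp: s_cont)
  have le: "L2_inner ?S l (e k) = L2_inner ?S h (e k)" for k
  proof -
    have lim: "(\<lambda>n. L2_inner ?S (s n) (e k)) \<longlonglongrightarrow> L2_inner ?S l (e k)"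
    proof (rule LIMSEQ_I)
      fix r :: real assume r: "r > 0"
      define M where "M = (LINT x|lebesgue_on ?S. \<bar>e k x\<bar>)"
      have M0: "0 \<le> M" unfolding M_def by (rule Bochner_Integration.integral_nonneg) simp
      have intk: "integrable (lebesgue_on ?S) (\<lambda>x. \<bar>e k x\<bar>)"
        using L2_mult_integrable[OF L2_continuous eigenbasis_L2[OF E, of k], of "\<lambda>_. 1"] by (simp add: continuous_on_const)
      have "\<forall>\<^sub>F n in sequentially. \<forall>x\<in>{0..xs}. dist (s n x) (l x) < r / (M + 1)"
        using l r M0 by (intro uniform_limitD) auto
      then obtain N where N: "\<And>n x. n \<ge> N \<Longrightarrow> x \<in> {0..xs} \<Longrightarrow> \<bar>s n x - l x\<bar> < r / (M + 1)"
        unfolding eventually_sequentially dist_real_def by blast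
      have "norm (L2_inner ?S (s n) (e k) - L2_inner ?S l (e k)) < r" if n: "n \<ge> N" for n
      proof -
        have L: "s n \<in> L2 ?S" "l \<in> L2 ?S" by (intro L2_continuous s_cont l_cont)+
        have dl: "(\<lambda>x. s n x - l x) \<in> L2 ?S"
          by (intro L2_continuous continuous_on_diff s_cont l_cont)
        have "norm (L2_inner ?S (s n) (e k) - L2_inner ?S l (e k)) = norm (L2_inner ?S (\<lambda>x. s n x - l x) (e k))"
          by (simp add: L2_inner_diff[OF L eigenbasis_L2[OF E]])
        also have "\<dots> \<le> (LINT x|lebesgue_on ?S. (r / (M + 1)) * \<bar>e k x\<bar>)"
          unfolding L2_inner_def
        proof (rule order_trans[OF integral_norm_bound integral_mono])
          show "integrable (lebesgue_on ?S) (\<lambda>x. norm ((s n x - l x) * e k x))"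
            by (intro integrable_norm L2_mult_integrable dl eigenbasis_L2[OF E])
          show "integrable (lebesgue_on ?S) (\<lambda>x. r / (M + 1) * \<bar>e k x\<bar>)"
            by (intro Bochner_Integration.integrable_mult_right intk)
          fix x assume "x \<in> space (lebesgue_on ?S)"
          then have "\<bar>s n x - l x\<bar> \<le> r / (M + 1)" using N[OF n, of x] by auto
          then show "norm ((s n x - l x) * e k x) \<le> r / (M + 1) * \<bar>e k x\<bar>"
            by (simp only: real_norm_def abs_mult mult_right_mono abs_ge_zero)
        qed
        also have "\<dots> = r / (M + 1) * M" by (simp add: M_def)
        also have "\<dots> < r" using r M0 by (simp add: field_simps)
        finally show ?thesis .
      qed
      then show "\<exists>N. \<forall>n\<ge>N. norm (L2_inner ?S (s n) (e k) - L2_inner ?S l (e k)) < r" by blast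
    qed
    have "L2_inner ?S (s n) (e k) = c k powr (1/2) * a k" if "n > k" for n
    proof -
      have "L2_inner ?S (s n) (e k) = (\<Sum>j<n. (c j powr (1/2) * a j) * L2_inner ?S (e j) (e k))"
        unfolding s_def by (rule L2_inner_sum) (auto intro: eigenbasis_L2[OF E])
      also have "\<dots> = (\<Sum>j<n. if j = k then c k powr (1/2) * a k else 0)"
        by (rule sum.cong) (auto simp: eigenbasis_orthonormal[OF E])
      finally show ?thesis using that by simp
    qed
    then have "(\<lambda>n. L2_inner ?S (s n) (e k)) \<longlonglongrightarrow> c k powr (1/2) * a k"
      by (intro tendsto_eventually) (auto simp: eventually_at_top_dense)
    then have "L2_inner ?S l (e k) = c k powr (1/2) * a k" using lim LIMSEQ_unique by blast
    then show ?thesis by (simp add: hk a_def)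
  qed
  have hl: "continuous_on {0..xs} (\<lambda>x. h x - l x)" by (intro continuous_on_diff h l_cont)
  have "\<forall>k. L2_inner ?S (\<lambda>x. h x - l x) (e k) = 0"
    by (simp add: L2_inner_diff[OF L2_continuous[OF h] L2_continuous[OF l_cont] eigenbasis_L2[OF E]] le)
  then have "AE x in lebesgue_on ?S. h x - l x = 0"
    using E L2_continuous[OF hl] unfolding laplace_eigenbasis_def by blast
  then have "h x - l x = 0" by (rule continuous_AE_zero[OF hl xs _ x])
  moreover have "\<bar>l x\<bar> \<le> sqrt (L2_inner ?S g g * B)"
  proof (rule LIMSEQ_le_const2)
    show "(\<lambda>n. \<bar>s n x\<bar>) \<longlonglongrightarrow> \<bar>l x\<bar>"
      using tendsto_uniform_limitI[OF l x] by (rule tendsto_rabs)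
    have "\<bar>s n x\<bar> \<le> sqrt ((\<Sum>k<n. (a k)\<^sup>2) * B)" for n
      unfolding s_def by (rule spectral_sum_abs_le[OF c B]) (use x in auto)
    also have "sqrt ((\<Sum>k<n. (a k)\<^sup>2) * B) \<le> sqrt (L2_inner ?S g g * B)" for n
      by (intro real_sqrt_le_mono mult_right_mono bess B0) auto
    finally show "\<exists>N. \<forall>n\<ge>N. \<bar>s n x\<bar> \<le> sqrt (L2_inner ?S g g * B)" by blast
  qed
  ultimately show ?thesis by simp
qed

lemma cm_space_embeds_continuous:
  assumes E: "laplace_eigenbasis xs e lam" and xs: "xs > 0" and kap: "kap > 0" and nu: "nu > 1/2"
    and pos: "\<forall>k. kap\<^sup>2 + lam k > 0"
  obtains B where "B > 0"
    "\<And>h x. h \<in> cm_space xs e (matern_eigenvalue sig kap nu lam) \<Longrightarrow> x \<in> {0..xs} \<Longrightarrow>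
       \<bar>h x\<bar> \<le> B * cm_norm xs e (matern_eigenvalue sig kap nu lam) h"
proof -
  let ?c = "matern_eigenvalue sig kap nu lam"
  obtain B where B: "B > 0"
    "\<And>K x. finite K \<Longrightarrow> x \<in> {0..xs} \<Longrightarrow> (\<Sum>k\<in>K. ?c k * (e k x)\<^sup>2) \<le> B"
    using matern_kernel_bound[OF E xs kap nu pos] by blast
  show ?thesis
  proof (rule that[of "sqrt B"])
    fix h x assume h: "h \<in> cm_space xs e ?c" and x: "x \<in> {0..xs}"
    then have "\<exists>g. spectral_power xs e ?c (1/2) g h" by (simp add: cm_space_def)
    then have "spectral_power xs e ?c (1/2) (cov_inv_sqrt xs e ?c h) h"
      unfolding cov_inv_sqrt_def by (rule someI_ex)
    moreover have "0 \<le> ?c k" for k by (simp add: matern_eigenvalue_def)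
    ultimately show "\<bar>h x\<bar> \<le> sqrt B * cm_norm xs e ?c h"
      using spectral_power_sup_bound[OF E xs _ B(2), of h _ x] h x
      by (simp add: cm_space_def cm_norm_def cm_inner_def real_sqrt_mult mult.commute)
  qed (use B in simp)
qed

section \<open>Cumulative resistance, its primitive and the moving front\<close>

lemma mean_value_within:
  fixes f f' :: "real \<Rightarrow> real"
  assumes "\<And>x. x \<in> {a..b} \<Longrightarrow> (f has_real_derivative f' x) (at x within {a..b})"
    and "x \<in> {a..b}" "y \<in> {a..b}"
  shows "\<exists>\<xi>\<in>{a..b}. min x y \<le> \<xi> \<and> \<xi> \<le> max x y \<and> f y - f x = (y - x) * f' \<xi>"
proof -
  have *: "\<exists>\<xi>. x \<le> \<xi> \<and> \<xi> \<le> y \<and> f y - f x = (y - x) * f' \<xi>" if "x \<in> {a..b}" "y \<in> {a..b}" "x \<le> y" for x y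
  proof -
    have "\<exists>z\<in>{x..y}. f y - f x = (\<lambda>d. d * f' z) (y - x)"
    proof (rule mvt_very_simple[OF \<open>x \<le> y\<close>])
      fix z assume "x \<le> z" "z \<le> y"
      then have "(f has_real_derivative f' z) (at z within {x..y})"
        using that by (intro DERIV_subset[OF assms(1)]) auto
      then show "(f has_derivative (\<lambda>d. d * f' z)) (at z within {x..y})"
        by (simp add: has_field_derivative_def mult_commute_abs)
    qed
    then show ?thesis by auto
  qed
  show ?thesis
  proof (cases "x \<le> y")
    case True
    obtain \<xi> where "x \<le> \<xi>" "\<xi> \<le> y" "f y - f x = (y - x) * f' \<xi>" using * assms(2,3) True by blast
    then show ?thesis using True assms(2,3) by (intro bexI[of _ \<xi>]) auto
  next
    case False
    then obtain \<xi> where "y \<le> \<xi>" "\<xi> \<le> x" "f x - f y = (x - y) * f' \<xi>" using *[of y x] assms(2,3) by auto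
    then show ?thesis using False assms(2,3) by (intro bexI[of _ \<xi>]) (auto simp: algebra_simps)
  qed
qed

lemma LINT_Icc_eq_integral:
  fixes g :: "real \<Rightarrow> real"
  assumes "continuous_on {a..b} g" "a \<le> x" "x \<le> b"
  shows "(LINT z:{a..x}|lebesgue. g z) = integral {a..x} g"
  by (intro set_lebesgue_integral_eq_integral absolutely_integrable_continuous_real continuous_on_subset[OF assms(1)])
     (use assms in auto)

text \<open>Cauchy's formula for repeated integration: \<open>y \<mapsto> y I(y) - \<integral>\<^sub>0\<^sup>y z g(z) dz\<close>
is a primitive of \<open>I\<close>, the primitive of \<open>g\<close>.\<close>

lemma integral_primitive:
  fixes g :: "real \<Rightarrow> real"
  assumes g: "continuous_on {0..b} g" and x: "x \<in> {0..b}"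
  shows "integral {0..x} (\<lambda>y. integral {0..y} g) = integral {0..x} (\<lambda>z. (x - z) * g z)"
proof -
  have g': "continuous_on {0..x} g" using x by (intro continuous_on_subset[OF g]) auto
  have zg: "continuous_on {0..x} (\<lambda>z. z * g z)" by (intro continuous_intros g')
  let ?I = "\<lambda>y. integral {0..y} g" and ?J = "\<lambda>y. integral {0..y} (\<lambda>z. z * g z)"
  have "(?I has_integral (x * ?I x - ?J x) - (0 * ?I 0 - ?J 0)) {0..x}"
  proof (rule fundamental_theorem_of_calculus)
    fix y assume y: "y \<in> {0..x}"
    have "(?I has_real_derivative g y) (at y within {0..x})" by (rule integral_has_real_derivative[OF g' y])
    moreover have "(?J has_real_derivative y * g y) (at y within {0..x})" by (rule integral_has_real_derivative[OF zg y])
    ultimately have "((\<lambda>y. y * ?I y - ?J y) has_real_derivative ?I y) (at y within {0..x})"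
      by (auto intro!: derivative_eq_intros)
    then show "((\<lambda>y. y * ?I y - ?J y) has_vector_derivative ?I y) (at y within {0..x})"
      by (simp add: has_real_derivative_iff_has_vector_derivative)
  qed (use x in auto)
  then have "integral {0..x} ?I = x * ?I x - ?J x" by (simp add: integral_unique)
  also have "\<dots> = integral {0..x} (\<lambda>z. x * g z - z * g z)"
    using g' zg by (subst Henstock_Kurzweil_Integration.integral_diff) (auto intro!: integrable_continuous_real continuous_intros)
  finally show ?thesis by (simp add: left_diff_distrib)
qed

text \<open>The estimates see the size of \<open>u\<close> only through these two-sided bounds on \<open>exp (- u)\<close>.\<close>

locale medium =
  fixes xs M :: real and u :: "real \<Rightarrow> real"
  assumes xs_pos: "0 < xs" and u_cont: "continuous_on {0..xs} u" and M_ge_1: "1 \<le> M"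
    and exp_lower: "x \<in> {0..xs} \<Longrightarrow> 1 / M \<le> exp (- u x)"
    and exp_upper: "x \<in> {0..xs} \<Longrightarrow> exp (- u x) \<le> M"
begin

abbreviation "F \<equiv> F_int u"
abbreviation "W \<equiv> W_int u"

lemma exp_cont: "continuous_on {0..xs} (\<lambda>z. exp (- u z))"
  by (intro continuous_intros u_cont)

lemma F_eq: "x \<in> {0..xs} \<Longrightarrow> F x = integral {0..x} (\<lambda>z. exp (- u z))"
  unfolding F_int_def by (rule LINT_Icc_eq_integral[OF exp_cont]) auto

lemma F_deriv: 
  assumes "x \<in> {0..xs}" 
  shows "(F has_real_derivative exp (- u x)) (at x within {0..xs})"
  by (rule has_field_derivative_transform_within[OF integral_has_real_derivative[OF exp_cont assms] zero_less_one assms])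
     (simp only: F_eq)

lemma F_cont: "continuous_on {0..xs} F"
  by (rule DERIV_continuous_on[OF F_deriv])

lemma W_eq: "x \<in> {0..xs} \<Longrightarrow> W x = integral {0..x} F"
  unfolding W_int_def by (rule LINT_Icc_eq_integral[OF F_cont]) auto

text \<open>In this form \<open>W\<close>, like \<open>F\<close>, is an integral of \<open>exp (- u)\<close> against a nonnegative
weight, so that one perturbation estimate covers both.\<close>

lemma W_eq_weighted:
  assumes "x \<in> {0..xs}" shows "W x = integral {0..x} (\<lambda>z. (x - z) * exp (- u z))"
proof -
  have "W x = integral {0..x} (\<lambda>y. integral {0..y} (\<lambda>z. exp (- u z)))"
    unfolding W_eq[OF assms]
  proof (rule Henstock_Kurzweil_Integration.integral_cong)
    show "F y = integral {0..y} (\<lambda>z. exp (- u z))" if "y \<in> {0..x}" for y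
      using that assms by (intro F_eq) auto
  qed
  then show ?thesis using integral_primitive[OF exp_cont assms] by simp
qed

lemma W_deriv:
  assumes "x \<in> {0..xs}" 
  shows "(W has_real_derivative F x) (at x within {0..xs})"
  by (rule has_field_derivative_transform_within[OF integral_has_real_derivative[OF F_cont assms] zero_less_one assms])
     (simp only: W_eq)

lemma F_0: "F 0 = 0" and W_0: "W 0 = 0"
  using xs_pos by (auto simp: F_eq W_eq)

lemma F_diff:
  assumes "0 \<le> x" "x \<le> y" "y \<le> xs"
  shows "(y - x) / M \<le> F y - F x" "F y - F x \<le> M * (y - x)"
proof -
  obtain \<xi> where \<xi>: "\<xi> \<in> {0..xs}" "F y - F x = (y - x) * exp (- u \<xi>)"
    using mean_value_within[of 0 xs, OF F_deriv, of x y] assms by fastforce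
  have "(y - x) * (1 / M) \<le> (y - x) * exp (- u \<xi>)"
    by (rule mult_left_mono[OF exp_lower[OF \<xi>(1)]]) (use assms in simp)
  then show "(y - x) / M \<le> F y - F x" using \<xi>(2) by simp
  have "(y - x) * exp (- u \<xi>) \<le> (y - x) * M"
    by (rule mult_left_mono[OF exp_upper[OF \<xi>(1)]]) (use assms in simp)
  then show "F y - F x \<le> M * (y - x)" using \<xi>(2) by (simp only: mult.commute)
qed

lemma F_abs_diff:
  assumes "x \<in> {0..xs}" "y \<in> {0..xs}" shows "\<bar>F y - F x\<bar> \<le> M * \<bar>y - x\<bar>"
proof -
  have *: "\<bar>F y - F x\<bar> \<le> M * \<bar>y - x\<bar>" if "0 \<le> x" "x \<le> y" "y \<le> xs" for x y
  proof -
    have "0 \<le> (y - x) / M" using that M_ge_1 by simp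
    then show ?thesis using F_diff[OF that] that by simp
  qed
  show ?thesis using *[of x y] *[of y x] assms by (cases "x \<le> y") (auto simp: abs_minus_commute)
qed

lemma F_bounds:
  assumes "x \<in> {0..xs}" shows "x / M \<le> F x" "F x \<le> M * x"
  using F_diff[of 0 x] assms F_0 by auto

lemma F_pos: assumes "0 < x" "x \<le> xs" shows "0 < F x"
proof -
  have "0 < x / M" using assms M_ge_1 by simp
  then show ?thesis using F_bounds(1)[of x] assms by simp
qed

lemma F_nonneg: "x \<in> {0..xs} \<Longrightarrow> 0 \<le> F x"
  using F_pos[of x] F_0 by (cases "x = 0") auto

lemma F_less:
  assumes "0 \<le> x" "x < y" "y \<le> xs" shows "F x < F y"
proof -
  have "0 < (y - x) / M" using assms M_ge_1 by simp
  then show ?thesis using F_diff(1)[of x y] assms by linarith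
qed

lemma F_mono: "0 \<le> x \<Longrightarrow> x \<le> y \<Longrightarrow> y \<le> xs \<Longrightarrow> F x \<le> F y"
  using F_less[of x y] by (cases "x = y") auto

lemma W_diff:
  assumes "0 \<le> x" "x \<le> y" "y \<le> xs"
  shows "F x * (y - x) \<le> W y - W x" "W y - W x \<le> F y * (y - x)"
proof -
  obtain \<xi> where \<xi>: "x \<le> \<xi>" "\<xi> \<le> y" "W y - W x = (y - x) * F \<xi>"
    using mean_value_within[of 0 xs, OF W_deriv, of x y] assms by fastforce
  have "F x \<le> F \<xi>" "F \<xi> \<le> F y" using assms \<xi> by (auto intro!: F_mono)
  then have "F x * (y - x) \<le> F \<xi> * (y - x)" "F \<xi> * (y - x) \<le> F y * (y - x)"
    using assms by (auto intro!: mult_right_mono)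
  then show "F x * (y - x) \<le> W y - W x" "W y - W x \<le> F y * (y - x)"
    unfolding \<xi>(3) by (simp_all only: mult.commute)
qed

lemma W_le: "x \<in> {0..xs} \<Longrightarrow> W x \<le> F x * x"
  using W_diff(2)[of 0 x] W_0 by simp

lemma W_less:
  assumes "0 \<le> x" "x < y" "y \<le> xs" shows "W x < W y"
proof -
  define m where "m = (x + y) / 2"
  have "0 \<le> F x * (m - x)" using F_nonneg[of x] assms by (simp add: m_def)
  then have "W x \<le> W m" using W_diff(1)[of x m] assms by (simp add: m_def)
  moreover have "0 < F m * (y - m)" using F_pos[of m] assms by (simp add: m_def)
  then have "W m < W y" using W_diff(1)[of m y] assms by (simp add: m_def)
  ultimately show ?thesis by simp
qed

lemma W_less_iff: "x \<in> {0..xs} \<Longrightarrow> y \<in> {0..xs} \<Longrightarrow> W x < W y \<longleftrightarrow> x < y"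
  using W_less[of x y] W_less[of y x] by (cases x y rule: linorder_cases) auto

lemma W_pos: "0 < x \<Longrightarrow> x \<le> xs \<Longrightarrow> 0 < W x"
  using W_less[of 0 x] W_0 by simp

lemma W_nonneg: "x \<in> {0..xs} \<Longrightarrow> 0 \<le> W x"
  using W_pos[of x] W_0 by (cases "x = 0") auto

lemma W_cont: "continuous_on {0..xs} W"
  by (rule DERIV_continuous_on[OF W_deriv])

lemma W_inj: "inj_on W {0..xs}"
  by (rule inj_onI) (metis W_less_iff less_irrefl linorder_less_linear)

end

locale injection = medium +
  fixes muf phi pI p0 :: real
  assumes muf: "0 < muf" and phi: "0 < phi" and pressures: "p0 < pI"
begin

abbreviation "Y \<equiv> front xs muf phi pI p0 u"
abbreviation "\<tau> \<equiv> filling_time xs muf phi pI p0 u"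
abbreviation "rate \<equiv> (pI - p0) / (muf * phi)"

lemma rate_pos: "0 < rate"
  using muf phi pressures by simp

lemma less_filling_time_iff: "t < \<tau> \<longleftrightarrow> rate * t < W xs"
  using muf phi pressures unfolding filling_time_def by (simp add: field_simps)

text \<open>Capping at \<open>W xs\<close> makes one equation for the front valid before and after the filling time.\<close>

lemma front_range:
  assumes "0 < t" shows "0 < Y t" "Y t \<le> xs" and W_front: "W (Y t) = min (rate * t) (W xs)"
proof -
  have "0 < Y t \<and> Y t \<le> xs \<and> W (Y t) = min (rate * t) (W xs)"
  proof (cases "t < \<tau>")
    case True
    then have lt: "rate * t < W xs" using less_filling_time_iff by simp
    have pos: "0 < rate * t" by (rule mult_pos_pos[OF rate_pos assms])
    have "\<exists>y\<ge>0. y \<le> xs \<and> W y = rate * t"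
      using xs_pos lt pos W_0 by (intro IVT') (auto intro: W_cont)
    then have im: "rate * t \<in> W ` {0..xs}" by force
    have Yt: "Y t = the_inv_into {0..xs} W (rate * t)" using True by (simp add: front_def)
    have "W (Y t) = rate * t" unfolding Yt by (rule f_the_inv_into_f[OF W_inj im])
    moreover have "Y t \<in> {0..xs}" unfolding Yt by (rule the_inv_into_into[OF W_inj im]) simp
    moreover have "Y t \<noteq> 0" using \<open>W (Y t) = rate * t\<close> pos W_0 by auto
    ultimately show ?thesis using lt by auto
  next
    case False
    then show ?thesis using less_filling_time_iff xs_pos by (simp add: front_def)
  qed
  then show "0 < Y t" "Y t \<le> xs" "W (Y t) = min (rate * t) (W xs)" by auto
qed

lemma front_in: "0 < t \<Longrightarrow> Y t \<in> {0..xs}"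
  using front_range[of t] by auto

lemma front_mono: assumes "0 < s" "s \<le> t" shows "Y s \<le> Y t"
proof (rule ccontr)
  assume "\<not> Y s \<le> Y t"
  then have "W (Y t) < W (Y s)" using front_in[of s] front_in[of t] assms W_less_iff by auto
  moreover have "rate * s \<le> rate * t" using assms rate_pos by (intro mult_left_mono) auto
  ultimately show False using W_front[of s] W_front[of t] assms by auto
qed

lemma F_front_pos: "0 < t \<Longrightarrow> 0 < F (Y t)"
  using front_range[of t] F_pos by simp

end

section \<open>First-order perturbation of the front\<close>

text \<open>For \<open>s > 0\<close> the upper bound follows from \<open>exp (- s) \<le> 1 / (1 + s)\<close> and \<open>1 \<le> (1
- s + s\<^sup>2) (1 + s) = 1 + s\<^sup>3\<close>.\<close>

lemma exp_minus_linearisation: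
  fixes s :: real
  assumes "\<bar>s\<bar> \<le> 1"
  shows "\<bar>exp (- s) - 1 + s\<bar> \<le> s\<^sup>2" and "\<bar>exp (- s) - 1\<bar> \<le> 2 * \<bar>s\<bar>"
proof -
  have lower: "0 \<le> exp (- s) - 1 + s" using exp_ge_add_one_self[of "- s"] by linarith
  have upper: "exp (- s) - 1 + s \<le> s\<^sup>2"
  proof (cases "s \<le> 0")
    case True
    then show ?thesis using exp_bound[of "- s"] assms by simp
  next
    case False
    have "exp (- s) = 1 / exp s" by (simp add: exp_minus inverse_eq_divide)
    also have "\<dots> \<le> 1 / (1 + s)" using False exp_ge_add_one_self[of s] by (intro divide_left_mono) auto
    also have "\<dots> \<le> 1 - s + s\<^sup>2"
    proof -
      have "1 \<le> (1 - s + s\<^sup>2) * (1 + s)" using False by (simp add: algebra_simps power2_eq_square)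
      then show ?thesis using False by (simp add: pos_divide_le_eq)
    qed
    finally show ?thesis by simp
  qed
  show "\<bar>exp (- s) - 1 + s\<bar> \<le> s\<^sup>2" using lower upper by simp
  have "s\<^sup>2 \<le> \<bar>s\<bar>" using assms by (metis abs_ge_zero abs_idempotent abs_mult mult_left_le power2_eq_square power2_abs)
  then show "\<bar>exp (- s) - 1\<bar> \<le> 2 * \<bar>s\<bar>" using lower upper by linarith
qed

lemma integral_abs_le_mult:
  fixes g k :: "real \<Rightarrow> real"
  assumes "continuous_on {a..b} g" "continuous_on {a..b} k" "\<And>z. z \<in> {a..b} \<Longrightarrow> \<bar>g z\<bar> \<le> c * k z"
  shows "\<bar>integral {a..b} g\<bar> \<le> c * integral {a..b} k"
proof -
  have "norm (integral {a..b} g) \<le> integral {a..b} (\<lambda>z. c * k z)"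
    by (rule integral_norm_bound_integral)
       (use assms in \<open>auto intro!: integrable_continuous_real continuous_intros\<close>)
  then show ?thesis by simp
qed

text \<open>A relative error in a ratio becomes an absolute error after truncation at \<open>1\<close>; this makes the Lipschitz
bound for the pressure uniform on both sides of the front.\<close>

lemma min_one_ratio_stable:
  fixes r s \<delta> :: real
  assumes "\<bar>s - r\<bar> \<le> \<delta> * r" "0 \<le> \<delta>" "\<delta> \<le> 1" "0 \<le> r"
  shows "\<bar>min s 1 - min r 1\<bar> \<le> \<delta>"
proof (cases "r \<le> 1")
  case True
  then have "\<delta> * r \<le> \<delta>" using assms by (simp add: mult_left_le)
  then show ?thesis using True assms by (auto simp: min_def abs_le_iff)
next
  case False
  have "1 - \<delta> \<le> (1 - \<delta>) * r" using False assms by (simp add: mult_le_cancel_left1)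
  then have "1 - \<delta> \<le> s" using assms by (simp add: algebra_simps abs_le_iff)
  then show ?thesis using False assms by (simp add: min_def)
qed

lemma min_relative_change:
  fixes a b b' \<delta> :: real
  assumes "\<bar>b' - b\<bar> \<le> \<delta> * b" "0 \<le> \<delta>" "\<delta> \<le> 1" "0 \<le> a"
  shows "\<bar>min a b' - min a b\<bar> \<le> \<delta> * min a b"
proof (cases "a \<le> b")
  case True
  have "(1 - \<delta>) * a \<le> (1 - \<delta>) * b" using True assms by (intro mult_left_mono) auto
  moreover have "0 \<le> \<delta> * a" using assms by simp
  ultimately show ?thesis using True assms by (auto simp: min_def abs_le_iff algebra_simps)
next
  case False
  have "0 \<le> \<delta> * b" using assms abs_ge_zero[of "b' - b"] by linarith
  then show ?thesis using False assms by (auto simp: min_def abs_le_iff)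
qed

text \<open>The smallness condition keeps all relative errors at most \<open>1\<close>; the number \<open>28\<close> is the
constant that \<open>ratio_perturbation\<close> produces.\<close>

locale perturbation = injection +
  fixes h :: "real \<Rightarrow> real" and \<eta> :: real
  assumes h_cont: "continuous_on {0..xs} h" and h_le: "x \<in> {0..xs} \<Longrightarrow> \<bar>h x\<bar> \<le> \<eta>"
    and \<eta>_pos: "0 < \<eta>" and \<eta>_small: "28 * M\<^sup>2 * \<eta> \<le> 1"
begin

lemma M_sq_ge_1: "1 \<le> M\<^sup>2"
  using M_ge_1 by (simp add: one_le_power)

lemma \<eta>_le: "28 * \<eta> \<le> 1"
proof -
  have "28 * \<eta> * 1 \<le> 28 * \<eta> * M\<^sup>2" using \<eta>_pos M_sq_ge_1 by (intro mult_left_mono) auto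
  then show ?thesis using \<eta>_small by (simp add: mult.commute mult.left_commute)
qed

sublocale v: injection xs "M * exp 1" "\<lambda>x. u x + h x" muf phi pI p0
proof unfold_locales
  show "continuous_on {0..xs} (\<lambda>x. u x + h x)" by (intro continuous_intros u_cont h_cont)
  show "1 \<le> M * exp 1" using mult_mono[of 1 M 1 "exp (1::real)"] M_ge_1 by simp
  fix x assume x: "x \<in> {0..xs}"
  have split: "exp (- (u x + h x)) = exp (- u x) * exp (- h x)" by (simp add: exp_diff exp_minus field_simps)
  have hx: "\<bar>h x\<bar> \<le> 1" using h_le[OF x] \<eta>_le \<eta>_pos by linarith
  have "1 / M * exp (- 1) \<le> exp (- u x) * exp (- h x)"
    using exp_lower[OF x] M_ge_1 hx by (intro mult_mono) auto
  then show "1 / (M * exp 1) \<le> exp (- (u x + h x))"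
    unfolding split by (simp add: exp_minus field_simps)
  show "exp (- (u x + h x)) \<le> M * exp 1"
    unfolding split using exp_upper[OF x] M_ge_1 hx by (intro mult_mono) auto
qed (use xs_pos muf phi pressures in auto)

text \<open>\<open>dF\<close> and \<open>dW\<close> are the directional derivatives of \<open>F\<close> and \<open>W\<close> at
\<open>u\<close> in the direction \<open>h\<close>.\<close>

definition dF :: "real \<Rightarrow> real" where "dF x = - integral {0..x} (\<lambda>z. exp (- u z) * h z)"
definition dW :: "real \<Rightarrow> real" where "dW x = - integral {0..x} (\<lambda>z. (x - z) * (exp (- u z) * h z))"

text \<open>Since the weight \<open>p\<close> is nonnegative, pointwise bounds on \<open>exp (- h) - 1\<close> and on \<open>exp
(- h) - 1 + h\<close> integrate to bounds relative to the unperturbed integral. Relative bounds are what survives as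
\<open>t\<close> tends to \<open>0\<close>, where \<open>F\<close> and \<open>W\<close> vanish at the front.\<close>

lemma weighted_perturbation:
  assumes x: "x \<in> {0..xs}" and p: "continuous_on {0..x} p" "\<And>z. z \<in> {0..x} \<Longrightarrow> 0 \<le> p z"
  defines "I \<equiv> integral {0..x} (\<lambda>z. p z * exp (- u z))"
    and "I' \<equiv> integral {0..x} (\<lambda>z. p z * exp (- (u z + h z)))"
    and "dI \<equiv> - integral {0..x} (\<lambda>z. p z * (exp (- u z) * h z))"
  shows "\<bar>I' - I - dI\<bar> \<le> \<eta>\<^sup>2 * I" "\<bar>I' - I\<bar> \<le> 2 * \<eta> * I" "\<bar>dI\<bar> \<le> \<eta> * I"
proof -
  have sub: "{0..x} \<subseteq> {0..xs}" using x by auto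
  have uc: "continuous_on {0..x} (\<lambda>z. exp (- u z))"
    by (rule continuous_on_subset[OF exp_cont sub])
  have hc: "continuous_on {0..x} h" by (rule continuous_on_subset[OF h_cont sub])
  have vc: "continuous_on {0..x} (\<lambda>z. exp (- (u z + h z)))"
    by (rule continuous_on_subset[OF v.exp_cont sub])
  have split: "exp (- (u z + h z)) = exp (- u z) * exp (- h z)" for z by (simp add: exp_diff exp_minus field_simps)
  have hz: "\<bar>h z\<bar> \<le> 1" "\<bar>h z\<bar> \<le> \<eta>" if "z \<in> {0..x}" for z
    using h_le[of z] that sub \<eta>_le \<eta>_pos by force+
  have pc: "continuous_on {0..x} (\<lambda>z. p z * exp (- u z))" by (intro continuous_intros p uc)
  have ints: "(\<lambda>z. p z * exp (- u z)) integrable_on {0..x}" "(\<lambda>z. p z * exp (- (u z + h z))) integrable_on {0..x}"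
    "(\<lambda>z. p z * (exp (- u z) * h z)) integrable_on {0..x}"
    by (intro integrable_continuous_real continuous_on_mult p(1) uc vc hc)+
  have "I' - I - dI = integral {0..x} (\<lambda>z. p z * exp (- (u z + h z)) - p z * exp (- u z) + p z * (exp (- u z) * h z))"
    unfolding I_def I'_def dI_def
    using ints by (simp add: Henstock_Kurzweil_Integration.integral_diff Henstock_Kurzweil_Integration.integral_add integrable_diff)
  also have "\<bar>\<dots>\<bar> \<le> \<eta>\<^sup>2 * I" unfolding I_def
  proof (rule integral_abs_le_mult[OF _ pc])
    show "continuous_on {0..x} (\<lambda>z. p z * exp (- (u z + h z)) - p z * exp (- u z) + p z * (exp (- u z) * h z))"
      by (intro continuous_on_add continuous_on_diff continuous_on_mult p(1) uc vc hc)
    fix z assume z: "z \<in> {0..x}"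
    have eq: "p z * exp (- (u z + h z)) - p z * exp (- u z) + p z * (exp (- u z) * h z)
      = (p z * exp (- u z)) * (exp (- h z) - 1 + h z)" unfolding split by (simp add: algebra_simps)
    have "\<bar>exp (- h z) - 1 + h z\<bar> \<le> (h z)\<^sup>2" by (rule exp_minus_linearisation(1)[OF hz(1)[OF z]])
    also have "(h z)\<^sup>2 \<le> \<eta>\<^sup>2" using hz(2)[OF z] by (metis abs_ge_zero power2_abs power_mono)
    finally have "(p z * exp (- u z)) * \<bar>exp (- h z) - 1 + h z\<bar> \<le> (p z * exp (- u z)) * \<eta>\<^sup>2"
      using p(2)[OF z] by (intro mult_left_mono) auto
    then show "\<bar>p z * exp (- (u z + h z)) - p z * exp (- u z) + p z * (exp (- u z) * h z)\<bar> \<le> \<eta>\<^sup>2 * (p z * exp (- u z))"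
      unfolding eq abs_mult using p(2)[OF z] by (simp add: mult.commute)
  qed
  finally show "\<bar>I' - I - dI\<bar> \<le> \<eta>\<^sup>2 * I" .
  have "I' - I = integral {0..x} (\<lambda>z. p z * exp (- (u z + h z)) - p z * exp (- u z))"
    unfolding I_def I'_def
    using ints by (simp add: Henstock_Kurzweil_Integration.integral_diff)
  also have "\<bar>\<dots>\<bar> \<le> 2 * \<eta> * I" unfolding I_def
  proof (rule integral_abs_le_mult[OF _ pc])
    show "continuous_on {0..x} (\<lambda>z. p z * exp (- (u z + h z)) - p z * exp (- u z))"
      by (intro continuous_on_diff continuous_on_mult p(1) uc vc)
    fix z assume z: "z \<in> {0..x}"
    have eq: "p z * exp (- (u z + h z)) - p z * exp (- u z)
      = (p z * exp (- u z)) * (exp (- h z) - 1)" unfolding split by (simp add: algebra_simps)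
    have "\<bar>exp (- h z) - 1\<bar> \<le> 2 * \<eta>"
      using exp_minus_linearisation(2)[OF hz(1)[OF z]] hz(2)[OF z] by linarith
    then have "(p z * exp (- u z)) * \<bar>exp (- h z) - 1\<bar> \<le> (p z * exp (- u z)) * (2 * \<eta>)"
      using p(2)[OF z] by (intro mult_left_mono) auto
    then show "\<bar>p z * exp (- (u z + h z)) - p z * exp (- u z)\<bar> \<le> 2 * \<eta> * (p z * exp (- u z))"
      unfolding eq abs_mult using p(2)[OF z] by (simp add: mult.commute)
  qed
  finally show "\<bar>I' - I\<bar> \<le> 2 * \<eta> * I" .
  have "\<bar>integral {0..x} (\<lambda>z. p z * (exp (- u z) * h z))\<bar> \<le> \<eta> * I" unfolding I_def
  proof (rule integral_abs_le_mult[OF _ pc])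
    show "continuous_on {0..x} (\<lambda>z. p z * (exp (- u z) * h z))"
      by (intro continuous_on_mult p(1) uc hc)
    fix z assume z: "z \<in> {0..x}"
    have "(p z * exp (- u z)) * \<bar>h z\<bar> \<le> (p z * exp (- u z)) * \<eta>"
      using p(2)[OF z] hz(2)[OF z] by (intro mult_left_mono) auto
    then show "\<bar>p z * (exp (- u z) * h z)\<bar> \<le> \<eta> * (p z * exp (- u z))"
      unfolding abs_mult using p(2)[OF z] by (simp add: mult.commute mult.left_commute)
  qed
  then show "\<bar>dI\<bar> \<le> \<eta> * I" by (simp add: dI_def)
qed

lemma F_perturbation:
  assumes x: "x \<in> {0..xs}"
  shows "\<bar>v.F x - F x - dF x\<bar> \<le> \<eta>\<^sup>2 * F x" "\<bar>v.F x - F x\<bar> \<le> 2 * \<eta> * F x" "\<bar>dF x\<bar> \<le> \<eta> * F x"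
  using weighted_perturbation[OF x, of "\<lambda>_. 1"] unfolding F_eq[OF x] v.F_eq[OF x] dF_def
  by simp_all

lemma W_perturbation:
  assumes x: "x \<in> {0..xs}"
  shows "\<bar>v.W x - W x - dW x\<bar> \<le> \<eta>\<^sup>2 * W x" "\<bar>v.W x - W x\<bar> \<le> 2 * \<eta> * W x" "\<bar>dW x\<bar> \<le> \<eta> * W x"
proof -
  have "continuous_on {0..x} (\<lambda>z. x - z)" by (intro continuous_intros)
  then show "\<bar>v.W x - W x - dW x\<bar> \<le> \<eta>\<^sup>2 * W x" "\<bar>v.W x - W x\<bar> \<le> 2 * \<eta> * W x" "\<bar>dW x\<bar> \<le> \<eta> * W x"
    using weighted_perturbation[OF x, of "\<lambda>z. x - z"]
    unfolding W_eq_weighted[OF x] v.W_eq_weighted[OF x] dW_def by simp_all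
qed

text \<open>The values of \<open>W\<close> at the two fronts agree up to a factor \<open>1 + 8 \<eta>\<close>. Convexity of
\<open>W\<close> with \<open>W 0 = 0\<close> turns this into the same relative bound for the fronts: from
\<open>a\<close> to \<open>b\<close> the function grows by at least \<open>F a (b - a)\<close>, while \<open>W a \<le>
F a * a\<close>.\<close>

lemma front_perturbation:
  assumes t: "0 < t" shows "\<bar>v.Y t - Y t\<bar> \<le> 8 * \<eta> * Y t"
proof -
  define m where "m = min (rate * t) (W xs)"
  define w where "w = W (v.Y t)"
  have Y: "Y t \<in> {0..xs}" "v.Y t \<in> {0..xs}" using front_in v.front_in t by auto
  have WY: "W (Y t) = m" using W_front[OF t] by (simp add: m_def)
  have m0: "0 \<le> m" using W_nonneg[OF Y(1)] WY by simp
  have w0: "0 \<le> w" using W_nonneg[OF Y(2)] by (simp add: w_def)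
  have rt: "0 \<le> rate * t" by (rule less_imp_le[OF mult_pos_pos[OF rate_pos t]])
  have "\<bar>v.W (v.Y t) - m\<bar> \<le> 2 * \<eta> * m"
    unfolding v.W_front[OF t] m_def
    by (rule min_relative_change) (use W_perturbation(2)[of xs] xs_pos \<eta>_pos \<eta>_le rt in auto)
  moreover have "\<bar>v.W (v.Y t) - w\<bar> \<le> 2 * \<eta> * w"
    using W_perturbation(2)[OF Y(2)] by (simp add: w_def)
  ultimately have cmp: "(1 - 2 * \<eta>) * w \<le> (1 + 2 * \<eta>) * m" "(1 - 2 * \<eta>) * m \<le> (1 + 2 * \<eta>) * w"
    by (simp_all add: algebra_simps abs_le_iff)
  have "\<eta> * \<eta> * 4 \<le> \<eta>" using \<eta>_le \<eta>_pos by simp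
  then have key: "1 + 2 * \<eta> \<le> (1 + 8 * \<eta>) * (1 - 2 * \<eta>)" by (simp add: algebra_simps)
  have eight: "a \<le> (1 + 8 * \<eta>) * b" if "(1 - 2 * \<eta>) * a \<le> (1 + 2 * \<eta>) * b" "0 \<le> b" for a b
  proof -
    have "(1 - 2 * \<eta>) * a \<le> ((1 + 8 * \<eta>) * (1 - 2 * \<eta>)) * b"
      using that mult_right_mono[OF key that(2)] by linarith
    then have "(1 - 2 * \<eta>) * a \<le> (1 - 2 * \<eta>) * ((1 + 8 * \<eta>) * b)" by (simp only: mult_ac)
    then show ?thesis using \<eta>_le by (subst (asm) mult_le_cancel_left_pos) auto
  qed
  have step: "b - a \<le> 8 * \<eta> * a" if ab: "0 < a" "a \<le> b" "b \<le> xs" "W b \<le> (1 + 8 * \<eta>) * W a" for a b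
  proof -
    have "F a * (b - a) \<le> W b - W a" using ab by (intro W_diff) auto
    also have "\<dots> \<le> 8 * \<eta> * W a" using ab by (simp add: algebra_simps)
    also have "\<dots> \<le> 8 * \<eta> * (F a * a)" using W_le[of a] ab \<eta>_pos by (intro mult_left_mono) auto
    finally have "F a * (b - a) \<le> F a * (8 * \<eta> * a)" by (simp only: mult_ac)
    then show ?thesis using F_pos[of a] ab by simp
  qed
  show ?thesis
  proof (cases "Y t \<le> v.Y t")
    case True
    have "v.Y t - Y t \<le> 8 * \<eta> * Y t"
      using eight[OF cmp(1) m0] True front_range[OF t] Y by (intro step) (auto simp: WY w_def)
    then show ?thesis using True by simp
  next
    case False
    have "Y t - v.Y t \<le> 8 * \<eta> * v.Y t"
      using eight[OF cmp(2) w0] False v.front_range[OF t] Y by (intro step) (auto simp: WY w_def)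
    also have "\<dots> \<le> 8 * \<eta> * Y t" using False \<eta>_pos by (intro mult_left_mono) auto
    finally show ?thesis using False by simp
  qed
qed

text \<open>The relative bound on the front passes to \<open>F\<close> because \<open>F\<close> has slope at most \<open>M\<close>
and \<open>F y \<ge> y / M\<close>.\<close>

lemma front_flux_perturbation:
  assumes t: "0 < t" shows "\<bar>v.F (v.Y t) - F (Y t)\<bar> \<le> 12 * M\<^sup>2 * \<eta> * F (Y t)"
proof -
  define q where "q = F (Y t)"
  have Y: "Y t \<in> {0..xs}" "v.Y t \<in> {0..xs}" using front_in v.front_in t by auto
  have q: "0 < q" using F_front_pos[OF t] by (simp add: q_def)
  have "Y t \<le> M * q" using F_bounds(1)[OF Y(1)] M_ge_1 by (simp add: q_def field_simps)
  have "\<bar>F (v.Y t) - q\<bar> \<le> M * \<bar>v.Y t - Y t\<bar>" unfolding q_def by (rule F_abs_diff[OF Y])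
  also have "\<dots> \<le> M * (8 * \<eta> * (M * q))"
  proof (rule mult_left_mono)
    have "8 * \<eta> * Y t \<le> 8 * \<eta> * (M * q)" using \<open>Y t \<le> M * q\<close> \<eta>_pos by (intro mult_left_mono) auto
    then show "\<bar>v.Y t - Y t\<bar> \<le> 8 * \<eta> * (M * q)" using front_perturbation[OF t] by linarith
  qed (use M_ge_1 in simp)
  finally have 1: "\<bar>F (v.Y t) - q\<bar> \<le> 8 * M\<^sup>2 * \<eta> * q" by (simp add: power2_eq_square mult_ac)
  have "8 * M\<^sup>2 * \<eta> * q \<le> 1 * q" using \<eta>_small q \<eta>_pos by (intro mult_right_mono) auto
  then have Fv: "F (v.Y t) \<le> 2 * q" using 1 by linarith
  have "\<bar>v.F (v.Y t) - F (v.Y t)\<bar> \<le> 2 * \<eta> * F (v.Y t)" by (rule F_perturbation(2)[OF Y(2)])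
  also have "\<dots> \<le> 2 * \<eta> * (2 * q)" using Fv \<eta>_pos by (intro mult_left_mono) auto
  also have "\<dots> = 4 * (\<eta> * q) * 1" by simp
  also have "\<dots> \<le> 4 * (\<eta> * q) * M\<^sup>2" using M_sq_ge_1 \<eta>_pos q by (intro mult_left_mono) auto
  finally have "\<bar>v.F (v.Y t) - F (v.Y t)\<bar> \<le> 4 * M\<^sup>2 * \<eta> * q" by (simp only: mult_ac)
  then have "\<bar>v.F (v.Y t) - q\<bar> \<le> 12 * M\<^sup>2 * \<eta> * q" using 1 by linarith
  then show ?thesis by (simp add: q_def)
qed

lemma ratio_perturbation:
  assumes t: "0 < t" and x: "x \<in> {0..xs}"
  shows "\<bar>v.F x / v.F (v.Y t) - F x / F (Y t)\<bar> \<le> 28 * M\<^sup>2 * \<eta> * (F x / F (Y t))"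
proof -
  define q where "q = F (Y t)"
  define q' where "q' = v.F (v.Y t)"
  have q: "0 < q" "0 < q'" using F_front_pos[OF t] v.F_front_pos[OF t] by (auto simp: q_def q'_def)
  have dq: "\<bar>q' - q\<bar> \<le> 12 * M\<^sup>2 * \<eta> * q" using front_flux_perturbation[OF t] by (simp add: q_def q'_def)
  have "12 * M\<^sup>2 * \<eta> * q \<le> (1/2) * q" using \<eta>_small q \<eta>_pos by (intro mult_right_mono) auto
  then have half: "q \<le> 2 * q'" using dq by linarith
  have Fx: "0 \<le> F x" by (rule F_nonneg[OF x])
  have "v.F x / q' - F x / q = ((v.F x - F x) * q - F x * (q' - q)) / (q' * q)"
    using q by (simp add: field_simps)
  also have "\<bar>\<dots>\<bar> \<le> (14 * M\<^sup>2 * \<eta> * F x * q) / (q' * q)"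
  proof -
    have "\<bar>(v.F x - F x) * q\<bar> \<le> (2 * \<eta> * F x) * q"
      unfolding abs_mult using F_perturbation(2)[OF x] q by (simp add: mult_right_mono)
    moreover have "\<bar>F x * (q' - q)\<bar> \<le> F x * (12 * M\<^sup>2 * \<eta> * q)"
      unfolding abs_mult using dq Fx by (simp add: mult_left_mono)
    moreover have "(2 * \<eta> * F x) * q * 1 \<le> (2 * \<eta> * F x) * q * M\<^sup>2"
      using M_sq_ge_1 \<eta>_pos Fx q by (intro mult_left_mono) auto
    ultimately have "\<bar>(v.F x - F x) * q - F x * (q' - q)\<bar> \<le> 14 * M\<^sup>2 * \<eta> * F x * q"
      using abs_triangle_ineq4[of "(v.F x - F x) * q" "F x * (q' - q)"] by (simp add: algebra_simps)
    then have "\<bar>(v.F x - F x) * q - F x * (q' - q)\<bar> / (q' * q) \<le> (14 * M\<^sup>2 * \<eta> * F x * q) / (q' * q)"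
      using q by (intro divide_right_mono) auto
    moreover have "\<bar>q' * q\<bar> = q' * q" using q by simp
    ultimately show ?thesis unfolding abs_divide by simp
  qed
  also have "\<dots> = 14 * M\<^sup>2 * \<eta> * F x / q'" using q by simp
  also have "\<dots> \<le> 14 * M\<^sup>2 * \<eta> * F x / (q / 2)"
    using half q Fx \<eta>_pos by (intro divide_left_mono) auto
  finally show ?thesis by (simp add: q_def q'_def)
qed

end

section \<open>First-order perturbation of the pressure\<close>

text \<open>Truncating the ratio at \<open>1\<close> replaces the case distinction at the front in the pressure, since
\<open>F\<close> is increasing.\<close>

definition normalized_pressure ::
  "real \<Rightarrow> real \<Rightarrow> real \<Rightarrow> real \<Rightarrow> real \<Rightarrow> (real \<Rightarrow> real) \<Rightarrow> real \<Rightarrow> real \<Rightarrow> real" where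
  "normalized_pressure xs muf phi pI p0 u x t =
     1 - min (F_int u x / F_int u (front xs muf phi pI p0 u t)) 1"

context injection begin

abbreviation "N \<equiv> normalized_pressure xs muf phi pI p0 u"

lemma F_le: assumes "x \<in> {0..xs}" shows "F x \<le> M * xs"
proof -
  have "M * x \<le> M * xs" using assms M_ge_1 by (intro mult_left_mono) auto
  then show ?thesis using F_bounds(2)[OF assms] by linarith
qed

lemma pressure_eq_normalized:
  assumes t: "0 < t" and x: "0 < x" "x < xs"
  shows "pressure xs muf phi pI p0 u x t = p0 + (pI - p0) * N x t"
proof (cases "x < Y t")
  case True
  then have "F x \<le> F (Y t)" using front_range[OF t] x by (intro F_mono) auto
  then have "F x / F (Y t) \<le> 1" using F_front_pos[OF t] by simp
  then show ?thesis using True x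
    by (simp add: pressure_def normalized_pressure_def Let_def min_def algebra_simps)
next
  case False
  then have "F (Y t) \<le> F x" using front_range[OF t] x by (intro F_mono) auto
  then have "1 \<le> F x / F (Y t)" using F_front_pos[OF t] by simp
  then show ?thesis using False
    by (simp add: pressure_def normalized_pressure_def Let_def min_def)
qed

end

context perturbation begin

lemma perturbed_injection: "injection xs (M * exp 1) (\<lambda>x. u x + h x) muf phi pI p0"
  by unfold_locales

text \<open>The derivative of \<open>F (Y t)\<close>: the chain rule gives \<open>dF (Y t) + exp (- u (Y t)) * dY\<close>, and
implicit differentiation of \<open>W (Y t) = rate * t\<close> gives \<open>dY = - dW (Y t) / F (Y t)\<close> before
the filling time; afterwards the front stands still.\<close>

definition dflux :: "real \<Rightarrow> real" where
  "dflux t = dF (Y t) - of_bool (t < \<tau>) * exp (- u (Y t)) * dW (Y t) / F (Y t)"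

text \<open>The derivative of the normalized pressure by the quotient rule behind the front; ahead of it the truncation is active.\<close>

definition dN :: "real \<Rightarrow> real \<Rightarrow> real" where
  "dN x t = (if x < Y t then F x / (F (Y t))\<^sup>2 * dflux t - dF x / F (Y t) else 0)"

lemma normalized_pressure_perturbation:
  assumes t: "0 < t" and x: "x \<in> {0..xs}"
  shows "\<bar>v.N x t - N x t\<bar> \<le> 28 * M\<^sup>2 * \<eta>"
proof -
  have "\<bar>min (v.F x / v.F (v.Y t)) 1 - min (F x / F (Y t)) 1\<bar> \<le> 28 * M\<^sup>2 * \<eta>"
    by (rule min_one_ratio_stable[OF ratio_perturbation[OF t x]])
       (use \<eta>_small \<eta>_pos F_nonneg[OF x] F_front_pos[OF t] in auto)
  then show ?thesis by (simp add: normalized_pressure_def abs_minus_commute)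
qed

lemma dflux_le:
  assumes t: "0 < t" shows "\<bar>dflux t\<bar> \<le> 2 * M\<^sup>2 * \<eta> * F (Y t)"
proof -
  have Y: "Y t \<in> {0..xs}" using front_in t by auto
  have q: "0 < F (Y t)" by (rule F_front_pos[OF t])
  have "\<bar>of_bool (t < \<tau>) * exp (- u (Y t)) * dW (Y t) / F (Y t)\<bar> \<le> M * (\<eta> * (F (Y t) * (M * F (Y t)))) / F (Y t)"
  proof -
    have "Y t \<le> M * F (Y t)" using F_bounds(1)[OF Y] M_ge_1 by (simp add: field_simps)
    then have "W (Y t) \<le> F (Y t) * (M * F (Y t))"
      using W_le[OF Y] q by (meson less_imp_le mult_left_mono order_trans)
    then have "\<eta> * W (Y t) \<le> \<eta> * (F (Y t) * (M * F (Y t)))" using \<eta>_pos by (intro mult_left_mono) auto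
    then have dw: "\<bar>dW (Y t)\<bar> \<le> \<eta> * (F (Y t) * (M * F (Y t)))" using W_perturbation(3)[OF Y] by linarith
    have e: "\<bar>of_bool (t < \<tau>) * exp (- u (Y t))\<bar> \<le> M" using exp_upper[OF Y] M_ge_1 by simp
    have "\<bar>of_bool (t < \<tau>) * exp (- u (Y t)) * dW (Y t)\<bar> \<le> M * (\<eta> * (F (Y t) * (M * F (Y t))))"
      unfolding abs_mult[of "_ * _"] using M_ge_1 by (intro mult_mono[OF e dw]) auto
    then show ?thesis unfolding abs_divide abs_of_pos[OF q]
      by (rule divide_right_mono) (use q in simp)
  qed
  also have "\<dots> = M\<^sup>2 * \<eta> * F (Y t)" using q by (simp add: power2_eq_square)
  moreover have "\<bar>dF (Y t)\<bar> \<le> M\<^sup>2 * \<eta> * F (Y t)"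
  proof -
    have "1 * (\<eta> * F (Y t)) \<le> M\<^sup>2 * (\<eta> * F (Y t))" using M_sq_ge_1 \<eta>_pos q by (intro mult_right_mono) auto
    then show ?thesis using F_perturbation(3)[OF Y] by (simp add: mult.assoc)
  qed
  ultimately show ?thesis unfolding dflux_def by linarith
qed

lemma dN_le:
  assumes t: "0 < t" and x: "x \<in> {0..xs}" shows "\<bar>dN x t\<bar> \<le> 3 * M\<^sup>2 * \<eta>"
proof (cases "x < Y t")
  case True
  have Y: "Y t \<in> {0..xs}" using front_in t by auto
  have q: "0 < F (Y t)" by (rule F_front_pos[OF t])
  have Fx: "0 \<le> F x" "F x \<le> F (Y t)" using F_nonneg[OF x] True x Y F_mono[of x "Y t"] by auto
  have "\<bar>F x / (F (Y t))\<^sup>2 * dflux t\<bar> \<le> 1 / F (Y t) * (2 * M\<^sup>2 * \<eta> * F (Y t))"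
    unfolding abs_mult
  proof (intro mult_mono dflux_le t)
    have "F x / (F (Y t))\<^sup>2 \<le> F (Y t) / (F (Y t))\<^sup>2" using Fx by (intro divide_right_mono) auto
    then show "\<bar>F x / (F (Y t))\<^sup>2\<bar> \<le> 1 / F (Y t)" using q Fx by (simp add: power2_eq_square)
  qed (use q in auto)
  also have "\<dots> = 2 * M\<^sup>2 * \<eta>" using q by simp
  finally have 1: "\<bar>F x / (F (Y t))\<^sup>2 * dflux t\<bar> \<le> 2 * M\<^sup>2 * \<eta>" .
  have "\<bar>dF x\<bar> \<le> \<eta> * F (Y t)"
    using F_perturbation(3)[OF x] mult_left_mono[OF Fx(2), of \<eta>] \<eta>_pos by linarith
  then have "\<bar>dF x / F (Y t)\<bar> \<le> \<eta>" unfolding abs_divide using q by (simp add: pos_divide_le_eq)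
  also have "1 * \<eta> \<le> M\<^sup>2 * \<eta>" using M_sq_ge_1 \<eta>_pos by (intro mult_right_mono) auto
  finally have "\<bar>dF x / F (Y t)\<bar> \<le> M\<^sup>2 * \<eta>" by simp
  with 1 have "\<bar>F x / (F (Y t))\<^sup>2 * dflux t - dF x / F (Y t)\<bar> \<le> 3 * M\<^sup>2 * \<eta>" by linarith
  then show ?thesis using True unfolding dN_def by (simp only: if_True)
next
  case False
  then show ?thesis using \<eta>_pos by (simp add: dN_def)
qed

text \<open>Both fronts solve the same equation with right-hand side \<open>rate * t\<close>, so the mean value theorem for the
perturbed \<open>W\<close> gives \<open>(Y' - Y) * F' \<xi> = - (W' Y - W Y)\<close>, and replacing \<open>F'
\<xi>\<close> by \<open>F Y\<close> costs \<open>O(\<eta>)\<close> times \<open>Y' - Y = O(\<eta>)\<close>.\<close>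

lemma front_linearisation:
  assumes t: "0 < t" "t < \<tau>" "t < v.\<tau>"
  shows "\<bar>F (Y t) * (v.Y t - Y t) + dW (Y t)\<bar> \<le> (80 * M * xs\<^sup>2 + W xs) * \<eta>\<^sup>2"
proof -
  define y where "y = Y t"
  define y' where "y' = v.Y t"
  have Y: "y \<in> {0..xs}" "y' \<in> {0..xs}" using front_in v.front_in t by (auto simp: y_def y'_def)
  have W': "v.W y' = rate * t" "W y = rate * t"
    using t W_front[of t] v.W_front[of t] less_filling_time_iff v.less_filling_time_iff by (auto simp: y_def y'_def)
  have dy: "\<bar>y' - y\<bar> \<le> 8 * \<eta> * xs"
  proof -
    have "8 * \<eta> * y \<le> 8 * \<eta> * xs" using Y \<eta>_pos by (intro mult_left_mono) auto
    then show ?thesis using front_perturbation[OF t(1)] by (simp add: y_def y'_def)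
  qed
  obtain \<xi> where \<xi>: "\<xi> \<in> {0..xs}" "min y y' \<le> \<xi>" "\<xi> \<le> max y y'" "v.W y' - v.W y = (y' - y) * v.F \<xi>"
    using mean_value_within[of 0 xs, OF v.W_deriv Y] by blast
  have \<xi>y: "\<bar>\<xi> - y\<bar> \<le> \<bar>y' - y\<bar>" using \<xi> by (auto simp: min_def max_def split: if_splits)
  have "\<bar>v.F \<xi> - F y\<bar> \<le> 10 * \<eta> * M * xs"
  proof -
    have "F \<xi> \<le> M * xs" by (rule F_le[OF \<xi>(1)])
    then have "2 * \<eta> * F \<xi> \<le> 2 * \<eta> * (M * xs)" using \<eta>_pos by (intro mult_left_mono) auto
    moreover have "M * \<bar>\<xi> - y\<bar> \<le> M * (8 * \<eta> * xs)" using \<xi>y dy M_ge_1 by (intro mult_left_mono) auto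
    ultimately show ?thesis
      using F_perturbation(2)[OF \<xi>(1)] F_abs_diff[OF Y(1) \<xi>(1)] by (simp add: algebra_simps abs_le_iff)
  qed
  then have "\<bar>(y' - y) * (F y - v.F \<xi>)\<bar> \<le> (8 * \<eta> * xs) * (10 * \<eta> * M * xs)"
    unfolding abs_mult using dy by (intro mult_mono) (auto simp: abs_minus_commute)
  moreover have "F y * (y' - y) + dW y = (y' - y) * (F y - v.F \<xi>) - (v.W y - W y - dW y)"
    using \<xi>(4) W' by (simp add: algebra_simps)
  moreover have "\<bar>v.W y - W y - dW y\<bar> \<le> \<eta>\<^sup>2 * W xs"
  proof -
    have "W y \<le> W xs" using W_less[of y xs] Y by (cases "y = xs") auto
    then have "\<eta>\<^sup>2 * W y \<le> \<eta>\<^sup>2 * W xs" by (intro mult_left_mono) auto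
    then show ?thesis using W_perturbation(1)[OF Y(1)] by linarith
  qed
  ultimately show ?thesis
    unfolding y_def[symmetric] y'_def[symmetric]
    by (simp add: algebra_simps power2_eq_square)
qed

text \<open>The coefficient \<open>u\<close> is merely continuous, so the increment of \<open>F\<close> over the displacement of
the front is linear only up to the oscillation of \<open>exp (- u)\<close> near the front. This term has no rate and
is the reason that the remainder is \<open>o(\<eta>)\<close> rather than \<open>O(\<eta>\<^sup>2)\<close>.\<close>

lemma flux_linearisation:
  assumes t: "0 < t"
  shows "\<exists>\<xi>\<in>{0..xs}. \<bar>\<xi> - Y t\<bar> \<le> 8 * \<eta> * xs \<and>
    \<bar>v.F (v.Y t) - F (Y t) - dF (Y t) - exp (- u (Y t)) * (v.Y t - Y t)\<bar>
      \<le> 17 * M * xs * \<eta>\<^sup>2 + 8 * \<eta> * xs * \<bar>exp (- u \<xi>) - exp (- u (Y t))\<bar>"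
proof -
  define y where "y = Y t"
  define y' where "y' = v.Y t"
  have Y: "y \<in> {0..xs}" "y' \<in> {0..xs}" using front_in v.front_in t by (auto simp: y_def y'_def)
  have dy: "\<bar>y' - y\<bar> \<le> 8 * \<eta> * xs"
  proof -
    have "8 * \<eta> * y \<le> 8 * \<eta> * xs" using Y \<eta>_pos by (intro mult_left_mono) auto
    then show ?thesis using front_perturbation[OF t(1)] by (simp add: y_def y'_def)
  qed
  obtain \<xi> where \<xi>: "\<xi> \<in> {0..xs}" "min y y' \<le> \<xi>" "\<xi> \<le> max y y'" "v.F y' - v.F y = (y' - y) * exp (- (u \<xi> + h \<xi>))"
    using mean_value_within[of 0 xs, OF v.F_deriv Y] by blast
  have \<xi>y: "\<bar>\<xi> - y\<bar> \<le> 8 * \<eta> * xs" using \<xi> dy by (auto simp: min_def max_def split: if_splits)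
  define osc where "osc = \<bar>exp (- u \<xi>) - exp (- u y)\<bar>"
  have "\<bar>exp (- (u \<xi> + h \<xi>)) - exp (- u \<xi>)\<bar> \<le> M * (2 * \<eta>)"
  proof -
    have split: "exp (- (u \<xi> + h \<xi>)) - exp (- u \<xi>) = exp (- u \<xi>) * (exp (- h \<xi>) - 1)"
      by (simp add: exp_diff exp_minus field_simps)
    have "\<bar>exp (- h \<xi>) - 1\<bar> \<le> 2 * \<eta>"
      using exp_minus_linearisation(2)[of "h \<xi>"] h_le[OF \<xi>(1)] \<eta>_le \<eta>_pos by linarith
    then show ?thesis unfolding split abs_mult using exp_upper[OF \<xi>(1)] M_ge_1 by (intro mult_mono) auto
  qed
  then have "\<bar>exp (- (u \<xi> + h \<xi>)) - exp (- u y)\<bar> \<le> osc + 2 * M * \<eta>" unfolding osc_def by linarith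
  then have "\<bar>(y' - y) * (exp (- (u \<xi> + h \<xi>)) - exp (- u y))\<bar> \<le> (8 * \<eta> * xs) * (osc + 2 * M * \<eta>)"
    unfolding abs_mult using dy by (intro mult_mono) auto
  moreover have "v.F y' - F y - dF y - exp (- u y) * (y' - y)
      = (v.F y - F y - dF y) + (y' - y) * (exp (- (u \<xi> + h \<xi>)) - exp (- u y))"
    using \<xi>(4) by (simp add: algebra_simps)
  moreover have "\<bar>v.F y - F y - dF y\<bar> \<le> \<eta>\<^sup>2 * (M * xs)"
  proof -
    have "F y \<le> M * xs" by (rule F_le[OF Y(1)])
    then have "\<eta>\<^sup>2 * F y \<le> \<eta>\<^sup>2 * (M * xs)" by (intro mult_left_mono) auto
    then show ?thesis using F_perturbation(1)[OF Y(1)] by linarith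
  qed
  ultimately have "\<bar>v.F y' - F y - dF y - exp (- u y) * (y' - y)\<bar>
      \<le> 17 * M * xs * \<eta>\<^sup>2 + 8 * \<eta> * xs * osc"
    by (simp add: algebra_simps power2_eq_square)
  then show ?thesis using \<xi>(1) \<xi>y unfolding y_def y'_def osc_def by blast
qed

end

context injection begin

context
  fixes h :: "nat \<Rightarrow> real \<Rightarrow> real" and \<eta> :: "nat \<Rightarrow> real"
  assumes P: "\<And>n. perturbation xs M u muf phi pI p0 (h n) (\<eta> n)" and \<eta>_lim: "\<eta> \<longlonglongrightarrow> 0"
begin

abbreviation "F' n \<equiv> F_int (\<lambda>x. u x + h n x)"
abbreviation "Y' n \<equiv> front xs muf phi pI p0 (\<lambda>x. u x + h n x)"
abbreviation "N' n \<equiv> normalized_pressure xs muf phi pI p0 (\<lambda>x. u x + h n x)"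
abbreviation "dF' n \<equiv> perturbation.dF u (h n)"
abbreviation "dW' n \<equiv> perturbation.dW u (h n)"
abbreviation "dflux' n \<equiv> perturbation.dflux xs u muf phi pI p0 (h n)"
abbreviation "dN' n \<equiv> perturbation.dN xs u muf phi pI p0 (h n)"

lemma \<eta>_seq_pos: "0 < \<eta> n"
  by (rule perturbation.\<eta>_pos[OF P])

lemma front_flux_tendsto:
  assumes t: "0 < t" shows "(\<lambda>n. F' n (Y' n t)) \<longlonglongrightarrow> F (Y t)"
proof (rule LIM_zero_cancel, rule Lim_null_comparison)
  show "\<forall>\<^sub>F n in sequentially. norm (F' n (Y' n t) - F (Y t)) \<le> 12 * M\<^sup>2 * \<eta> n * F (Y t)"
    using perturbation.front_flux_perturbation[OF P t] by simp
  show "(\<lambda>n. 12 * M\<^sup>2 * \<eta> n * F (Y t)) \<longlonglongrightarrow> 0" by (auto intro!: tendsto_eq_intros \<eta>_lim)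
qed

text \<open>A time on one side of the filling time stays on that side for all small perturbations.\<close>

lemma filling_time_tendsto:
  "(\<lambda>n. filling_time xs muf phi pI p0 (\<lambda>x. u x + h n x)) \<longlonglongrightarrow> \<tau>"
proof -
  have "(\<lambda>n. W_int (\<lambda>x. u x + h n x) xs) \<longlonglongrightarrow> W xs"
  proof (rule LIM_zero_cancel, rule Lim_null_comparison)
    have xs: "xs \<in> {0..xs}" using xs_pos by simp
    show "\<forall>\<^sub>F n in sequentially. norm (W_int (\<lambda>x. u x + h n x) xs - W xs) \<le> 2 * \<eta> n * W xs"
      using perturbation.W_perturbation(2)[OF P xs] by simp
    show "(\<lambda>n. 2 * \<eta> n * W xs) \<longlonglongrightarrow> 0" by (auto intro!: tendsto_eq_intros \<eta>_lim)
  qed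
  then show ?thesis unfolding filling_time_def by (intro tendsto_intros)
qed

lemma flux_asymptotics:
  assumes t: "0 < t" "t \<noteq> \<tau>"
  shows "(\<lambda>n. (F' n (Y' n t) - F (Y t) - dflux' n t) / \<eta> n) \<longlonglongrightarrow> 0"
proof -
  define y where "y = Y t"
  define q where "q = F y"
  have y: "y \<in> {0..xs}" using front_in t by (simp add: y_def)
  have q: "0 < q" using F_front_pos t by (simp add: q_def y_def)
  have "\<forall>n. \<exists>\<xi>. \<xi> \<in> {0..xs} \<and> \<bar>\<xi> - y\<bar> \<le> 8 * \<eta> n * xs \<and>
    \<bar>F' n (Y' n t) - q - dF' n y - exp (- u y) * (Y' n t - y)\<bar>
      \<le> 17 * M * xs * (\<eta> n)\<^sup>2 + 8 * \<eta> n * xs * \<bar>exp (- u \<xi>) - exp (- u y)\<bar>"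
    using perturbation.flux_linearisation[OF P t(1)] unfolding y_def q_def by blast
  from choice[OF this] obtain \<xi> where \<xi>_all: "\<forall>n. \<xi> n \<in> {0..xs} \<and> \<bar>\<xi> n - y\<bar> \<le> 8 * \<eta> n * xs \<and>
    \<bar>F' n (Y' n t) - q - dF' n y - exp (- u y) * (Y' n t - y)\<bar>
      \<le> 17 * M * xs * (\<eta> n)\<^sup>2 + 8 * \<eta> n * xs * \<bar>exp (- u (\<xi> n)) - exp (- u y)\<bar>" ..
  then have \<xi>: "\<And>n. \<xi> n \<in> {0..xs}" "\<And>n. \<bar>\<xi> n - y\<bar> \<le> 8 * \<eta> n * xs"
    "\<And>n. \<bar>F' n (Y' n t) - q - dF' n y - exp (- u y) * (Y' n t - y)\<bar>
      \<le> 17 * M * xs * (\<eta> n)\<^sup>2 + 8 * \<eta> n * xs * \<bar>exp (- u (\<xi> n)) - exp (- u y)\<bar>"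
    by blast+
  have "\<xi> \<longlonglongrightarrow> y"
  proof (rule LIM_zero_cancel, rule Lim_null_comparison)
    show "\<forall>\<^sub>F n in sequentially. norm (\<xi> n - y) \<le> 8 * \<eta> n * xs" using \<xi>(2) by simp
    show "(\<lambda>n. 8 * \<eta> n * xs) \<longlonglongrightarrow> 0" by (auto intro!: tendsto_eq_intros \<eta>_lim)
  qed
  then have exp_lim: "(\<lambda>n. exp (- u (\<xi> n))) \<longlonglongrightarrow> exp (- u y)"
    by (rule continuous_on_tendsto_compose[OF exp_cont _ y]) (simp only: \<xi>(1) eventually_True)
  define K where "K = 80 * M * xs\<^sup>2 + W xs"
  define E where "E n = 17 * M * xs * \<eta> n + 8 * xs * \<bar>exp (- u (\<xi> n)) - exp (- u y)\<bar> + M / q * K * \<eta> n" for n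
  have E_lim: "E \<longlonglongrightarrow> 0"
  proof -
    have "(\<lambda>n. 17 * M * xs * \<eta> n + 8 * xs * \<bar>exp (- u (\<xi> n)) - exp (- u y)\<bar> + M / q * K * \<eta> n)
        \<longlonglongrightarrow> 17 * M * xs * 0 + 8 * xs * 0 + M / q * K * 0"
      by (intro tendsto_add tendsto_mult tendsto_const \<eta>_lim tendsto_rabs_zero LIM_zero exp_lim)
    then show ?thesis by (simp add: E_def[abs_def])
  qed
  have K0: "0 \<le> K" using M_ge_1 W_nonneg[of xs] xs_pos by (simp add: K_def)
  have front: "\<forall>\<^sub>F n in sequentially.
    \<bar>exp (- u y) * (Y' n t - y) + of_bool (t < \<tau>) * exp (- u y) * dW' n y / q\<bar> \<le> M / q * K * (\<eta> n)\<^sup>2"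
  proof (cases "t < \<tau>")
    case True
    have "\<forall>\<^sub>F n in sequentially. t < filling_time xs muf phi pI p0 (\<lambda>x. u x + h n x)"
      by (rule order_tendstoD(1)[OF filling_time_tendsto True])
    then show ?thesis
    proof eventually_elim
      case (elim n)
      have "\<bar>q * (Y' n t - y) + dW' n y\<bar> \<le> K * (\<eta> n)\<^sup>2"
        using perturbation.front_linearisation[OF P t(1) True elim] by (simp add: K_def q_def y_def)
      then have "exp (- u y) / q * \<bar>q * (Y' n t - y) + dW' n y\<bar> \<le> M / q * (K * (\<eta> n)\<^sup>2)"
        using exp_upper[OF y] q M_ge_1 by (intro mult_mono divide_right_mono) auto
      moreover have "exp (- u y) / q * \<bar>q * (Y' n t - y) + dW' n y\<bar> = \<bar>exp (- u y) / q * (q * (Y' n t - y) + dW' n y)\<bar>"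
        using q by (simp add: abs_mult)
      moreover have "exp (- u y) / q * (q * (Y' n t - y) + dW' n y)
          = exp (- u y) * (Y' n t - y) + of_bool (t < \<tau>) * exp (- u y) * dW' n y / q"
        using True q by (simp add: field_simps)
      ultimately show ?case by (simp only: mult.assoc)
    qed
  next
    case False
    then have gt: "\<tau> < t" using t by simp
    have "\<forall>\<^sub>F n in sequentially. filling_time xs muf phi pI p0 (\<lambda>x. u x + h n x) < t"
      by (rule order_tendstoD(2)[OF filling_time_tendsto gt])
    then show ?thesis
    proof eventually_elim
      case (elim n)
      then have "Y' n t = y" using gt by (simp add: y_def front_def)
      then show ?case using False q K0 M_ge_1 by simp
    qed
  qed
  show ?thesis
  proof (rule Lim_null_comparison[OF _ E_lim])
    show "\<forall>\<^sub>F n in sequentially. norm ((F' n (Y' n t) - F (Y t) - dflux' n t) / \<eta> n) \<le> E n"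
      using front
    proof eventually_elim
      case (elim n)
      have "F' n (Y' n t) - F (Y t) - dflux' n t
        = (F' n (Y' n t) - q - dF' n y - exp (- u y) * (Y' n t - y))
          + (exp (- u y) * (Y' n t - y) + of_bool (t < \<tau>) * exp (- u y) * dW' n y / q)"
        by (simp add: perturbation.dflux_def[OF P] y_def q_def)
      then have "\<bar>F' n (Y' n t) - F (Y t) - dflux' n t\<bar> \<le> E n * \<eta> n"
        using elim \<xi>(3)[of n] by (simp add: E_def algebra_simps power2_eq_square)
      then show ?case using \<eta>_seq_pos[of n] by (simp add: abs_divide pos_divide_le_eq)
    qed
  qed
qed

text \<open>Off the front the ratio \<open>F x / F (Y t)\<close> differs from \<open>1\<close>, so the truncation is inactive or
active for all small perturbations alike, and only the quotient rule remains.\<close>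

lemma normalized_pressure_asymptotics:
  assumes t: "0 < t" "t \<noteq> \<tau>" and x: "x \<in> {0..xs}" "x \<noteq> Y t"
  shows "(\<lambda>n. (N' n x t - N x t - dN' n x t) / \<eta> n) \<longlonglongrightarrow> 0"
proof -
  define q where "q = F (Y t)"
  define q' where "q' n = F' n (Y' n t)" for n
  have q: "0 < q" using F_front_pos t by (simp add: q_def)
  have q': "0 < q' n" for n
    unfolding q'_def by (rule injection.F_front_pos[OF perturbation.perturbed_injection[OF P] t(1)])
  have q'_lim: "q' \<longlonglongrightarrow> q" unfolding q_def q'_def by (rule front_flux_tendsto[OF t(1)])
  have F_lim: "(\<lambda>n. F' n x) \<longlonglongrightarrow> F x"
  proof (rule LIM_zero_cancel, rule Lim_null_comparison)
    show "\<forall>\<^sub>F n in sequentially. norm (F' n x - F x) \<le> 2 * \<eta> n * F x"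
      using perturbation.F_perturbation(2)[OF P x(1)] by simp
    show "(\<lambda>n. 2 * \<eta> n * F x) \<longlonglongrightarrow> 0" by (auto intro!: tendsto_eq_intros \<eta>_lim)
  qed
  have ratio_lim: "(\<lambda>n. F' n x / q' n) \<longlonglongrightarrow> F x / q"
    using q by (intro tendsto_divide F_lim q'_lim) simp
  show ?thesis
  proof (cases "x < Y t")
    case False
    then have "F (Y t) < F x" using x front_in[OF t(1)] by (intro F_less) auto
    then have gt: "1 < F x / q" using q by (simp add: q_def)
    have "\<forall>\<^sub>F n in sequentially. 1 < F' n x / q' n" by (rule order_tendstoD(1)[OF ratio_lim gt])
    then have "\<forall>\<^sub>F n in sequentially. (N' n x t - N x t - dN' n x t) / \<eta> n = 0"
    proof eventually_elim
      case (elim n)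
      then show ?case using gt False
        by (simp add: normalized_pressure_def perturbation.dN_def[OF P] q_def q'_def)
    qed
    then show ?thesis by (rule tendsto_eventually)
  next
    case True
    then have "F x < F (Y t)" using x front_in[OF t(1)] by (intro F_less) auto
    then have lt: "F x / q < 1" using q by (simp add: q_def)
    have ev: "\<forall>\<^sub>F n in sequentially. F' n x / q' n < 1" by (rule order_tendstoD(2)[OF ratio_lim lt])
    define \<alpha> where "\<alpha> n = (F' n x - F x - dF' n x) / \<eta> n" for n
    define \<beta> where "\<beta> n = (q' n - q - dflux' n t) / \<eta> n" for n
    define \<gamma> where "\<gamma> n = (q * dF' n x - F x * dflux' n t) / \<eta> n" for n
    have \<alpha>: "\<alpha> \<longlonglongrightarrow> 0"
    proof (rule Lim_null_comparison)
      show "\<forall>\<^sub>F n in sequentially. norm (\<alpha> n) \<le> \<eta> n * F x"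
      proof (rule always_eventually, rule allI)
        fix n show "norm (\<alpha> n) \<le> \<eta> n * F x"
          using perturbation.F_perturbation(1)[OF P x(1), of n] \<eta>_seq_pos[of n]
          by (simp add: \<alpha>_def abs_divide pos_divide_le_eq power2_eq_square mult_ac)
      qed
      show "(\<lambda>n. \<eta> n * F x) \<longlonglongrightarrow> 0" by (auto intro!: tendsto_eq_intros \<eta>_lim)
    qed
    have \<beta>: "\<beta> \<longlonglongrightarrow> 0" unfolding \<beta>_def q_def q'_def by (rule flux_asymptotics[OF t])
    have \<gamma>: "\<bar>\<gamma> n\<bar> \<le> q * F x + F x * (2 * M\<^sup>2 * q)" for n
    proof -
      have "\<bar>q * dF' n x\<bar> \<le> q * (\<eta> n * F x)"
        unfolding abs_mult using q perturbation.F_perturbation(3)[OF P x(1), of n] by (simp add: mult_left_mono)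
      moreover have "\<bar>F x * dflux' n t\<bar> \<le> F x * (2 * M\<^sup>2 * \<eta> n * q)"
        unfolding abs_mult using F_nonneg[OF x(1)] perturbation.dflux_le[OF P t(1), of n]
        by (simp add: mult_left_mono q_def)
      ultimately have "\<bar>q * dF' n x - F x * dflux' n t\<bar> \<le> (q * F x + F x * (2 * M\<^sup>2 * q)) * \<eta> n"
        by (simp add: algebra_simps)
      then show ?thesis using \<eta>_seq_pos[of n] by (simp add: \<gamma>_def abs_divide pos_divide_le_eq)
    qed
    have inv_lim: "(\<lambda>n. 1 / (q' n * q) - 1 / q\<^sup>2) \<longlonglongrightarrow> 0"
      using q by (auto intro!: tendsto_eq_intros q'_lim simp: power2_eq_square)
    have "(\<lambda>n. (q * \<alpha> n - F x * \<beta> n) / (q' n * q) + (1 / (q' n * q) - 1 / q\<^sup>2) * \<gamma> n) \<longlonglongrightarrow> (q * 0 - F x * 0) / (q * q) + 0"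
    proof (intro tendsto_add tendsto_divide tendsto_diff tendsto_mult tendsto_const \<alpha> \<beta> q'_lim)
      show "(\<lambda>n. (1 / (q' n * q) - 1 / q\<^sup>2) * \<gamma> n) \<longlonglongrightarrow> 0"
        by (rule lim_null_mult_right_bounded[OF inv_lim always_eventually]) (use \<gamma> in auto)
    qed (use q in simp)
    then have lim: "(\<lambda>n. - ((q * \<alpha> n - F x * \<beta> n) / (q' n * q) + (1 / (q' n * q) - 1 / q\<^sup>2) * \<gamma> n)) \<longlonglongrightarrow> 0"
      using tendsto_minus by fastforce
    have "\<forall>\<^sub>F n in sequentially. (N' n x t - N x t - dN' n x t) / \<eta> n
      = - ((q * \<alpha> n - F x * \<beta> n) / (q' n * q) + (1 / (q' n * q) - 1 / q\<^sup>2) * \<gamma> n)"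
      using ev
    proof eventually_elim
      case (elim n)
      have "N' n x t - N x t - dN' n x t
         = - (F' n x / q' n - F x / q - (dF' n x / q - F x / q\<^sup>2 * dflux' n t))"
        using elim lt True
        by (simp add: normalized_pressure_def perturbation.dN_def[OF P] q_def q'_def)
      moreover have "(q * \<alpha> n - F x * \<beta> n) / (q' n * q) + (1 / (q' n * q) - 1 / q\<^sup>2) * \<gamma> n
         = (F' n x / q' n - F x / q - (dF' n x / q - F x / q\<^sup>2 * dflux' n t)) / \<eta> n"
        using q q'[of n] \<eta>_seq_pos[of n] unfolding \<alpha>_def \<beta>_def \<gamma>_def
        by (simp add: field_simps power2_eq_square)
      ultimately show ?case by (simp only: minus_divide_left)
    qed
    then show ?thesis using lim by (simp add: tendsto_cong)
  qed
qed

end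

end

section \<open>Measurability of the front and of the pressure\<close>

abbreviation lborel_on :: "real set \<Rightarrow> real measure" where
  "lborel_on A \<equiv> restrict_space lborel A"

lemma measurable_lborel_on_iff: "f \<in> borel_measurable (lborel_on A) \<longleftrightarrow> f \<in> borel_measurable (restrict_space borel A)"
  by (rule arg_cong[of _ _ "\<lambda>S. f \<in> S"], rule measurable_cong_sets) (simp_all add: sets_restrict_space)

lemma ident_measurable_lborel_on [measurable]: "(\<lambda>x. x) \<in> borel_measurable (lborel_on A)"
  unfolding measurable_lborel_on_iff by (rule measurable_restrict_space1) simp

lemma finite_measure_lborel_on_Ioo: "finite_measure (lborel_on {a<..<b})"
  using emeasure_bounded_finite[of "{a<..<b}"]
  by (intro finite_measureI) (simp add: emeasure_restrict_space space_restrict_space)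

lemma finite_measure_lborel_on_Ioc: "finite_measure (lborel_on {a<..b})"
  using emeasure_bounded_finite[of "{a<..b}"]
  by (intro finite_measureI) (simp add: emeasure_restrict_space space_restrict_space)

lemma AE_lborel_on_neq: "AE x in lborel_on A. x \<noteq> c" if "A \<in> sets borel"
proof -
  have "AE x in lborel. x \<noteq> c" by (rule AE_lborel_singleton)
  then show ?thesis using that by (subst AE_restrict_space_iff) auto
qed

text \<open>Sections of a Lebesgue measurable function need not be measurable, and exceptional null sets occur; passing to a Borel
function that agrees almost everywhere makes Fubini's theorem for the Borel product measure available.\<close>

lemma LINT_lebesgue_eq_lborel:
  fixes G g :: "real \<Rightarrow> real"
  assumes G: "G \<in> borel_measurable borel" and AE: "AE x in lborel. indicator A x * g x = G x"
  shows "(LINT x:A|lebesgue. g x) = integral\<^sup>L lborel G"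
proof -
  have G': "G \<in> borel_measurable lebesgue" using G by (intro measurable_completion) simp
  have AE': "AE x in lebesgue. G x = indicator A x * g x"
    using AE_completion[OF AE] by (auto elim: eventually_mono)
  have "(LINT x:A|lebesgue. g x) = (LINT x|lebesgue. indicator A x * g x)"
    by (simp add: set_lebesgue_integral_def)
  also have "\<dots> = integral\<^sup>L lebesgue G"
    by (rule integral_cong_AE[OF borel_measurable_AE[OF G' AE'] G']) (use AE' in \<open>auto elim: eventually_mono\<close>)
  also have "\<dots> = integral\<^sup>L lborel G" using G by (intro integral_completion) simp
  finally show ?thesis .
qed

lemma LINT_lebesgue_eq_lborel_on:
  fixes f g :: "real \<Rightarrow> real"
  assumes B: "B \<in> sets borel" and f: "f \<in> borel_measurable (lborel_on B)"
    and AE: "AE x in lborel. indicator A x * g x = indicator B x * f x"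
  shows "(LINT x:A|lebesgue. g x) = integral\<^sup>L (lborel_on B) f"
proof -
  have "(\<lambda>x. indicator B x *\<^sub>R f x) \<in> borel_measurable borel"
    using f B unfolding measurable_lborel_on_iff by (subst borel_measurable_restrict_space_iff[symmetric]) auto
  then have "(LINT x:A|lebesgue. g x) = integral\<^sup>L lborel (\<lambda>x. indicator B x *\<^sub>R f x)"
    by (intro LINT_lebesgue_eq_lborel) (use AE in auto)
  also have "\<dots> = integral\<^sup>L (lborel_on B) f"
    using B by (subst integral_restrict_space) auto
  finally show ?thesis .
qed

lemma lebesgue_on_measurable:
  fixes f :: "real \<Rightarrow> real"
  assumes B: "B \<in> sets borel" and f: "f \<in> borel_measurable (lborel_on B)"
  shows "f \<in> borel_measurable (lebesgue_on B)"
proof -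
  have "(\<lambda>x. indicator B x *\<^sub>R f x) \<in> borel_measurable borel"
    using f B unfolding measurable_lborel_on_iff by (subst borel_measurable_restrict_space_iff[symmetric]) auto
  then have "(\<lambda>x. indicator B x *\<^sub>R f x) \<in> borel_measurable lebesgue"
    by (intro measurable_completion) simp
  then show ?thesis using B by (subst borel_measurable_restrict_space_iff) auto
qed

lemma integral_lebesgue_on_eq_lborel_on:
  fixes f :: "real \<Rightarrow> real"
  assumes B: "B \<in> sets borel" and f: "f \<in> borel_measurable (lborel_on B)"
  shows "integral\<^sup>L (lebesgue_on B) f = integral\<^sup>L (lborel_on B) f"
proof -
  have "integral\<^sup>L (lebesgue_on B) f = (LINT x:B|lebesgue. f x)"
    using B by (subst integral_restrict_space) (auto simp: set_lebesgue_integral_def)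
  also have "\<dots> = integral\<^sup>L (lborel_on B) f"
    by (rule LINT_lebesgue_eq_lborel_on[OF B f]) simp
  finally show ?thesis .
qed

lemma continuous_measurable_lborel_on:
  fixes g :: "real \<Rightarrow> real"
  assumes "continuous_on {0..xs} g" "A \<subseteq> {0..xs}"
  shows "g \<in> borel_measurable (lborel_on A)"
  unfolding measurable_lborel_on_iff
  by (rule borel_measurable_continuous_on_restrict[OF continuous_on_subset[OF assms]])

text \<open>The kernel of the linearised pressure contains both the strict and the weak inequality; they differ on a null set.\<close>

lemma integral_lborel_on_Ioo_below:
  fixes g :: "real \<Rightarrow> real"
  assumes g: "continuous_on {0..xs} g" and b: "0 \<le> b" "b \<le> xs"
  shows "(LINT z|lborel_on {0<..<xs}. of_bool (z < b) * g z) = integral {0..b} g"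
    and "(LINT z|lborel_on {0<..<xs}. of_bool (z \<le> b) * g z) = integral {0..b} g"
proof -
  have [measurable]: "g \<in> borel_measurable (lborel_on {0<..<xs})"
    by (rule continuous_measurable_lborel_on[OF g]) auto
  have "(LINT z|lborel_on {0<..<xs}. of_bool (z \<le> b) * g z) = (LINT z|lborel_on {0<..<xs}. indicator {0..b} z * g z)"
    by (rule Bochner_Integration.integral_cong) (auto simp: space_restrict_space)
  also have "\<dots> = (LINT z|lebesgue_on {0<..<xs}. indicator {0..b} z * g z)"
    by (rule integral_lebesgue_on_eq_lborel_on[symmetric]) auto
  also have "\<dots> = integral {0..b} g"
    using b by (intro integral_indicator_times_continuous[OF g]) auto
  finally show le: "(LINT z|lborel_on {0<..<xs}. of_bool (z \<le> b) * g z) = integral {0..b} g" .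
  have "(LINT z|lborel_on {0<..<xs}. of_bool (z < b) * g z) = (LINT z|lborel_on {0<..<xs}. of_bool (z \<le> b) * g z)"
  proof (rule integral_cong_AE)
    show "AE z in lborel_on {0<..<xs}. of_bool (z < b) * g z = of_bool (z \<le> b) * g z"
      using AE_lborel_on_neq[of "{0<..<xs}" b, simplified] by (rule eventually_mono) auto
  qed measurable
  then show "(LINT z|lborel_on {0<..<xs}. of_bool (z < b) * g z) = integral {0..b} g" using le by simp
qed

text \<open>\<open>H0\<close> is the given essentially bounded weight, \<open>H\<close> a bounded Borel function that agrees with
it almost everywhere. The exceptional set is taken section by section, as the iterated integrals require.\<close>

locale observation = injection +
  fixes T C :: real and H0 H :: "real \<times> real \<Rightarrow> real"
  assumes T_pos: "0 < T" and H_borel [measurable]: "H \<in> borel_measurable (borel \<Otimes>\<^sub>M borel)"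
    and H_le: "\<bar>H z\<bar> \<le> C"
    and H0_AE: "AE t in lborel. AE x in lborel. 0 < x \<and> x < xs \<and> 0 < t \<and> t \<le> T \<longrightarrow> H0 (x, t) = H (x, t)"
begin

abbreviation "MX \<equiv> lborel_on {0<..<xs}"
abbreviation "MT \<equiv> lborel_on {0<..T}"

sublocale MX: finite_measure MX by (rule finite_measure_lborel_on_Ioo)
sublocale MT: finite_measure MT by (rule finite_measure_lborel_on_Ioc)
sublocale XX: pair_sigma_finite MX MX ..
sublocale TX: pair_sigma_finite MT MX ..

lemma C_nonneg: "0 \<le> C"
  using H_le[of undefined] by linarith

lemma F_measurable [measurable]: "F \<in> borel_measurable MX"
  by (rule continuous_measurable_lborel_on[OF F_cont]) auto

lemma exp_measurable [measurable]: "(\<lambda>z. exp (- u z)) \<in> borel_measurable MX"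
  by (rule continuous_measurable_lborel_on[OF exp_cont]) auto

text \<open>Monotonicity in time gives measurability without any regularity theory for the inverse of \<open>W\<close>.\<close>

lemma front_measurable [measurable]: "Y \<in> borel_measurable MT"
  unfolding measurable_lborel_on_iff
  by (rule borel_measurable_mono_on_fnc) (auto intro!: mono_onI front_mono)

lemma flux_measurable [measurable]: "(\<lambda>t. F (Y t)) \<in> borel_measurable MT"
  unfolding measurable_lborel_on_iff
proof (rule borel_measurable_mono_on_fnc, rule mono_onI)
  fix s t assume "s \<in> {0<..T}" "t \<in> {0<..T}" "s \<le> t"
  then show "F (Y s) \<le> F (Y t)"
    using front_range[of s] front_range[of t] front_mono[of s t] by (intro F_mono) auto
qed

lemma exp_front_measurable [measurable]: "(\<lambda>t. exp (- u (Y t))) \<in> borel_measurable MT"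
proof -
  have "Y \<in> MT \<rightarrow>\<^sub>M restrict_space borel {0..xs}"
    using front_in by (intro measurable_restrict_space2 front_measurable) (auto simp: space_restrict_space)
  moreover have "(\<lambda>z. exp (- u z)) \<in> borel_measurable (restrict_space borel {0..xs})"
    by (rule borel_measurable_continuous_on_restrict[OF exp_cont])
  ultimately show ?thesis by (rule measurable_compose)
qed

text \<open>The kernel for which the linearised pressure at \<open>(x, t)\<close> is the integral of \<open>kern t x z * exp (- u
z) * h z\<close> over \<open>z\<close>; its three terms come from \<open>dF x\<close>, \<open>dF (Y t)\<close> and the
motion of the front.\<close>

definition kern :: "real \<Rightarrow> real \<Rightarrow> real \<Rightarrow> real" where
  "kern t x z = of_bool (x < Y t) * of_bool (z < Y t) *
     (of_bool (z \<le> x) / F (Y t) - F x / (F (Y t))\<^sup>2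
      + of_bool (t < \<tau>) * ((Y t - z) / (F (Y t)) ^ 3) * exp (- u (Y t)) * F x)"

lemma normalized_pressure_measurable [measurable]:
  "(\<lambda>p. N (snd p) (fst p)) \<in> borel_measurable (MT \<Otimes>\<^sub>M MX)"
  unfolding normalized_pressure_def by measurable

lemma H_measurable [measurable]: 
  "(\<lambda>p. H (snd p, fst p)) \<in> borel_measurable (MT \<Otimes>\<^sub>M MX)"
  "(\<lambda>x. H (x, t)) \<in> borel_measurable MX"
  by measurable

end

section \<open>The representer as an iterated integral\<close>

context observation begin

lemma MX_integrable:
  fixes f :: "real \<Rightarrow> real"
  assumes "f \<in> borel_measurable MX" "\<And>x. 0 < x \<Longrightarrow> x < xs \<Longrightarrow> \<bar>f x\<bar> \<le> B"
  shows "integrable MX f"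
  by (rule MX.integrable_const_bound[OF _ assms(1), of B]) (use assms(2) in \<open>auto intro!: AE_I2 simp: space_restrict_space\<close>)

lemma MT_integrable:
  fixes f :: "real \<Rightarrow> real"
  assumes "f \<in> borel_measurable MT" "\<And>t. 0 < t \<Longrightarrow> t \<le> T \<Longrightarrow> \<bar>f t\<bar> \<le> B"
  shows "integrable MT f"
  by (rule MT.integrable_const_bound[OF _ assms(1), of B]) (use assms(2) in \<open>auto intro!: AE_I2 simp: space_restrict_space\<close>)

lemma MX_integral_le:
  fixes f g :: "real \<Rightarrow> real"
  assumes f: "f \<in> borel_measurable MX" and g: "integrable MX g" and le: "\<And>x. 0 < x \<Longrightarrow> x < xs \<Longrightarrow> \<bar>f x\<bar> \<le> g x"
  shows "\<bar>LINT x|MX. f x\<bar> \<le> (LINT x|MX. g x)"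
proof -
  have "integrable MX f"
    by (rule Bochner_Integration.integrable_bound[OF g f])
       (use le in \<open>auto intro!: AE_I2 simp: space_restrict_space intro: order_trans[OF _ abs_ge_self]\<close>)
  then have "norm (LINT x|MX. f x) \<le> (LINT x|MX. norm (f x))" by (intro integral_norm_bound)
  also have "\<dots> \<le> (LINT x|MX. g x)"
    using le by (intro integral_mono integrable_norm \<open>integrable MX f\<close> g) (auto simp: space_restrict_space)
  finally show ?thesis by simp
qed

lemma observation_eq:
  "(LINT t:{0<..T}|lebesgue. LINT x:{0<..<xs}|lebesgue. H0 (x, t) * pressure xs muf phi pI p0 u x t)
   = (LINT t|MT. LINT x|MX. H (x, t) * (p0 + (pI - p0) * N x t))"
proof (rule LINT_lebesgue_eq_lborel_on)
  show "(\<lambda>t. LINT x|MX. H (x, t) * (p0 + (pI - p0) * N x t)) \<in> borel_measurable MT"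
    unfolding normalized_pressure_def by measurable
  show "AE t in lborel. indicator {0<..T} t * (LINT x:{0<..<xs}|lebesgue. H0 (x, t) * pressure xs muf phi pI p0 u x t)
      = indicator {0<..T} t * (LINT x|MX. H (x, t) * (p0 + (pI - p0) * N x t))"
    using H0_AE
  proof (rule eventually_mono)
    fix t assume t: "AE x in lborel. 0 < x \<and> x < xs \<and> 0 < t \<and> t \<le> T \<longrightarrow> H0 (x, t) = H (x, t)"
    have "(LINT x:{0<..<xs}|lebesgue. H0 (x, t) * pressure xs muf phi pI p0 u x t)
        = (LINT x|MX. H (x, t) * (p0 + (pI - p0) * N x t))" if "0 < t" "t \<le> T"
    proof (rule LINT_lebesgue_eq_lborel_on)
      show "(\<lambda>x. H (x, t) * (p0 + (pI - p0) * N x t)) \<in> borel_measurable MX"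
        unfolding normalized_pressure_def by measurable
      show "AE x in lborel. indicator {0<..<xs} x * (H0 (x, t) * pressure xs muf phi pI p0 u x t)
         = indicator {0<..<xs} x * (H (x, t) * (p0 + (pI - p0) * N x t))"
        using t by (rule eventually_mono) (use that pressure_eq_normalized in \<open>auto simp: indicator_def\<close>)
    qed simp
    then show "indicator {0<..T} t * (LINT x:{0<..<xs}|lebesgue. H0 (x, t) * pressure xs muf phi pI p0 u x t)
      = indicator {0<..T} t * (LINT x|MX. H (x, t) * (p0 + (pI - p0) * N x t))"
      by (simp add: indicator_def)
  qed
qed simp

text \<open>Each term of the kernel is of order \<open>1 / F (Y t)\<close> by \<open>F x \<le> F (Y t)\<close> and \<open>Y t
\<le> M * F (Y t)\<close>.\<close>

lemma abs_kern_le: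
  assumes t: "0 < t" and x: "0 < x" "x < xs" and z: "0 < z"
  shows "\<bar>kern t x z\<bar> \<le> of_bool (x < Y t) * (3 * M\<^sup>2 / F (Y t))"
proof (cases "x < Y t \<and> z < Y t")
  case True
  define q where "q = F (Y t)"
  have Y: "Y t \<in> {0..xs}" using front_in t by auto
  have q: "0 < q" using F_front_pos[OF t] by (simp add: q_def)
  have M2: "1 \<le> M\<^sup>2" using M_ge_1 by (simp add: one_le_power)
  have Fx: "0 \<le> F x" "F x \<le> q" unfolding q_def using True x Y F_nonneg[of x] F_mono[of x "Y t"] by auto
  have Yq: "Y t \<le> M * q" using F_bounds(1)[OF Y] M_ge_1 by (simp add: q_def field_simps)
  have 1: "\<bar>of_bool (z \<le> x) / q\<bar> \<le> 1 / q" using q by simp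
  have "F x / q\<^sup>2 \<le> q / q\<^sup>2" using Fx by (intro divide_right_mono) auto
  then have 2: "\<bar>F x / q\<^sup>2\<bar> \<le> 1 / q" using q Fx by (simp add: power2_eq_square)
  have "((Y t - z) / q ^ 3) * exp (- u (Y t)) * F x \<le> ((M * q) / q ^ 3) * M * q"
    using Yq z q Fx exp_upper[OF Y] M_ge_1 True
    by (intro mult_mono divide_right_mono) auto
  also have "\<dots> = M\<^sup>2 / q" using q by (simp add: power2_eq_square power3_eq_cube)
  finally have 3: "\<bar>of_bool (t < \<tau>) * ((Y t - z) / q ^ 3) * exp (- u (Y t)) * F x\<bar> \<le> M\<^sup>2 / q"
    using True q Fx by (simp add: abs_mult)
  have "1 / q \<le> M\<^sup>2 / q" using M2 q by (intro divide_right_mono) auto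
  then have "\<bar>of_bool (z \<le> x) / q - F x / q\<^sup>2 + of_bool (t < \<tau>) * ((Y t - z) / q ^ 3) * exp (- u (Y t)) * F x\<bar>
     \<le> 3 * (M\<^sup>2 / q)" using 1 2 3 by linarith
  then show ?thesis using True by (simp add: kern_def q_def)
next
  case False
  then have "kern t x z = 0" by (auto simp: kern_def)
  then show ?thesis using F_front_pos[OF t] by simp
qed

lemma integral_below_front:
  assumes t: "0 < t" shows "(LINT x|MX. of_bool (x < Y t)) = Y t"
  using integral_lborel_on_Ioo_below(1)[of xs "\<lambda>_. 1" "Y t"] front_range[OF t] by simp

text \<open>The contribution of time \<open>t\<close> to the representer at \<open>z\<close>, up to the factor \<open>(pI - p0) *
exp (- u z)\<close>.\<close>

definition response :: "real \<Rightarrow> real \<Rightarrow> real" where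
  "response t z = (LINT x|MX. H (x, t) * kern t x z)"

text \<open>The kernel blows up like \<open>1 / F (Y t)\<close> as \<open>t\<close> tends to \<open>0\<close>, but its support has
length \<open>Y t \<le> M * F (Y t)\<close>, so that integration over \<open>x\<close> removes the singularity.\<close>

lemma abs_response_le:
  assumes t: "0 < t" and z: "0 < z" "z < xs"
  shows "\<bar>response t z\<bar> \<le> 3 * C * M ^ 3"
proof -
  have q: "0 < F (Y t)" by (rule F_front_pos[OF t])
  have "\<bar>response t z\<bar> \<le> (LINT x|MX. C * (3 * M\<^sup>2 / F (Y t)) * of_bool (x < Y t))"
    unfolding response_def
  proof (rule MX_integral_le)
    show "(\<lambda>x. H (x, t) * kern t x z) \<in> borel_measurable MX"
      unfolding kern_def by measurable
    show "integrable MX (\<lambda>x. C * (3 * M\<^sup>2 / F (Y t)) * of_bool (x < Y t))"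
      by (rule MX_integrable[of _ "C * (3 * M\<^sup>2 / F (Y t))"]) (use q C_nonneg in \<open>auto simp: abs_mult\<close>)
    fix x assume x: "0 < x" "x < xs"
    have "\<bar>H (x, t) * kern t x z\<bar> \<le> C * (of_bool (x < Y t) * (3 * M\<^sup>2 / F (Y t)))"
      unfolding abs_mult using H_le abs_kern_le[OF t x z(1)] C_nonneg by (intro mult_mono) auto
    then show "\<bar>H (x, t) * kern t x z\<bar> \<le> C * (3 * M\<^sup>2 / F (Y t)) * of_bool (x < Y t)" by (simp only: mult_ac)
  qed
  also have "\<dots> = C * (3 * M\<^sup>2 / F (Y t)) * Y t" by (simp add: integral_below_front[OF t])
  also have "\<dots> \<le> C * (3 * M\<^sup>2 / F (Y t)) * (M * F (Y t))"
  proof (rule mult_left_mono)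
    show "Y t \<le> M * F (Y t)" using F_bounds(1)[OF front_in[OF t]] M_ge_1 by (simp add: field_simps)
  qed (use q C_nonneg in simp)
  also have "\<dots> = 3 * C * M ^ 3" using q by (simp add: power2_eq_square power3_eq_cube)
  finally show ?thesis .
qed

lemma response_measurable [measurable]:
  "(\<lambda>p. response (fst p) (snd p)) \<in> borel_measurable (MT \<Otimes>\<^sub>M MX)"
  unfolding response_def kern_def by measurable

text \<open>The left-hand side is the bracket in the integrand of the representer.\<close>

lemma bracket_eq_response:
  assumes t: "0 < t" and z: "0 < z" "z < xs"
    and AE: "AE x in lborel. 0 < x \<and> x < xs \<longrightarrow> H0 (x, t) = H (x, t)"
  shows "of_bool (z < Y t) *
     (1 / F (Y t) * (LINT x:{z..Y t}|lebesgue. H0 (x, t))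
      - 1 / (F (Y t))\<^sup>2 * (LINT x:{0..Y t}|lebesgue. H0 (x, t) * F x)
      + of_bool (t < \<tau>) * ((Y t - z) / (F (Y t)) ^ 3) * exp (- u (Y t)) *
        (LINT x:{0..Y t}|lebesgue. H0 (x, t) * F x)) = response t z"
proof (cases "z < Y t")
  case True
  have Y: "0 < Y t" "Y t \<le> xs" by (rule front_range[OF t])+
  have ne: "AE x in lborel. x \<noteq> 0 \<and> x \<noteq> Y t"
    using AE_lborel_singleton[of "0::real"] AE_lborel_singleton[of "Y t"] by (rule eventually_conj)
  define f1 where "f1 x = of_bool (x < Y t) * of_bool (z \<le> x) * H (x, t)" for x
  define f2 where "f2 x = of_bool (x < Y t) * (H (x, t) * F x)" for x
  have [measurable]: "f1 \<in> borel_measurable MX" "f2 \<in> borel_measurable MX"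
    unfolding f1_def f2_def by measurable
  have i1: "(LINT x:{z..Y t}|lebesgue. H0 (x, t)) = (LINT x|MX. f1 x)"
  proof (rule LINT_lebesgue_eq_lborel_on)
    show "AE x in lborel. indicator {z..Y t} x * H0 (x, t) = indicator {0<..<xs} x * f1 x"
      using AE ne by eventually_elim (use z Y in \<open>auto simp: indicator_def f1_def\<close>)
  qed auto
  have i2: "(LINT x:{0..Y t}|lebesgue. H0 (x, t) * F x) = (LINT x|MX. f2 x)"
  proof (rule LINT_lebesgue_eq_lborel_on)
    show "AE x in lborel. indicator {0..Y t} x * (H0 (x, t) * F x) = indicator {0<..<xs} x * f2 x"
      using AE ne by eventually_elim (use z Y in \<open>auto simp: indicator_def f2_def\<close>)
  qed auto
  have int1: "integrable MX f1"
    by (rule MX_integrable[of _ C]) (use H_le C_nonneg in \<open>auto simp: f1_def\<close>)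
  have int2: "integrable MX f2"
  proof (rule MX_integrable[of _ "C * (M * xs)"])
    fix x assume "0 < x" "x < xs"
    then have "\<bar>F x\<bar> \<le> M * xs" using F_le[of x] F_nonneg[of x] by auto
    then have "\<bar>H (x, t) * F x\<bar> \<le> C * (M * xs)" unfolding abs_mult using H_le C_nonneg by (intro mult_mono) auto
    then show "\<bar>f2 x\<bar> \<le> C * (M * xs)" using C_nonneg M_ge_1 xs_pos by (simp add: f2_def)
  qed simp
  define a where "a = 1 / F (Y t)"
  define b where "b = - 1 / (F (Y t))\<^sup>2 + of_bool (t < \<tau>) * ((Y t - z) / (F (Y t)) ^ 3) * exp (- u (Y t))"
  have "H (x, t) * kern t x z = a * f1 x + b * f2 x" for x
    using True by (simp add: kern_def f1_def f2_def a_def b_def algebra_simps)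
  then have "response t z = a * (LINT x|MX. f1 x) + b * (LINT x|MX. f2 x)"
    unfolding response_def using int1 int2 by simp
  then show ?thesis unfolding i1 i2 using True by (simp add: a_def b_def algebra_simps)
next
  case False
  then show ?thesis by (simp add: response_def kern_def)
qed

lemma representer_eq:
  assumes z: "0 < z" "z < xs"
  shows "representer xs muf phi pI p0 T H0 u z = (pI - p0) * exp (- u z) * (LINT t|MT. response t z)"
proof -
  have zX: "z \<in> space MX" using z by (simp add: space_restrict_space)
  have "(\<lambda>t. response t z) \<in> borel_measurable MT"
    using measurable_compose[OF measurable_Pair2'[OF zX, of MT] response_measurable] by simp
  then have "(LINT t:{0<..T}|lebesgue.
     of_bool (z < Y t) *
     (1 / F (Y t) * (LINT x:{z..Y t}|lebesgue. H0 (x, t))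
      - 1 / (F (Y t))\<^sup>2 * (LINT x:{0..Y t}|lebesgue. H0 (x, t) * F x)
      + of_bool (t < \<tau>) * ((Y t - z) / (F (Y t)) ^ 3) * exp (- u (Y t)) *
        (LINT x:{0..Y t}|lebesgue. H0 (x, t) * F x))) = (LINT t|MT. response t z)"
  proof (rule LINT_lebesgue_eq_lborel_on[rotated])
    show "AE t in lborel. indicator {0<..T} t * (of_bool (z < Y t) *
     (1 / F (Y t) * (LINT x:{z..Y t}|lebesgue. H0 (x, t))
      - 1 / (F (Y t))\<^sup>2 * (LINT x:{0..Y t}|lebesgue. H0 (x, t) * F x)
      + of_bool (t < \<tau>) * ((Y t - z) / (F (Y t)) ^ 3) * exp (- u (Y t)) *
        (LINT x:{0..Y t}|lebesgue. H0 (x, t) * F x))) = indicator {0<..T} t * response t z"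
      using H0_AE
    proof (rule eventually_mono)
      fix t assume AE: "AE x in lborel. 0 < x \<and> x < xs \<and> 0 < t \<and> t \<le> T \<longrightarrow> H0 (x, t) = H (x, t)"
      show "indicator {0<..T} t * (of_bool (z < Y t) *
     (1 / F (Y t) * (LINT x:{z..Y t}|lebesgue. H0 (x, t))
      - 1 / (F (Y t))\<^sup>2 * (LINT x:{0..Y t}|lebesgue. H0 (x, t) * F x)
      + of_bool (t < \<tau>) * ((Y t - z) / (F (Y t)) ^ 3) * exp (- u (Y t)) *
        (LINT x:{0..Y t}|lebesgue. H0 (x, t) * F x))) = indicator {0<..T} t * response t z"
      proof (cases "0 < t \<and> t \<le> T")
        case True
        then have "AE x in lborel. 0 < x \<and> x < xs \<longrightarrow> H0 (x, t) = H (x, t)" using AE by simp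
        then show ?thesis using bracket_eq_response[OF _ z, of t] True by simp
      next
        case False
        then show ?thesis by (auto simp: indicator_def)
      qed
    qed
  qed simp
  then show ?thesis unfolding representer_def Let_def by simp
qed

definition rep_bound :: real where
  "rep_bound = (pI - p0) * M * (3 * C * M ^ 3 * T)"

lemma representer_measurable [measurable]:
  "representer xs muf phi pI p0 T H0 u \<in> borel_measurable MX"
proof -
  have "(\<lambda>z. (pI - p0) * exp (- u z) * (LINT t|MT. response t z)) \<in> borel_measurable MX"
  proof (intro borel_measurable_times borel_measurable_const exp_measurable MT.borel_measurable_lebesgue_integral)
    have "(\<lambda>p. response (snd p) (fst p)) \<in> borel_measurable (MX \<Otimes>\<^sub>M MT)"
      using measurable_compose[OF measurable_Pair[OF measurable_snd measurable_fst] response_measurable] by simp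
    then show "case_prod (\<lambda>z t. response t z) \<in> borel_measurable (MX \<Otimes>\<^sub>M MT)" by (simp add: split_beta')
  qed
  then show ?thesis
    by (subst measurable_cong[OF representer_eq]) (auto simp: space_restrict_space)
qed

lemma representer_bound:
  assumes z: "0 < z" "z < xs"
  shows "\<bar>representer xs muf phi pI p0 T H0 u z\<bar> \<le> rep_bound"
proof -
  have zX: "z \<in> space MX" using z by (simp add: space_restrict_space)
  have m: "(\<lambda>t. response t z) \<in> borel_measurable MT"
    using measurable_compose[OF measurable_Pair2'[OF zX, of MT] response_measurable] by simp
  have i: "integrable MT (\<lambda>t. response t z)"
    by (rule MT_integrable[OF m]) (rule abs_response_le[OF _ z])
  have "\<bar>LINT t|MT. response t z\<bar> \<le> (LINT t|MT. \<bar>response t z\<bar>)"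
    by (rule integral_abs_bound)
  also have "\<dots> \<le> (LINT t|MT. 3 * C * M ^ 3)"
    using abs_response_le[OF _ z] i by (intro integral_mono integrable_abs) (auto simp: space_restrict_space)
  also have "\<dots> = 3 * C * M ^ 3 * T"
    using T_pos by (simp add: measure_restrict_space space_restrict_space)
  finally have "\<bar>LINT t|MT. response t z\<bar> \<le> 3 * C * M ^ 3 * T" .
  moreover have "\<bar>(pI - p0) * exp (- u z)\<bar> \<le> (pI - p0) * M"
    unfolding abs_mult using pressures exp_upper[of z] z by (intro mult_mono) auto
  ultimately have "\<bar>(pI - p0) * exp (- u z)\<bar> * \<bar>LINT t|MT. response t z\<bar> \<le> rep_bound"
    unfolding rep_bound_def using pressures M_ge_1 by (intro mult_mono) auto
  then show ?thesis unfolding representer_eq[OF z] abs_mult .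
qed

lemma representer_L2: "representer xs muf phi pI p0 T H0 u \<in> L2 {0<..<xs}"
proof -
  interpret L: finite_measure "lebesgue_on {0<..<xs}" by (rule finite_measure_lebesgue_on) auto
  have m: "representer xs muf phi pI p0 T H0 u \<in> borel_measurable (lebesgue_on {0<..<xs})"
    by (rule lebesgue_on_measurable) auto
  have "integrable (lebesgue_on {0<..<xs}) (\<lambda>z. (representer xs muf phi pI p0 T H0 u z)\<^sup>2)"
  proof (rule L.integrable_const_bound[of _ "rep_bound\<^sup>2"])
    show "AE z in lebesgue_on {0<..<xs}. norm ((representer xs muf phi pI p0 T H0 u z)\<^sup>2) \<le> rep_bound\<^sup>2"
      using representer_bound by (intro AE_I2) (auto simp: abs_le_square_iff[symmetric] intro: order_trans[OF _ abs_ge_self])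
  qed (use m in measurable)
  then show ?thesis using m by (simp add: L2_def)
qed

end

section \<open>Duality between the representer and the linearised pressure\<close>

context observation begin

sublocale PTX: finite_measure "MT \<Otimes>\<^sub>M MX"
  by (rule finite_measure_pair_measure) unfold_locales

lemma TX_integrable:
  fixes f :: "real \<Rightarrow> real \<Rightarrow> real"
  assumes "(\<lambda>p. f (fst p) (snd p)) \<in> borel_measurable (MT \<Otimes>\<^sub>M MX)"
    "\<And>t x. 0 < t \<Longrightarrow> t \<le> T \<Longrightarrow> 0 < x \<Longrightarrow> x < xs \<Longrightarrow> \<bar>f t x\<bar> \<le> B"
  shows "integrable (MT \<Otimes>\<^sub>M MX) (\<lambda>p. f (fst p) (snd p))"
  by (rule PTX.integrable_const_bound[OF _ assms(1), of B])
     (use assms(2) in \<open>auto intro!: AE_I2 simp: space_restrict_space space_pair_measure\<close>)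

lemma iterated_eq_product_integral:
  fixes f :: "real \<Rightarrow> real \<Rightarrow> real"
  assumes "integrable (MT \<Otimes>\<^sub>M MX) (\<lambda>p. f (fst p) (snd p))"
  shows "(LINT t|MT. LINT x|MX. f t x) = (LINT p|(MT \<Otimes>\<^sub>M MX). f (fst p) (snd p))"
  using TX.integral_fst[of f] assms by (simp add: split_beta')

lemma normalized_pressure_le:
  assumes "0 < t" "0 < x" "x < xs" shows "\<bar>N x t\<bar> \<le> 1"
proof -
  have "0 \<le> F x / F (Y t)" using F_nonneg[of x] F_front_pos[of t] assms by simp
  then show ?thesis by (simp add: normalized_pressure_def min_def)
qed

definition weighted_pressure :: real where
  "weighted_pressure = (LINT p|(MT \<Otimes>\<^sub>M MX). H (snd p, fst p) * (p0 + (pI - p0) * N (snd p) (fst p)))"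

lemma weighted_pressure_integrable:
  "integrable (MT \<Otimes>\<^sub>M MX) (\<lambda>p. H (snd p, fst p) * (p0 + (pI - p0) * N (snd p) (fst p)))"
proof (rule TX_integrable[of "\<lambda>t x. H (x, t) * (p0 + (pI - p0) * N x t)" "C * (\<bar>p0\<bar> + (pI - p0) * 1)"])
  fix t x :: real assume "0 < t" "t \<le> T" "0 < x" "x < xs"
  then have "\<bar>N x t\<bar> \<le> 1" by (intro normalized_pressure_le)
  then have "\<bar>(pI - p0) * N x t\<bar> \<le> (pI - p0) * 1" unfolding abs_mult using pressures by (intro mult_mono) auto
  then have "\<bar>p0 + (pI - p0) * N x t\<bar> \<le> \<bar>p0\<bar> + (pI - p0) * 1" by linarith
  then show "\<bar>H (x, t) * (p0 + (pI - p0) * N x t)\<bar> \<le> C * (\<bar>p0\<bar> + (pI - p0) * 1)"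
    unfolding abs_mult using H_le C_nonneg by (intro mult_mono) auto
qed measurable

lemma observation_eq_weighted_pressure:
  "(LINT t:{0<..T}|lebesgue. LINT x:{0<..<xs}|lebesgue. H0 (x, t) * pressure xs muf phi pI p0 u x t) = weighted_pressure"
  unfolding observation_eq weighted_pressure_def
  by (rule iterated_eq_product_integral[OF weighted_pressure_integrable])

text \<open>The points at which the pressure need not be differentiable: the filling time, and for each other time one position.\<close>

lemma AE_off_front:
  "AE p in MT \<Otimes>\<^sub>M MX. fst p \<noteq> \<tau> \<and> snd p \<noteq> Y (fst p)"
proof (rule TX.AE_pair_measure)
  show "{p \<in> space (MT \<Otimes>\<^sub>M MX). fst p \<noteq> \<tau> \<and> snd p \<noteq> Y (fst p)} \<in> sets (MT \<Otimes>\<^sub>M MX)"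
    by measurable
  have "AE t in MT. t \<noteq> \<tau>" by (rule AE_lborel_on_neq) simp
  then show "AE t in MT. AE x in MX. fst (t, x) \<noteq> \<tau> \<and> snd (t, x) \<noteq> Y (fst (t, x))"
  proof (rule eventually_mono)
    fix t assume "t \<noteq> \<tau>"
    moreover have "AE x in MX. x \<noteq> Y t" by (rule AE_lborel_on_neq) simp
    ultimately show "AE x in MX. fst (t, x) \<noteq> \<tau> \<and> snd (t, x) \<noteq> Y (fst (t, x))" by simp
  qed
qed

end

locale observed_perturbation = observation + perturbation
begin

sublocale vo: observation xs "M * exp 1" "\<lambda>x. u x + h x" muf phi pI p0 T C H0 H
  by unfold_locales (use T_pos H_borel H_le H0_AE in auto)

lemma h_measurable [measurable]: "h \<in> borel_measurable MX"
  by (rule continuous_measurable_lborel_on[OF h_cont]) auto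

lemma exp_h_cont: "continuous_on {0..xs} (\<lambda>z. exp (- u z) * h z)"
  by (intro continuous_on_mult exp_cont h_cont)

lemma exp_h_le: "0 < z \<Longrightarrow> z < xs \<Longrightarrow> \<bar>exp (- u z) * h z\<bar> \<le> M * \<eta>"
  unfolding abs_mult using exp_upper[of z] h_le[of z] M_ge_1 by (intro mult_mono) auto

lemma dN_eq_kern_integral:
  assumes t: "0 < t" and x: "0 < x" "x < xs"
  shows "(LINT z|MX. kern t x z * (exp (- u z) * h z)) = dN x t"
proof (cases "x < Y t")
  case True
  define g where "g z = exp (- u z) * h z" for z
  define y where "y = Y t"
  define q where "q = F y"
  define b where "b = of_bool (t < \<tau>) * exp (- u y) * F x / q ^ 3"
  have y: "0 < y" "y \<le> xs" using front_range[OF t] by (auto simp: y_def)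
  have q: "0 < q" using F_front_pos[OF t] by (simp add: q_def y_def)
  have g: "continuous_on {0..xs} g" unfolding g_def by (rule exp_h_cont)
  have yg: "continuous_on {0..xs} (\<lambda>z. (y - z) * g z)" by (intro continuous_intros g)
  have [measurable]: "g \<in> borel_measurable MX" unfolding g_def by measurable
  have gb: "\<bar>g z\<bar> \<le> M * \<eta>" if "0 < z" "z < xs" for z using exp_h_le[OF that] by (simp add: g_def)
  have B0: "0 \<le> M * \<eta>" using M_ge_1 \<eta>_pos by simp
  have i1: "integrable MX (\<lambda>z. of_bool (z \<le> x) * g z)"
    by (rule MX_integrable[of _ "M * \<eta>"]) (use gb B0 in \<open>auto simp: of_bool_def\<close>)
  have i2: "integrable MX (\<lambda>z. of_bool (z < y) * g z)"
    by (rule MX_integrable[of _ "M * \<eta>"]) (use gb B0 in \<open>auto simp: of_bool_def\<close>)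
  have i3: "integrable MX (\<lambda>z. of_bool (z < y) * ((y - z) * g z))"
  proof (rule MX_integrable[of _ "xs * (M * \<eta>)"])
    fix z assume z: "0 < z" "z < xs"
    have "\<bar>y - z\<bar> \<le> xs" using z y by auto
    then have "\<bar>(y - z) * g z\<bar> \<le> xs * (M * \<eta>)" unfolding abs_mult using gb[OF z] xs_pos by (intro mult_mono) auto
    then show "\<bar>of_bool (z < y) * ((y - z) * g z)\<bar> \<le> xs * (M * \<eta>)" using B0 xs_pos by (auto simp: of_bool_def)
  qed measurable
  have kern: "kern t x z * (exp (- u z) * h z) = 1 / q * (of_bool (z \<le> x) * g z)
      - F x / q\<^sup>2 * (of_bool (z < y) * g z) + b * (of_bool (z < y) * ((y - z) * g z))" for z
    using True by (auto simp: kern_def g_def y_def q_def b_def field_simps)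
  have "(LINT z|MX. kern t x z * (exp (- u z) * h z)) = 1 / q * integral {0..x} g
      - F x / q\<^sup>2 * integral {0..y} g + b * integral {0..y} (\<lambda>z. (y - z) * g z)"
    unfolding kern using i1 i2 i3 x y
    by (simp add: integral_lborel_on_Ioo_below[OF g] integral_lborel_on_Ioo_below[OF yg])
  also have "\<dots> = dN x t"
    using True q by (simp add: dN_def dflux_def dF_def dW_def g_def[abs_def] y_def q_def b_def field_simps power2_eq_square power3_eq_cube)
  finally show ?thesis .
next
  case False
  then show ?thesis by (simp add: kern_def dN_def)
qed

lemma dN_measurable [measurable]: "(\<lambda>p. dN (snd p) (fst p)) \<in> borel_measurable (MT \<Otimes>\<^sub>M MX)"
proof -
  have "(\<lambda>p. LINT z|MX. kern (fst p) (snd p) z * (exp (- u z) * h z)) \<in> borel_measurable (MT \<Otimes>\<^sub>M MX)"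
    unfolding kern_def by measurable
  then show ?thesis
    by (subst measurable_cong[OF dN_eq_kern_integral[symmetric]]) (auto simp: space_restrict_space space_pair_measure)
qed

lemma dN_integrable: "integrable (MT \<Otimes>\<^sub>M MX) (\<lambda>p. H (snd p, fst p) * dN (snd p) (fst p))"
proof (rule TX_integrable[of "\<lambda>t x. H (x, t) * dN x t" "C * (3 * M\<^sup>2 * \<eta>)"])
  fix t x :: real assume "0 < t" "t \<le> T" "0 < x" "x < xs"
  then have "\<bar>dN x t\<bar> \<le> 3 * M\<^sup>2 * \<eta>" by (intro dN_le) auto
  then show "\<bar>H (x, t) * dN x t\<bar> \<le> C * (3 * M\<^sup>2 * \<eta>)"
    unfolding abs_mult using H_le C_nonneg by (intro mult_mono) auto
qed measurable

lemma response_duality: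
  assumes t: "0 < t"
  shows "(LINT z|MX. response t z * (exp (- u z) * h z)) = (LINT x|MX. H (x, t) * dN x t)"
proof -
  interpret PXX: finite_measure "MX \<Otimes>\<^sub>M MX" by (rule finite_measure_pair_measure) unfold_locales
  have q: "0 < F (Y t)" by (rule F_front_pos[OF t])
  have int: "integrable (MX \<Otimes>\<^sub>M MX) (case_prod (\<lambda>x z. H (x, t) * kern t x z * (exp (- u z) * h z)))"
  proof (rule PXX.integrable_const_bound[of _ "C * (3 * M\<^sup>2 / F (Y t)) * (M * \<eta>)"])
    show "AE p in MX \<Otimes>\<^sub>M MX. norm (case_prod (\<lambda>x z. H (x, t) * kern t x z * (exp (- u z) * h z)) p)
        \<le> C * (3 * M\<^sup>2 / F (Y t)) * (M * \<eta>)"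
    proof (rule AE_I2)
      fix p assume "p \<in> space (MX \<Otimes>\<^sub>M MX)"
      then obtain x z where p: "p = (x, z)" "0 < x" "x < xs" "0 < z" "z < xs"
        by (auto simp: space_pair_measure space_restrict_space)
      have "\<bar>kern t x z\<bar> \<le> 3 * M\<^sup>2 / F (Y t)"
        using abs_kern_le[OF t p(2,3,4)] q by (auto simp: of_bool_def split: if_splits)
      then have "\<bar>H (x, t) * kern t x z * (exp (- u z) * h z)\<bar> \<le> C * (3 * M\<^sup>2 / F (Y t)) * (M * \<eta>)"
        unfolding abs_mult[of _ "exp _ * _"] abs_mult[of "H _"]
        using H_le exp_h_le[OF p(4,5)] C_nonneg q by (intro mult_mono) auto
      then show "norm (case_prod (\<lambda>x z. H (x, t) * kern t x z * (exp (- u z) * h z)) p)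
        \<le> C * (3 * M\<^sup>2 / F (Y t)) * (M * \<eta>)" by (simp add: p)
    qed
    show "case_prod (\<lambda>x z. H (x, t) * kern t x z * (exp (- u z) * h z)) \<in> borel_measurable (MX \<Otimes>\<^sub>M MX)"
      unfolding kern_def split_beta' by measurable
  qed
  have "(LINT z|MX. response t z * (exp (- u z) * h z))
      = (LINT z|MX. LINT x|MX. H (x, t) * kern t x z * (exp (- u z) * h z))"
    by (simp add: response_def)
  also have "\<dots> = (LINT x|MX. LINT z|MX. H (x, t) * kern t x z * (exp (- u z) * h z))"
    by (rule XX.Fubini_integral[OF int])
  also have "\<dots> = (LINT x|MX. H (x, t) * (LINT z|MX. kern t x z * (exp (- u z) * h z)))"
    by (simp add: mult.assoc)
  also have "\<dots> = (LINT x|MX. H (x, t) * dN x t)"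
    by (rule Bochner_Integration.integral_cong) (auto simp: space_restrict_space dN_eq_kern_integral[OF t])
  finally show ?thesis .
qed

text \<open>Fubini's theorem in \<open>(t, z)\<close>; the interchange of \<open>x\<close> and \<open>z\<close> at fixed time is
\<open>response_duality\<close>. The order matters: the triple integrand is unbounded near \<open>t = 0\<close>, but
it is bounded after integration over \<open>x\<close>.\<close>

lemma representer_duality:
  "(LINT z|MX. representer xs muf phi pI p0 T H0 u z * h z)
   = (pI - p0) * (LINT p|(MT \<Otimes>\<^sub>M MX). H (snd p, fst p) * dN (snd p) (fst p))"
proof -
  have int: "integrable (MT \<Otimes>\<^sub>M MX) (case_prod (\<lambda>t z. response t z * (exp (- u z) * h z)))"
    unfolding split_beta'
  proof (rule TX_integrable[of "\<lambda>t z. response t z * (exp (- u z) * h z)" "3 * C * M ^ 3 * (M * \<eta>)"])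
    fix t z :: real assume *: "0 < t" "t \<le> T" "0 < z" "z < xs"
    show "\<bar>response t z * (exp (- u z) * h z)\<bar> \<le> 3 * C * M ^ 3 * (M * \<eta>)"
      unfolding abs_mult[of "response t z"]
      using abs_response_le[of t z] exp_h_le[of z] * C_nonneg M_ge_1 by (intro mult_mono) auto
  qed measurable
  have "(LINT z|MX. representer xs muf phi pI p0 T H0 u z * h z)
      = (LINT z|MX. (pI - p0) * (LINT t|MT. response t z * (exp (- u z) * h z)))"
    by (rule Bochner_Integration.integral_cong) (auto simp: space_restrict_space representer_eq)
  also have "\<dots> = (pI - p0) * (LINT z|MX. LINT t|MT. response t z * (exp (- u z) * h z))"
    by simp
  also have "(LINT z|MX. LINT t|MT. response t z * (exp (- u z) * h z))
      = (LINT t|MT. LINT z|MX. response t z * (exp (- u z) * h z))"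
    by (rule TX.Fubini_integral[OF int])
  also have "\<dots> = (LINT t|MT. LINT x|MX. H (x, t) * dN x t)"
    by (rule Bochner_Integration.integral_cong) (auto simp: space_restrict_space response_duality)
  also have "\<dots> = (LINT p|(MT \<Otimes>\<^sub>M MX). H (snd p, fst p) * dN (snd p) (fst p))"
    by (rule iterated_eq_product_integral[OF dN_integrable])
  finally show ?thesis .
qed

lemma remainder_eq:
  "vo.weighted_pressure - weighted_pressure - (LINT z|MX. representer xs muf phi pI p0 T H0 u z * h z)
   = (pI - p0) * \<eta> * (LINT p|(MT \<Otimes>\<^sub>M MX). H (snd p, fst p) * ((v.N (snd p) (fst p) - N (snd p) (fst p) - dN (snd p) (fst p)) / \<eta>))"
proof -
  have "vo.weighted_pressure - weighted_pressure - (LINT z|MX. representer xs muf phi pI p0 T H0 u z * h z)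
    = (LINT p|(MT \<Otimes>\<^sub>M MX). H (snd p, fst p) * (p0 + (pI - p0) * v.N (snd p) (fst p))
        - H (snd p, fst p) * (p0 + (pI - p0) * N (snd p) (fst p)) - (pI - p0) * (H (snd p, fst p) * dN (snd p) (fst p)))"
    unfolding representer_duality vo.weighted_pressure_def weighted_pressure_def
    using vo.weighted_pressure_integrable weighted_pressure_integrable dN_integrable
    by simp
  also have "\<dots> = (LINT p|(MT \<Otimes>\<^sub>M MX). ((pI - p0) * \<eta>) * (H (snd p, fst p) * ((v.N (snd p) (fst p) - N (snd p) (fst p) - dN (snd p) (fst p)) / \<eta>)))"
    using \<eta>_pos by (intro Bochner_Integration.integral_cong) (auto simp: field_simps)
  finally show ?thesis by simp
qed

lemma remainder_measurable:
  "(\<lambda>p. H (snd p, fst p) * ((v.N (snd p) (fst p) - N (snd p) (fst p) - dN (snd p) (fst p)) / \<eta>)) \<in> borel_measurable (MT \<Otimes>\<^sub>M MX)"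
  using vo.normalized_pressure_measurable by measurable

lemma remainder_integrand_le:
  assumes t: "0 < t" and x: "0 < x" "x < xs"
  shows "\<bar>H (x, t) * ((v.N x t - N x t - dN x t) / \<eta>)\<bar> \<le> C * (31 * M\<^sup>2)"
proof -
  have "\<bar>v.N x t - N x t - dN x t\<bar> \<le> 31 * M\<^sup>2 * \<eta>"
    using normalized_pressure_perturbation[OF t, of x] dN_le[OF t, of x] x by simp
  then have "\<bar>(v.N x t - N x t - dN x t) / \<eta>\<bar> \<le> 31 * M\<^sup>2"
    using \<eta>_pos by (simp add: abs_divide pos_divide_le_eq)
  then show ?thesis unfolding abs_mult[of "H _"] using H_le C_nonneg by (intro mult_mono) auto
qed

end

section \<open>Frechet differentiability\<close>

text \<open>Dominated convergence: the difference quotients of the remainder tend to \<open>0\<close> off a null set and have a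
common bound.\<close>

lemma (in observation) remainder_tendsto:
  assumes P: "\<And>n. perturbation xs M u muf phi pI p0 (h n) (\<eta> n)" and \<eta>: "\<eta> \<longlonglongrightarrow> 0"
  shows "(\<lambda>n. LINT p|(MT \<Otimes>\<^sub>M MX). H (snd p, fst p) *
     ((normalized_pressure xs muf phi pI p0 (\<lambda>x. u x + h n x) (snd p) (fst p) - N (snd p) (fst p)
       - perturbation.dN xs u muf phi pI p0 (h n) (snd p) (fst p)) / \<eta> n)) \<longlonglongrightarrow> 0"
proof -
  have OP: "observed_perturbation xs M u muf phi pI p0 T C H0 H (h n) (\<eta> n)" for n
    by (intro observed_perturbation.intro observation_axioms P)
  have in_box: "0 < fst p \<and> 0 < snd p \<and> snd p < xs" if "p \<in> space (MT \<Otimes>\<^sub>M MX)" for p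
    using that by (auto simp: space_restrict_space space_pair_measure)
  have "(\<lambda>n. LINT p|(MT \<Otimes>\<^sub>M MX). H (snd p, fst p) *
     ((normalized_pressure xs muf phi pI p0 (\<lambda>x. u x + h n x) (snd p) (fst p) - N (snd p) (fst p)
       - perturbation.dN xs u muf phi pI p0 (h n) (snd p) (fst p)) / \<eta> n)) \<longlonglongrightarrow> (LINT p|(MT \<Otimes>\<^sub>M MX). 0)"
  proof (rule integral_dominated_convergence[where w = "\<lambda>_. C * (31 * M\<^sup>2)"])
    show "integrable (MT \<Otimes>\<^sub>M MX) (\<lambda>_. C * (31 * M\<^sup>2))" by simp
    show "AE p in MT \<Otimes>\<^sub>M MX. norm (H (snd p, fst p) *
     ((normalized_pressure xs muf phi pI p0 (\<lambda>x. u x + h n x) (snd p) (fst p) - N (snd p) (fst p)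
       - perturbation.dN xs u muf phi pI p0 (h n) (snd p) (fst p)) / \<eta> n)) \<le> C * (31 * M\<^sup>2)" for n
    proof (rule AE_I2)
      fix p assume "p \<in> space (MT \<Otimes>\<^sub>M MX)"
      then show "norm (H (snd p, fst p) *
     ((normalized_pressure xs muf phi pI p0 (\<lambda>x. u x + h n x) (snd p) (fst p) - N (snd p) (fst p)
       - perturbation.dN xs u muf phi pI p0 (h n) (snd p) (fst p)) / \<eta> n)) \<le> C * (31 * M\<^sup>2)"
        using observed_perturbation.remainder_integrand_le[OF OP, of "fst p" "snd p" n] in_box[of p]
        unfolding real_norm_def by blast
    qed
    show "AE p in MT \<Otimes>\<^sub>M MX. (\<lambda>n. H (snd p, fst p) *
     ((normalized_pressure xs muf phi pI p0 (\<lambda>x. u x + h n x) (snd p) (fst p) - N (snd p) (fst p)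
       - perturbation.dN xs u muf phi pI p0 (h n) (snd p) (fst p)) / \<eta> n)) \<longlonglongrightarrow> 0"
      using AE_off_front AE_space
    proof eventually_elim
      case (elim p)
      then have "(\<lambda>n. (normalized_pressure xs muf phi pI p0 (\<lambda>x. u x + h n x) (snd p) (fst p) - N (snd p) (fst p)
       - perturbation.dN xs u muf phi pI p0 (h n) (snd p) (fst p)) / \<eta> n) \<longlonglongrightarrow> 0"
        using in_box[of p] by (intro normalized_pressure_asymptotics[OF P \<eta>]) auto
      then show ?case by (rule tendsto_mult_right_zero)
    qed
  qed (use observed_perturbation.remainder_measurable[OF OP] in simp_all)
  then show ?thesis by simp
qed

text \<open>Dominated convergence needs sequences, so a failure of uniformity is turned into a sequence of perturbations of size
tending to \<open>0\<close> with remainders that are too large. The bound \<open>\<eta>\<close> need not be the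
supremum of \<open>\<bar>h\<bar>\<close>; this leaves room for a multiple of the Cameron--Martin norm, and for
\<open>h = 0\<close>.\<close>

lemma (in observation) sup_norm_differentiability:
  fixes \<epsilon> :: real
  defines "G \<equiv> \<lambda>v. LINT t:{0<..T}|lebesgue. LINT x:{0<..<xs}|lebesgue. H0 (x, t) * pressure xs muf phi pI p0 v x t"
  assumes \<epsilon>: "0 < \<epsilon>"
  shows "\<exists>\<delta>>0. \<forall>h \<eta>. continuous_on {0..xs} h \<longrightarrow> 0 < \<eta> \<longrightarrow> \<eta> < \<delta> \<longrightarrow> (\<forall>x\<in>{0..xs}. \<bar>h x\<bar> \<le> \<eta>) \<longrightarrow>
     \<bar>G (\<lambda>x. u x + h x) - G u - (LINT z|MX. representer xs muf phi pI p0 T H0 u z * h z)\<bar> \<le> \<epsilon> * \<eta>"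
    (is "\<exists>\<delta>>0. ?P \<delta>")
proof (rule ccontr)
  assume contra: "\<not> ?thesis"
  \<comment> \<open>The factor \<open>1 / (28 * M\<^sup>2)\<close> enforces the smallness condition of the locale \<open>perturbation\<close>.\<close>
  define \<delta> where "\<delta> n = 1 / (28 * M\<^sup>2) * (1 / real (Suc n))" for n
  have \<delta>: "0 < \<delta> n" for n using M_ge_1 by (simp add: \<delta>_def)
  define bad where "bad n h \<eta> \<longleftrightarrow> continuous_on {0..xs} h \<and> 0 < \<eta> \<and> \<eta> < \<delta> n \<and> (\<forall>x\<in>{0..xs}. \<bar>h x\<bar> \<le> \<eta>) \<and>
     \<epsilon> * \<eta> < \<bar>G (\<lambda>x. u x + h x) - G u - (LINT z|MX. representer xs muf phi pI p0 T H0 u z * h z)\<bar>" for n h \<eta>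
  have ex_bad: "\<exists>p. bad n (fst p) (snd p)" for n
  proof (rule ccontr)
    assume none: "\<nexists>p. bad n (fst p) (snd p)"
    have "?P (\<delta> n)"
    proof (intro allI impI, rule ccontr)
      fix h \<eta>
      assume "continuous_on {0..xs} h" "0 < \<eta>" "\<eta> < \<delta> n" "\<forall>x\<in>{0..xs}. \<bar>h x\<bar> \<le> \<eta>"
        "\<not> \<bar>G (\<lambda>x. u x + h x) - G u - (LINT z|MX. representer xs muf phi pI p0 T H0 u z * h z)\<bar> \<le> \<epsilon> * \<eta>"
      then have "bad n h \<eta>" unfolding bad_def not_le by (intro conjI)
      then have "bad n (fst (h, \<eta>)) (snd (h, \<eta>))" by simp
      then have "\<exists>p. bad n (fst p) (snd p)" by (rule exI)
      with none show False by (rule notE)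
    qed
    with \<delta>[of n] have "\<exists>\<delta>>0. ?P \<delta>" by (intro exI conjI)
    with contra show False by (rule notE)
  qed
  define p where "p n = (SOME p. bad n (fst p) (snd p))" for n
  have p: "bad n (fst (p n)) (snd (p n))" for n
    unfolding p_def by (rule someI_ex[OF ex_bad])
  define h where "h n = fst (p n)" for n
  define \<eta> where "\<eta> n = snd (p n)" for n
  have bad: "bad n (h n) (\<eta> n)" for n using p by (simp add: h_def \<eta>_def)
  have \<eta>\<delta>: "0 < \<eta> n" "\<eta> n < \<delta> n" for n using bad by (auto simp: bad_def)
  have small: "28 * M\<^sup>2 * \<eta> n \<le> 1" for n
  proof -
    have "28 * M\<^sup>2 * \<eta> n \<le> 28 * M\<^sup>2 * \<delta> n" using \<eta>\<delta>(2)[of n] M_ge_1 by (intro mult_left_mono) auto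
    also have "\<dots> \<le> 1" using M_ge_1 by (simp add: \<delta>_def)
    finally show ?thesis .
  qed
  have P: "perturbation xs M u muf phi pI p0 (h n) (\<eta> n)" for n
    by (intro perturbation.intro perturbation_axioms.intro injection_axioms)
       (use bad[of n] small[of n] in \<open>auto simp: bad_def\<close>)
  have "\<delta> \<longlonglongrightarrow> 1 / (28 * M\<^sup>2) * 0"
    unfolding \<delta>_def by (intro tendsto_mult tendsto_const LIMSEQ_Suc[OF lim_1_over_n])
  then have "\<delta> \<longlonglongrightarrow> 0" by simp
  then have \<eta>_lim: "\<eta> \<longlonglongrightarrow> 0"
  proof (rule Lim_null_comparison[rotated])
    have "norm (\<eta> n) \<le> \<delta> n" for n using \<eta>\<delta>[of n] by simp
    then show "\<forall>\<^sub>F n in sequentially. norm (\<eta> n) \<le> \<delta> n" by simp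
  qed
  define I where "I n = (LINT p|(MT \<Otimes>\<^sub>M MX). H (snd p, fst p) *
     ((normalized_pressure xs muf phi pI p0 (\<lambda>x. u x + h n x) (snd p) (fst p) - N (snd p) (fst p)
       - perturbation.dN xs u muf phi pI p0 (h n) (snd p) (fst p)) / \<eta> n))" for n
  have "I \<longlonglongrightarrow> 0" unfolding I_def by (rule remainder_tendsto[OF P \<eta>_lim])
  then have "(\<lambda>n. \<bar>I n\<bar>) \<longlonglongrightarrow> 0" by (rule tendsto_rabs_zero)
  then have "\<forall>\<^sub>F n in sequentially. \<bar>I n\<bar> < \<epsilon> / (pI - p0)"
    using \<epsilon> pressures by (intro order_tendstoD(2)) auto
  then obtain n where n: "\<bar>I n\<bar> < \<epsilon> / (pI - p0)" using eventually_happens'[OF sequentially_bot] by blast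
  have OP: "observed_perturbation xs M u muf phi pI p0 T C H0 H (h n) (\<eta> n)"
    by (intro observed_perturbation.intro observation_axioms P)
  interpret OP: observed_perturbation xs M u muf phi pI p0 T C H0 H "h n" "\<eta> n" by (rule OP)
  have "G (\<lambda>x. u x + h n x) - G u - (LINT z|MX. representer xs muf phi pI p0 T H0 u z * h n z)
      = (pI - p0) * \<eta> n * I n"
    unfolding G_def observation_eq_weighted_pressure OP.vo.observation_eq_weighted_pressure I_def
    by (rule OP.remainder_eq)
  then have "\<bar>G (\<lambda>x. u x + h n x) - G u - (LINT z|MX. representer xs muf phi pI p0 T H0 u z * h n z)\<bar>
      = \<eta> n * ((pI - p0) * \<bar>I n\<bar>)"
    using pressures \<eta>\<delta>(1)[of n] by (simp add: abs_mult)
  also have "\<dots> \<le> \<eta> n * \<epsilon>"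
    using n pressures \<eta>\<delta>(1)[of n] by (intro mult_left_mono) (auto simp: field_simps)
  finally show False using bad[of n] by (simp add: bad_def mult.commute)
qed

text \<open>A Borel version is truncated at the essential bound; the exceptional null set of the plane is then cut into sections,
almost all of which are null.\<close>

lemma Linfty_borel_representative:
  assumes f: "f \<in> Linfty ({0<..<xs} \<times> {0<..T})"
  shows "\<exists>H C. H \<in> borel_measurable (borel \<Otimes>\<^sub>M borel) \<and> (\<forall>z. \<bar>H z\<bar> \<le> C) \<and>
    (AE t in lborel. AE x in lborel. 0 < x \<and> x < xs \<and> 0 < t \<and> t \<le> T \<longrightarrow> f (x, t) = H (x, t))"
proof -
  let ?S = "{0<..<xs} \<times> {0<..T}"
  have "?S \<in> sets (borel \<Otimes>\<^sub>M borel)" by (intro pair_measureI) auto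
  then have S: "?S \<in> sets lborel" unfolding borel_prod sets_lborel .
  have S': "?S \<in> sets lebesgue" using S by (intro sets_completionI_sets) simp
  obtain C where C: "AE z in lebesgue_on ?S. \<bar>f z\<bar> \<le> C" and fm: "f \<in> borel_measurable (lebesgue_on ?S)"
    using f by (auto simp: Linfty_def)
  have "(\<lambda>z. indicator ?S z *\<^sub>R f z) \<in> borel_measurable lebesgue"
    using fm S' by (subst borel_measurable_restrict_space_iff[symmetric]) auto
  then obtain g where g: "g \<in> borel_measurable lborel" "AE z in lborel. indicator ?S z *\<^sub>R f z = g z"
    using completion_ex_borel_measurable_real by blast
  have "AE z in lebesgue. z \<in> ?S \<longrightarrow> \<bar>f z\<bar> \<le> C"
    using C S' by (subst (asm) AE_restrict_space_iff) auto
  then have C': "AE z in lborel. z \<in> ?S \<longrightarrow> \<bar>f z\<bar> \<le> C" by (simp add: AE_completion_iff)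
  define H where "H z = max (- \<bar>C\<bar>) (min \<bar>C\<bar> (g z))" for z
  have [measurable]: "g \<in> borel_measurable borel" using g(1) by simp
  have Hm: "H \<in> borel_measurable borel" unfolding H_def[abs_def] by measurable
  have "AE z in lborel. z \<in> ?S \<longrightarrow> f z = H z"
    using g(2) C' by eventually_elim (auto simp: H_def)
  then obtain Z where Z: "{z \<in> space lborel. \<not> (z \<in> ?S \<longrightarrow> f z = H z)} \<subseteq> Z" "emeasure lborel Z = 0" "Z \<in> sets lborel"
    by (rule AE_E)
  have eqH: "f z = H z" if "z \<in> ?S" "z \<notin> Z" for z
  proof (rule ccontr)
    assume "f z \<noteq> H z"
    then have "z \<in> {z \<in> space lborel. \<not> (z \<in> ?S \<longrightarrow> f z = H z)}" using that(1) by simp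
    with Z(1) that(2) show False by (meson subsetD)
  qed
  have Zp: "Z \<in> sets (lborel \<Otimes>\<^sub>M lborel)" using Z(3) by (simp only: lborel_prod)
  have "AE z in lborel. z \<notin> Z" using Z(2,3) by (intro AE_not_in) auto
  then have "AE z in lborel \<Otimes>\<^sub>M lborel. z \<notin> Z" by (simp only: lborel_prod)
  then have "AE x in lborel. AE t in lborel. (x, t) \<notin> Z" by (rule lborel_pair.AE_pair)
  then have "AE t in lborel. AE x in lborel. (x, t) \<notin> Z"
  proof (subst (asm) lborel_pair.AE_commute)
    have "{z \<in> space (lborel \<Otimes>\<^sub>M lborel). (fst z, snd z) \<notin> Z} = space (lborel \<Otimes>\<^sub>M lborel) - Z" by auto
    then show "{z \<in> space (lborel \<Otimes>\<^sub>M lborel). (fst z, snd z) \<notin> Z} \<in> sets (lborel \<Otimes>\<^sub>M lborel)"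
      using sets.compl_sets[OF Zp] by simp
  qed
  then have AE: "AE t in lborel. AE x in lborel. 0 < x \<and> x < xs \<and> 0 < t \<and> t \<le> T \<longrightarrow> f (x, t) = H (x, t)"
  proof (rule eventually_mono)
    fix t assume "AE x in lborel. (x, t) \<notin> Z"
    then show "AE x in lborel. 0 < x \<and> x < xs \<and> 0 < t \<and> t \<le> T \<longrightarrow> f (x, t) = H (x, t)"
      by (rule eventually_mono) (use eqH in auto)
  qed
  show ?thesis
  proof (intro exI conjI allI)
    show "H \<in> borel_measurable (borel \<Otimes>\<^sub>M borel)" using Hm by (simp only: borel_prod)
    show "\<bar>H z\<bar> \<le> \<bar>C\<bar>" for z by (auto simp: H_def)
  qed (rule AE)
qed

theorem theorem3p2:
  fixes xs T muf phi pI p0 sig kap nu :: real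
    and H :: "'m::finite \<Rightarrow> real \<times> real \<Rightarrow> real"
    and e :: "nat \<Rightarrow> real \<Rightarrow> real" and lam :: "nat \<Rightarrow> real"
  assumes "xs > 0" and "T > 0" and "muf > 0" and "phi > 0" and "pI > p0"
    and "sig > 0" and "kap > 0" and "nu > 1/2"
    and "laplace_eigenbasis xs e lam" and "\<forall>k. kap\<^sup>2 + lam k > 0"
    and "\<forall>i. H i \<in> Linfty ({0<..<xs} \<times> {0<..T})"
  shows "\<forall>i. \<forall>u \<in> cm_space xs e (matern_eigenvalue sig kap nu lam).
           representer xs muf phi pI p0 T (H i) u \<in> L2 {0<..<xs} \<and>
           has_frechet_derivative_over
             (\<lambda>v. observation_map xs muf phi pI p0 T H v $ i)
             (\<lambda>h. L2_inner {0<..<xs} (representer xs muf phi pI p0 T (H i) u) h)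
             u
             (cm_space xs e (matern_eigenvalue sig kap nu lam))
             (cm_norm xs e (matern_eigenvalue sig kap nu lam))"
proof (intro allI ballI)
  fix i u
  let ?E = "cm_space xs e (matern_eigenvalue sig kap nu lam)"
  let ?N = "cm_norm xs e (matern_eigenvalue sig kap nu lam)"
  let ?r = "representer xs muf phi pI p0 T (H i) u"
  assume u: "u \<in> ?E"
  have cont: "continuous_on {0..xs} h" if "h \<in> ?E" for h using that by (simp add: cm_space_def)
  obtain B where B: "B > 0" "\<And>h x. h \<in> ?E \<Longrightarrow> x \<in> {0..xs} \<Longrightarrow> \<bar>h x\<bar> \<le> B * ?N h"
    using cm_space_embeds_continuous[OF assms(9,1,7,8,10), of sig] by blast
  have N0: "0 \<le> ?N h" for h
    unfolding cm_norm_def cm_inner_def by (intro real_sqrt_ge_zero L2_inner_nonneg)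
  define M where "M = exp (B * ?N u)"
  obtain HB C where HB: "HB \<in> borel_measurable (borel \<Otimes>\<^sub>M borel)" "\<forall>z. \<bar>HB z\<bar> \<le> C"
    "AE t in lborel. AE x in lborel. 0 < x \<and> x < xs \<and> 0 < t \<and> t \<le> T \<longrightarrow> H i (x, t) = HB (x, t)"
    using Linfty_borel_representative[OF assms(11)[rule_format, of i]] by (elim exE conjE)
  interpret observation xs M u muf phi pI p0 T C "H i" HB
  proof unfold_locales
    show "1 \<le> M" unfolding M_def using B(1) N0[of u] by simp
    show "1 / M \<le> exp (- u x)" "exp (- u x) \<le> M" if "x \<in> {0..xs}" for x
      using B(2)[OF u that] unfolding M_def by (simp_all add: exp_minus[symmetric] inverse_eq_divide[symmetric] abs_le_iff)
  qed (use assms HB cont[OF u] in auto)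
  have r: "?r \<in> L2 {0<..<xs}" by (rule representer_L2)
  have inner: "L2_inner {0<..<xs} ?r h = (LINT z|MX. ?r z * h z)" if "h \<in> ?E" for h
  proof -
    have "h \<in> borel_measurable MX" by (rule continuous_measurable_lborel_on[OF cont[OF that]]) auto
    then show ?thesis unfolding L2_inner_def
      by (intro integral_lebesgue_on_eq_lborel_on borel_measurable_times representer_measurable) auto
  qed
  have EL2: "h \<in> L2 {0<..<xs}" if "h \<in> ?E" for h by (rule L2_continuous[OF cont[OF that]])
  have linear: "L2_inner {0<..<xs} ?r (\<lambda>x. a * h x + b * k x) = a * L2_inner {0<..<xs} ?r h + b * L2_inner {0<..<xs} ?r k"
    if "h \<in> ?E" "k \<in> ?E" for h k a b
  proof -
    have "L2_inner {0<..<xs} ?r (\<lambda>x. a * h x + b * k x)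
        = (LINT x|lebesgue_on {0<..<xs}. a * (?r x * h x) + b * (?r x * k x))"
      unfolding L2_inner_def by (simp add: algebra_simps)
    also have "\<dots> = a * L2_inner {0<..<xs} ?r h + b * L2_inner {0<..<xs} ?r k"
      using L2_mult_integrable[OF r EL2[OF that(1)]] L2_mult_integrable[OF r EL2[OF that(2)]]
      unfolding L2_inner_def by simp
    finally show ?thesis .
  qed
  have bounded: "\<bar>L2_inner {0<..<xs} ?r h\<bar> \<le> rep_bound * B * xs * ?N h" if h: "h \<in> ?E" for h
  proof -
    have hm: "h \<in> borel_measurable MX" by (rule continuous_measurable_lborel_on[OF cont[OF h]]) auto
    have "\<bar>LINT z|MX. ?r z * h z\<bar> \<le> (LINT z|MX. rep_bound * (B * ?N h))"
    proof (rule MX_integral_le)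
      fix x assume x: "0 < x" "x < xs"
      have "0 \<le> rep_bound" using representer_bound[OF x] abs_ge_zero order_trans by blast
      then show "\<bar>?r x * h x\<bar> \<le> rep_bound * (B * ?N h)"
        unfolding abs_mult using representer_bound[OF x] B(2)[OF h, of x] x by (intro mult_mono) auto
    qed (use hm in \<open>auto intro: borel_measurable_times representer_measurable\<close>)
    also have "\<dots> = rep_bound * B * xs * ?N h"
      using xs_pos by (simp add: measure_restrict_space space_restrict_space)
    finally show ?thesis unfolding inner[OF h] .
  qed
  have remainder: "\<exists>del>0. \<forall>h\<in>?E. ?N h < del \<longrightarrow>
      \<bar>observation_map xs muf phi pI p0 T H (\<lambda>x. u x + h x) $ i - observation_map xs muf phi pI p0 T H u $ i
        - L2_inner {0<..<xs} ?r h\<bar> \<le> eps * ?N h" if eps: "eps > 0" for eps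
  proof -
    let ?R = "\<lambda>h. \<bar>observation_map xs muf phi pI p0 T H (\<lambda>x. u x + h x) $ i - observation_map xs muf phi pI p0 T H u $ i
        - L2_inner {0<..<xs} ?r h\<bar>"
    have div: "0 < eps / B" using eps B(1) by simp
    have obs: "observation_map xs muf phi pI p0 T H v $ i
      = (LINT t:{0<..T}|lebesgue. LINT x:{0<..<xs}|lebesgue. H i (x, t) * pressure xs muf phi pI p0 v x t)" for v
      by (simp add: observation_map_def)
    have "\<exists>\<delta>>0. \<forall>h \<eta>. continuous_on {0..xs} h \<longrightarrow> 0 < \<eta> \<longrightarrow> \<eta> < \<delta> \<longrightarrow> (\<forall>x\<in>{0..xs}. \<bar>h x\<bar> \<le> \<eta>) \<longrightarrow>
      \<bar>observation_map xs muf phi pI p0 T H (\<lambda>x. u x + h x) $ i - observation_map xs muf phi pI p0 T H u $ i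
        - (LINT z|MX. ?r z * h z)\<bar> \<le> eps / B * \<eta>"
      unfolding obs by (rule sup_norm_differentiability[OF div])
    then obtain \<delta> where \<delta>: "\<delta> > 0" and sup: "\<forall>h \<eta>. continuous_on {0..xs} h \<longrightarrow> 0 < \<eta> \<longrightarrow> \<eta> < \<delta> \<longrightarrow> (\<forall>x\<in>{0..xs}. \<bar>h x\<bar> \<le> \<eta>) \<longrightarrow>
      \<bar>observation_map xs muf phi pI p0 T H (\<lambda>x. u x + h x) $ i - observation_map xs muf phi pI p0 T H u $ i
        - (LINT z|MX. ?r z * h z)\<bar> \<le> eps / B * \<eta>"
      by (elim exE conjE)
    have R: "?R h \<le> eps / B * \<eta>" if h: "h \<in> ?E" and "0 < \<eta>" "\<eta> < \<delta>" and le: "\<And>x. x \<in> {0..xs} \<Longrightarrow> \<bar>h x\<bar> \<le> \<eta>" for h \<eta>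
      unfolding inner[OF h] by (rule sup[rule_format]) (use that cont[OF h] in auto)
    show ?thesis
    proof (intro exI[of _ "\<delta> / B"] conjI ballI impI)
      fix h assume h: "h \<in> ?E" and small: "?N h < \<delta> / B"
      have lt: "B * ?N h < \<delta>" using small B(1) by (simp add: pos_less_divide_eq mult.commute)
      have *: "?R h \<le> eps / B * \<eta>" if "B * ?N h < \<eta>" "\<eta> < \<delta>" for \<eta>
      proof (rule R[OF h _ that(2)])
        have "0 \<le> B * ?N h" using N0[of h] B(1) by simp
        then show "0 < \<eta>" using that by linarith
        show "\<bar>h x\<bar> \<le> \<eta>" if "x \<in> {0..xs}" for x using B(2)[OF h that] \<open>B * ?N h < \<eta>\<close> by linarith
      qed
      \<comment> \<open>The bound holds for every \<open>\<eta>\<close> above \<open>B * ?N h\<close>, which may vanish; letting \<open>\<eta>\<close> decrease to it covers that case.\<close>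
      have "?R h * B / eps \<le> B * ?N h"
      proof (rule dense_ge_bounded[OF lt])
        fix \<eta> assume "B * ?N h < \<eta>" "\<eta> < \<delta>"
        then show "?R h * B / eps \<le> \<eta>" using *[of \<eta>] eps B(1) by (simp add: field_simps)
      qed
      then show "?R h \<le> eps * ?N h" using eps B(1) by (simp add: field_simps)
    qed (use \<delta> B(1) in simp)
  qed
  show "?r \<in> L2 {0<..<xs} \<and>
        has_frechet_derivative_over (\<lambda>v. observation_map xs muf phi pI p0 T H v $ i)
          (\<lambda>h. L2_inner {0<..<xs} ?r h) u ?E ?N"
    unfolding has_frechet_derivative_over_def using r linear bounded remainder by blast
qed

end
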